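(* Let $$V=\sum_{i=1}^n|\phi_{\lambda_i}|^2,\qquad \widetilde V=\sum_{i=1}^n|P_N\phi_{\lambda_i}|^2$$ over a region $\mathbb{D}^n(S)$ where the principal eigenfunctions $\{\phi_{\lambda_i}\}_{i=1}^n$ are analytic. If for all $x\in D\subset\mathbb{X}$, $$|V(x)-\widetilde V(x)|<\varepsilon_1,\qquad|\dot V(x)-\dot{\widetilde V}(x)|<\varepsilon_2,$$ and $$\Omega=\{x\in D : \gamma_1<\widetilde V(x)<\gamma_2\}$$ is not empty, then $\Omega$ is an inner approximation of the region of attraction of the origin for $\dot x=F(x)$, with $$\gamma_1=\frac{-\varepsilon_2-2|\lambda_m|\varepsilon_1}{2\lambda_m},\qquad \lambda_m=\max_i\lambda_i^R,$$ and where $\gamma_2$ is the largest level set (that is, the value of the largest level set) of $\widetilde V$ lying in $D$.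
   Context: Setting: $\dot x=F(x)$, $x\in\mathbb{X}$, where $\mathbb{X}\subset\mathbb{R}^n$ is compact and the vector field $F$ is analytic and Lipschitz continuous, with flow map $\varphi^t:\mathbb{X}\to\mathbb{X}$, $t\ge0$. The origin is a locally stable hyperbolic equilibrium, so that the eigenvalues $\lambda_1,\dots,\lambda_n$ of the Jacobian matrix $\mathbf{J}_F(0)$ of $F$ at $0$ have strictly negative real part, and these eigenvalues are non-resonant. The region of attraction of the origin is $\{x\in\mathbb{X}:\varphi^t(x)\to0\text{ as }t\to\infty\}$; an inner approximation of it is a set contained in it. $\mathcal{L}f=F\cdot\nabla f$ is the infinitesimal generator of the Koopman semigroup $f\mapsto f\circ\varphi^t$. The $n$ principal eigenfunctions $\phi_{\lambda_i}$ are the (possibly complex-valued) eigenfunctions of $\mathcal{L}$ associated with the eigenvalues $\lambda_i$ of $\mathbf{J}_F(0)$: $\mathcal{L}\phi_{\lambda_i}=\lambda_i\phi_{\lambda_i}$. Notation: $\mathbb{D}^n(S)=\{x\in\mathbb{R}^n:|x_i|<S\ \forall i\}$ with $S>0$. For $N\in\mathbb{N}$, $P_N$ is the truncation operator that keeps the monomials $x_1^{k_1}\cdots x_n^{k_n}$ with $\sum_i k_i\le N$ and sends all others to $0$, so that $P_Nf$ is the Taylor expansion of an analytic function $f$ at the origin truncated at total degree $N$. $\lambda_i^R=\Re(\lambda_i)$. For a function $W$, $\dot W=\mathcal{L}W=F\cdot\nabla W$ is its derivative along the trajectories of $\dot x=F(x)$. $\varepsilon_1,\varepsilon_2$ are real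 constants. *)

theory Defs
  imports "HOL-Analysis.Analysis"
begin

definition monomial :: "('n::finite \<Rightarrow> nat) \<Rightarrow> real^'n \<Rightarrow> real" where
  "monomial k x = (\<Prod>i\<in>UNIV. (x $ i) ^ k i)"

text \<open>The sum over all multi-indices is unordered, hence absolutely convergent for
  finite-dimensional values; no convergence beyond some small polydisc around \<open>p\<close> is required.\<close>

definition power_series_at ::
  "(real^'n::finite \<Rightarrow> 'b::real_normed_vector) \<Rightarrow> real^'n \<Rightarrow> (('n \<Rightarrow> nat) \<Rightarrow> 'b) \<Rightarrow> bool" where
  "power_series_at f p a \<longleftrightarrow>
     (\<exists>r>0. \<forall>x. (\<forall>i. \<bar>x $ i - p $ i\<bar> < r) \<longrightarrow>
        ((\<lambda>k. monomial k (x - p) *\<^sub>R a k) has_sum f x) UNIV)"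

text \<open>For a set \<open>A\<close> that is not open this means, as usual, that \<open>f\<close> is analytic on a
  full neighbourhood of each point of \<open>A\<close>.\<close>

definition real_analytic_on ::
  "(real^'n::finite \<Rightarrow> 'b::real_normed_vector) \<Rightarrow> (real^'n) set \<Rightarrow> bool" where
  "real_analytic_on f A \<longleftrightarrow> (\<forall>p\<in>A. \<exists>a. power_series_at f p a)"

text \<open>Well defined when \<open>f\<close> is analytic at the origin, since the coefficients of a power
  series are determined by its sum near the centre.\<close>

definition taylor_coeffs ::
  "(real^'n::finite \<Rightarrow> 'b::real_normed_vector) \<Rightarrow> ('n \<Rightarrow> nat) \<Rightarrow> 'b" where
  "taylor_coeffs f = (THE a. power_series_at f 0 a)"

definition truncation ::
  "nat \<Rightarrow> (real^'n::finite \<Rightarrow> 'b::real_normed_vector) \<Rightarrow> real^'n \<Rightarrow> 'b" where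
  "truncation N f x = (\<Sum>k | (\<Sum>i\<in>UNIV. k i) \<le> N. monomial k x *\<^sub>R taylor_coeffs f k)"

definition cube :: "real \<Rightarrow> (real^'n::finite) set" where
  "cube S = {x. \<forall>i. \<bar>x $ i\<bar> < S}"

definition is_flow ::
  "(real^'n::finite \<Rightarrow> real^'n) \<Rightarrow> (real^'n) set \<Rightarrow> (real \<Rightarrow> real^'n \<Rightarrow> real^'n) \<Rightarrow> bool" where
  "is_flow F X flow \<longleftrightarrow>
     (\<forall>x\<in>X. flow 0 x = x \<and>
        (\<forall>t\<ge>0. flow t x \<in> X \<and>
           ((\<lambda>s. flow s x) has_vector_derivative F (flow t x)) (at t within {0..})))"

definition region_of_attraction ::
  "(real^'n::finite) set \<Rightarrow> (real \<Rightarrow> real^'n \<Rightarrow> real^'n) \<Rightarrow> (real^'n) set" where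
  "region_of_attraction X flow = {x\<in>X. ((\<lambda>t. flow t x) \<longlongrightarrow> 0) at_top}"

text \<open>\<open>lam\<close> lists the complex eigenvalues of \<open>A\<close>, repeated according to
  algebraic multiplicity: the characteristic polynomial factors accordingly.\<close>

definition eigenvalue_family :: "real^'n^'n::finite \<Rightarrow> ('n \<Rightarrow> complex) \<Rightarrow> bool" where
  "eigenvalue_family A lam \<longleftrightarrow>
     (\<forall>z. det (mat z - map_matrix complex_of_real A) = (\<Prod>i\<in>UNIV. z - lam i))"

definition nonresonant :: "('n::finite \<Rightarrow> complex) \<Rightarrow> bool" where
  "nonresonant lam \<longleftrightarrow>
     (\<forall>i. \<forall>k :: 'n \<Rightarrow> nat. (\<Sum>j\<in>UNIV. k j) \<ge> 2 \<longrightarrow> lam i \<noteq> (\<Sum>j\<in>UNIV. of_nat (k j) * lam j))"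

text \<open>The directional derivative of \<open>f\<close> along \<open>F\<close>, i.e. \<open>F \<bullet> \<nabla>f\<close>, for real- or
  complex-valued \<open>f\<close>.\<close>

definition generator ::
  "(real^'n::finite \<Rightarrow> real^'n) \<Rightarrow> (real^'n \<Rightarrow> 'b::real_normed_vector) \<Rightarrow> real^'n \<Rightarrow> 'b" where
  "generator F f x = frechet_derivative f (at x) (F x)"

definition eigenfunction ::
  "(real^'n::finite \<Rightarrow> real^'n) \<Rightarrow> (real^'n) set \<Rightarrow> complex \<Rightarrow> (real^'n \<Rightarrow> complex) \<Rightarrow> bool" where
  "eigenfunction F A l f \<longleftrightarrow>
     (\<exists>x\<in>A. f x \<noteq> 0) \<and>
     (\<forall>x\<in>A. f differentiable (at x) \<and> generator F f x = l * f x)"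

text \<open>Linear independence is what makes these \<open>n\<close> eigenfunctions when an eigenvalue is
  repeated; for pairwise distinct eigenvalues it follows from the first conjunct.\<close>

definition principal_eigenfunctions ::
  "(real^'n::finite \<Rightarrow> real^'n) \<Rightarrow> (real^'n) set \<Rightarrow> ('n \<Rightarrow> complex) \<Rightarrow>
   ('n \<Rightarrow> real^'n \<Rightarrow> complex) \<Rightarrow> bool" where
  "principal_eigenfunctions F A lam \<phi> \<longleftrightarrow>
     (\<forall>i. eigenfunction F A (lam i) (\<phi> i)) \<and>
     (\<forall>c :: 'n \<Rightarrow> complex. (\<forall>x\<in>A. (\<Sum>i\<in>UNIV. c i * \<phi> i x) = 0) \<longrightarrow> (\<forall>i. c i = 0))"

text \<open>The values of those nonempty level sets of \<open>W\<close>, regarded as a function on \<open>Q\<close>,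
  that lie in \<open>D\<close>.\<close>

definition levels_in :: "(real^'n::finite \<Rightarrow> real) \<Rightarrow> (real^'n) set \<Rightarrow> (real^'n) set \<Rightarrow> real set" where
  "levels_in W Q D = {c. {x\<in>Q. W x = c} \<noteq> {} \<and> {x\<in>Q. W x = c} \<subseteq> D}"

end

theory Submission
  imports Defs "HOL-Complex_Analysis.Complex_Analysis"
    "HOL-Computational_Algebra.Fundamental_Theorem_Algebra"
begin

text \<open>
  Analyticity and nonresonance force the whole cube on which the principal
  eigenfunctions are defined into the region of attraction; the set \<open>\<Omega>\<close> lies in that cube.

  By nonresonance an eigenfunction cannot have a leading homogeneous part of degree other than
  one, so the differentials of the principal eigenfunctions at the origin are linearly independent
  and \<open>V\<close> is comparable to \<open>|x|\<^sup>2\<close> near the origin. In particular the origin is attracting.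
  Now follow a segment from the origin inside the cube. As long as \<open>s x\<close> is attracted, the
  identity \<open>\<phi> (flow T (s x)) = exp (\<lambda> T) \<phi> (s x)\<close> holds for large \<open>T\<close>, even if the trajectory leaves
  the cube in between: both sides are analytic in \<open>s\<close>, and they agree near \<open>s = 0\<close>. Since \<open>\<phi>\<close> is
  bounded near any point of the cube, the identity bounds the time needed to enter a fixed
  neighbourhood of the origin, so attraction persists in the limit and cannot break down along the
  segment.
\<close>

section \<open>Power series and their complexification\<close>

text \<open>The obstacle is that the eigenfunction equation is available in the cube only, so it
  cannot be integrated along a trajectory that leaves the cube and returns. The remedy is to fix the
  time \<open>T\<close> and to vary the starting point: \<open>F\<close> is analytic on all of
  \<open>X\<close>, so \<open>flow T\<close> depends analytically on the starting point whatever
  happens in between, and only the two endpoints have to lie in the cube. Nonresonance enters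
  through the derivation along \<open>A *v x\<close> on homogeneous polynomials of degree
  \<open>m\<close>: all its eigenvalues are sums of \<open>m\<close> eigenvalues of
  \<open>A\<close>. Analyticity is handled by holomorphic extension in one complex parameter, which
  makes Cauchy estimates, Montel's theorem and the identity theorem available. The waiting time is
  uniform for this reason: if the vector of eigenfunctions has norm at most \<open>M\<close> at the
  starting point, every \<open>T\<close> that makes \<open>exp (lm * T) * M\<close> small enough
  will do, however late the trajectory was first known to arrive.\<close>

definition deg :: "('n::finite \<Rightarrow> nat) \<Rightarrow> nat" where
  "deg k = (\<Sum>i\<in>UNIV. k i)"

definition cvec :: "real^'n \<Rightarrow> complex^'n" where
  "cvec x = (\<chi> i. complex_of_real (x $ i))"

lemma cvec_nth [simp]: "cvec x $ i = complex_of_real (x $ i)"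
  by (simp add: cvec_def)

lemma norm_cvec [simp]: "norm (cvec x) = norm x"
  by (simp add: norm_vec_def)

lemma cvec_simps [simp]: "cvec (x + y) = cvec x + cvec y" "cvec (x - y) = cvec x - cvec y"
    "cvec (r *\<^sub>R x) = r *\<^sub>R cvec x" "cvec 0 = 0"
  by (simp_all add: vec_eq_iff scaleR_conv_of_real[where 'a=complex])

definition cmonomial :: "('n::finite \<Rightarrow> nat) \<Rightarrow> complex^'n \<Rightarrow> complex" where
  "cmonomial k z = (\<Prod>i\<in>UNIV. (z $ i) ^ k i)"

lemma cmonomial_cvec: "cmonomial k (cvec x) = of_real (monomial k x)"
  by (simp add: cmonomial_def monomial_def)

lemma norm_cmonomial_le: "norm (cmonomial k z) \<le> norm z ^ deg k"
proof -
  have "norm (cmonomial k z) = (\<Prod>i\<in>UNIV. norm (z $ i) ^ k i)"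
    by (simp add: cmonomial_def norm_power prod_norm [symmetric])
  also have "\<dots> \<le> (\<Prod>i\<in>UNIV. norm z ^ k i)"
    by (intro prod_mono conjI power_mono) (auto simp: Finite_Cartesian_Product.norm_nth_le)
  also have "\<dots> = norm z ^ deg k"
    by (simp add: deg_def power_sum)
  finally show ?thesis .
qed

lemma abs_monomial_le: "\<bar>monomial k x\<bar> \<le> norm x ^ deg k"
  using norm_cmonomial_le[of k "cvec x"] by (simp add: cmonomial_cvec)

lemma monomial_scaleR: "monomial k (s *\<^sub>R x) = s ^ deg k * monomial k x"
  by (simp add: monomial_def deg_def power_mult_distrib prod.distrib power_sum)

lemma finite_deg_le: "finite {k :: 'n::finite \<Rightarrow> nat. deg k \<le> m}"
proof (rule finite_subset)
  show "{k :: 'n \<Rightarrow> nat. deg k \<le> m} \<subseteq> (UNIV :: 'n set) \<rightarrow>\<^sub>E {..m}"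
  proof
    fix k :: "'n \<Rightarrow> nat" assume k: "k \<in> {k. deg k \<le> m}"
    have "k i \<le> deg k" for i
      unfolding deg_def by (rule member_le_sum) auto
    with k show "k \<in> (UNIV :: 'n set) \<rightarrow>\<^sub>E {..m}"
      by (auto intro: order_trans)
  qed
  show "finite ((UNIV :: 'n set) \<rightarrow>\<^sub>E {..m})"
    by (intro finite_PiE) auto
qed

text \<open>Evaluate the series at the corner \<open>p + u\<close> of a smaller cube: there every
  monomial equals \<open>r ^ deg k\<close>, and unordered summability of complex numbers is
  absolute. The corner thus supplies a majorant for the whole ball of radius \<open>r\<close>;
  halving \<open>r0\<close> keeps it strictly inside.\<close>

lemma power_series_at_summable:
  fixes f :: "real^'n::finite \<Rightarrow> complex"
  assumes "power_series_at f p a"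
  obtains r where "r > 0" "(\<lambda>k. norm (a k) * r ^ deg k) summable_on UNIV"
    "\<And>x. norm (x - p) \<le> r \<Longrightarrow> ((\<lambda>k. monomial k (x - p) *\<^sub>R a k) has_sum f x) UNIV"
proof -
  obtain r0 where r0: "r0 > 0" "\<And>x. (\<forall>i. \<bar>x $ i - p $ i\<bar> < r0) \<Longrightarrow>
        ((\<lambda>k. monomial k (x - p) *\<^sub>R a k) has_sum f x) UNIV"
    using assms unfolding power_series_at_def by blast
  define r where "r = r0 / 2"
  have r: "r > 0" "r < r0" using r0 by (auto simp: r_def)
  define u :: "real^'n" where "u = (\<chi> i. r)"
  have mu: "monomial k u = r ^ deg k" for k
    by (simp add: monomial_def u_def deg_def power_sum)
  have "((\<lambda>k. monomial k (p + u - p) *\<^sub>R a k) has_sum f (p + u)) UNIV"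
    by (rule r0(2)) (use r in \<open>auto simp: u_def\<close>)
  hence "(\<lambda>k. r ^ deg k *\<^sub>R a k) summable_on UNIV"
    by (auto simp: mu summable_on_def)
  hence "(\<lambda>k. norm (r ^ deg k *\<^sub>R a k)) summable_on UNIV"
    by (simp add: summable_on_iff_abs_summable_on_complex)
  hence "(\<lambda>k. norm (a k) * r ^ deg k) summable_on UNIV"
    using r by (simp add: mult.commute)
  moreover have "((\<lambda>k. monomial k (x - p) *\<^sub>R a k) has_sum f x) UNIV" if "norm (x - p) \<le> r" for x
  proof (rule r0(2), rule allI)
    fix i
    show "\<bar>x $ i - p $ i\<bar> < r0"
      using component_le_norm_cart[of "x - p" i] that r by simp
  qed
  ultimately show ?thesis using that r by blast
qed

text \<open>Holomorphy in several variables is only ever tested along curves with one complex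
  parameter, so the one-variable theory suffices.\<close>

definition holo_curve :: "(complex \<Rightarrow> complex^'n) \<Rightarrow> complex set \<Rightarrow> bool" where
  "holo_curve z U \<longleftrightarrow> (\<forall>i. (\<lambda>s. z s $ i) holomorphic_on U)"

text \<open>The extension is the same series summed at complex points. The majorant
  \<open>norm (a k) * r ^ deg k\<close> gives the bound \<open>M\<close> and, by the M-test, uniform
  convergence of the finite partial sums along a holomorphic curve, so the limit is
  holomorphic.\<close>

lemma complexification:
  fixes f :: "real^'n::finite \<Rightarrow> complex"
  assumes "power_series_at f p a"
  obtains r fh M where "r > 0"
    "\<And>x. norm (x - p) \<le> r \<Longrightarrow> fh (cvec x) = f x"
    "\<And>z. norm (z - cvec p) \<le> r \<Longrightarrow> norm (fh z) \<le> M"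
    "\<And>z U. open U \<Longrightarrow> holo_curve z U \<Longrightarrow> (\<And>s. s \<in> U \<Longrightarrow> norm (z s - cvec p) \<le> r) \<Longrightarrow>
       (\<lambda>s. fh (z s)) holomorphic_on U"
proof -
  obtain r where r: "r > 0" and sm: "(\<lambda>k. norm (a k) * r ^ deg k) summable_on UNIV"
    and hs: "\<And>x. norm (x - p) \<le> r \<Longrightarrow> ((\<lambda>k. monomial k (x - p) *\<^sub>R a k) has_sum f x) UNIV"
    by (rule power_series_at_summable[OF assms]) (rule that)
  define t where "t = (\<lambda>z k. cmonomial k (z - cvec p) * a k)"
  define fh where "fh = (\<lambda>z. infsum (t z) UNIV)"
  define M where "M = infsum (\<lambda>k. norm (a k) * r ^ deg k) UNIV"
  have tb: "norm (t z k) \<le> norm (a k) * r ^ deg k" if "norm (z - cvec p) \<le> r" for z k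
  proof -
    have "norm (t z k) \<le> norm (z - cvec p) ^ deg k * norm (a k)"
      using norm_cmonomial_le[of k "z - cvec p"] by (auto simp: t_def norm_mult intro!: mult_right_mono)
    also have "\<dots> \<le> r ^ deg k * norm (a k)"
      using that by (intro mult_right_mono power_mono) auto
    finally show ?thesis by (simp add: mult.commute)
  qed
  have ts: "(\<lambda>k. norm (t z k)) summable_on UNIV" if "norm (z - cvec p) \<le> r" for z
    by (rule summable_on_comparison_test[OF sm]) (use tb that in auto)
  have 1: "fh (cvec x) = f x" if "norm (x - p) \<le> r" for x
  proof -
    have "t (cvec x) = (\<lambda>k. monomial k (x - p) *\<^sub>R a k)"
      by (auto simp: t_def scaleR_conv_of_real simp flip: cvec_simps cmonomial_cvec)
    thus ?thesis using hs[OF that] by (simp add: fh_def infsumI)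
  qed
  have 2: "norm (fh z) \<le> M" if "norm (z - cvec p) \<le> r" for z
  proof -
    have "norm (fh z) \<le> infsum (\<lambda>k. norm (t z k)) UNIV"
      unfolding fh_def by (rule norm_infsum_bound) (use ts that in auto)
    also have "\<dots> \<le> M"
      unfolding M_def by (rule infsum_mono) (use ts sm tb that in auto)
    finally show ?thesis .
  qed
  have 3: "(\<lambda>s. fh (z s)) holomorphic_on U"
    if U: "open U" and h: "holo_curve z U" and zr: "\<And>s. s \<in> U \<Longrightarrow> norm (z s - cvec p) \<le> r" for z U
  proof -
    have th: "(\<lambda>s. t (z s) k) holomorphic_on U" for k
      using h unfolding holo_curve_def t_def cmonomial_def
      by (auto intro!: holomorphic_intros)
    have "\<exists>e>0. (\<lambda>s. fh (z s)) holomorphic_on ball w e" if w: "w \<in> U" for w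
    proof -
      obtain e where e: "e > 0" "cball w e \<subseteq> U"
        using U w open_contains_cball[of U] by meson
      have ul: "uniform_limit (cball w e) (\<lambda>K s. \<Sum>k\<in>K. t (z s) k) (\<lambda>s. fh (z s)) (finite_subsets_at_top UNIV)"
        unfolding fh_def
        by (rule Weierstrass_m_test_general[where M = "\<lambda>k. norm (a k) * r ^ deg k"])
           (use tb zr e sm in auto)
      have hol: "(\<lambda>s. \<Sum>k\<in>K. t (z s) k) holomorphic_on cball w e" for K
        by (intro holomorphic_on_sum holomorphic_on_subset[OF th e(2)])
      have "\<forall>\<^sub>F K in finite_subsets_at_top UNIV. continuous_on (cball w e) (\<lambda>s. \<Sum>k\<in>K. t (z s) k) \<and>
          (\<lambda>s. \<Sum>k\<in>K. t (z s) k) holomorphic_on ball w e"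
        using hol by (intro always_eventually allI conjI holomorphic_on_imp_continuous_on)
          (auto intro: holomorphic_on_subset[OF hol])
      from holomorphic_uniform_limit[OF this ul] show ?thesis
        using e(1) finite_subsets_at_top_neq_bot by blast
    qed
    thus ?thesis
      by (simp add: holomorphic_on_open[OF U])
         (meson centre_in_ball field_differentiable_def holomorphic_on_imp_differentiable_at open_ball)
  qed
  show ?thesis using that[OF r 1 2 3] by blast
qed

section \<open>Homogeneous parts of a power series and the Taylor remainder\<close>

definition hpart :: "(('n::finite \<Rightarrow> nat) \<Rightarrow> complex) \<Rightarrow> nat \<Rightarrow> real^'n \<Rightarrow> complex" where
  "hpart a m x = (\<Sum>k | deg k = m. of_real (monomial k x) * a k)"

lemma finite_deg [simp]: "finite {k :: 'n::finite \<Rightarrow> nat. deg k = m}"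
  by (rule finite_subset[OF _ finite_deg_le[of m]]) auto

lemma hpart_scaleR: "hpart a m (s *\<^sub>R x) = of_real s ^ m * hpart a m x"
  by (auto simp: hpart_def monomial_scaleR sum_distrib_left intro!: sum.cong)

text \<open>For \<open>deg k > m\<close> and \<open>norm x \<le> r\<close>, the power
  \<open>(norm x / r) ^ deg k\<close> is at most \<open>(norm x / r) ^ Suc m\<close>, so the tail is
  controlled by the full absolute sum at radius \<open>r\<close>. That \<open>r\<close> and
  \<open>C\<close> do not depend on \<open>m\<close> matters when \<open>m\<close> tends to
  infinity.\<close>

lemma hpart_remainder:
  fixes f :: "real^'n::finite \<Rightarrow> complex"
  assumes "power_series_at f 0 a"
  obtains r C where "r > 0" "C \<ge> 0"
    "\<And>m x. norm x \<le> r \<Longrightarrow> norm (f x - (\<Sum>j\<le>m. hpart a j x)) \<le> C * (norm x / r) ^ Suc m"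
proof -
  obtain r where r: "r > 0" and sm: "(\<lambda>k. norm (a k) * r ^ deg k) summable_on UNIV"
    and hs: "\<And>x. norm (x - 0) \<le> r \<Longrightarrow> ((\<lambda>k. monomial k (x - 0) *\<^sub>R a k) has_sum f x) UNIV"
    by (rule power_series_at_summable[OF assms]) (rule that)
  define M where "M = infsum (\<lambda>k. norm (a k) * r ^ deg k) UNIV"
  have M0: "M \<ge> 0" unfolding M_def by (rule infsum_nonneg) (use r in auto)
  have "norm (f x - (\<Sum>j\<le>m. hpart a j x)) \<le> M * (norm x / r) ^ Suc m" if x: "norm x \<le> r" for m x
  proof -
    define t where "t = (\<lambda>k. monomial k x *\<^sub>R a k)"
    define B where "B = {k :: 'n \<Rightarrow> nat. deg k \<le> m}"
    have "(\<Sum>j\<le>m. hpart a j x) = (\<Sum>j\<le>m. sum t {k \<in> B. deg k = j})"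
      unfolding hpart_def t_def B_def
      by (intro sum.cong) (auto simp: scaleR_conv_of_real)
    also have "\<dots> = sum t B"
      unfolding B_def by (rule sum.group) (auto simp: finite_deg_le)
    finally have eq: "(\<Sum>j\<le>m. hpart a j x) = sum t B" .
    have "(t has_sum (f x)) UNIV" using hs[of x] x by (simp add: t_def)
    hence "(t has_sum (f x - sum t B)) (UNIV - B)"
      by (intro has_sum_Diff) (auto simp: B_def finite_deg_le)
    hence hsd: "f x - sum t B = infsum t (UNIV - B)" by (simp add: infsumI)
    have tb: "norm (t k) \<le> (norm x / r) ^ Suc m * (norm (a k) * r ^ deg k)" if "k \<in> UNIV - B" for k
    proof -
      have "norm (t k) \<le> norm x ^ deg k * norm (a k)"
        using abs_monomial_le[of k x] by (auto simp: t_def intro!: mult_right_mono)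
      also have "norm x ^ deg k = (norm x / r) ^ deg k * r ^ deg k"
        using r by (simp add: power_divide)
      also have "(norm x / r) ^ deg k \<le> (norm x / r) ^ Suc m"
        using that x r by (intro power_decreasing) (auto simp: B_def)
      finally show ?thesis using r by (simp add: mult_ac mult_left_mono mult_right_mono)
    qed
    have smx: "(\<lambda>k. (norm x / r) ^ Suc m * (norm (a k) * r ^ deg k)) summable_on A" for A
      by (intro summable_on_cmult_right summable_on_subset_banach[OF sm]) auto
    have st: "(\<lambda>k. norm (t k)) summable_on (UNIV - B)"
      by (rule summable_on_comparison_test[OF smx]) (use tb in auto)
    have "norm (infsum t (UNIV - B)) \<le> infsum (\<lambda>k. norm (t k)) (UNIV - B)"
      using st by (rule norm_infsum_bound)
    also have "\<dots> \<le> infsum (\<lambda>k. (norm x / r) ^ Suc m * (norm (a k) * r ^ deg k)) UNIV"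
      by (rule infsum_mono_neutral) (use st smx tb r in auto)
    also have "\<dots> = (norm x / r) ^ Suc m * M"
      unfolding M_def by (rule infsum_cmult_right) (use sm in auto)
    finally show ?thesis by (simp add: eq hsd mult.commute)
  qed
  thus ?thesis using that r M0 by blast
qed

section \<open>Homogeneous polynomial eigenfunctions of a linear vector field\<close>

lemma deg_upd_Suc: "deg (k(j := Suc (k j))) = Suc (deg k)"
  unfolding deg_def by (simp add: sum.remove[of UNIV j])

text \<open>These are the coefficients of the formal partial derivative in the variable
  \<open>j\<close>.\<close>

definition dcoef :: "'n::finite \<Rightarrow> (('n \<Rightarrow> nat) \<Rightarrow> complex) \<Rightarrow> ('n \<Rightarrow> nat) \<Rightarrow> complex" where
  "dcoef j a k = of_nat (Suc (k j)) * a (k(j := Suc (k j)))"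

lemma dcoef_commute: "dcoef l (dcoef j a) = dcoef j (dcoef l a)"
  by (cases "l = j") (auto simp: dcoef_def fun_eq_iff fun_upd_twist)

text \<open>When \<open>k j = 0\<close>, the truncated subtraction \<open>k j - 1\<close> is
  harmless because the factor \<open>of_nat (k j)\<close> vanishes.\<close>

lemma has_derivative_monomial:
  "(monomial k has_derivative (\<lambda>h. \<Sum>j\<in>UNIV. h $ j * (of_nat (k j) * monomial (k(j := k j - 1)) x))) (at x)"
proof -
  have "((\<lambda>x. \<Prod>i\<in>UNIV. (x $ i) ^ k i) has_derivative
     (\<lambda>h. \<Sum>i\<in>UNIV. (of_nat (k i) * (h $ i) * (x $ i) ^ (k i - 1)) * (\<Prod>j\<in>UNIV - {i}. (x $ j) ^ k j))) (at x)"
    by (intro has_derivative_prod has_derivative_power)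
       (auto intro!: derivative_eq_intros bounded_linear.has_derivative[OF bounded_linear_vec_nth])
  moreover have "monomial (k(i := k i - 1)) x = (x $ i) ^ (k i - 1) * (\<Prod>j\<in>UNIV - {i}. (x $ j) ^ k j)" for i
    unfolding monomial_def by (simp add: prod.remove[of UNIV i])
  ultimately show ?thesis
    by (simp add: monomial_def[abs_def] mult_ac)
qed

text \<open>The derivative of \<open>hpart a m\<close> at \<open>x\<close> in direction
  \<open>h\<close>, written through coefficients so that the drop of the degree by one is
  explicit.\<close>

definition hder :: "(('n::finite \<Rightarrow> nat) \<Rightarrow> complex) \<Rightarrow> nat \<Rightarrow> real^'n \<Rightarrow> real^'n \<Rightarrow> complex" where
  "hder a m x h = (case m of 0 \<Rightarrow> 0 | Suc m' \<Rightarrow> \<Sum>j\<in>UNIV. of_real (h $ j) * hpart (dcoef j a) m' x)"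

lemma hpart_0: "hpart a 0 x = a (\<lambda>_. 0)"
proof -
  have "{k :: 'a \<Rightarrow> nat. deg k = 0} = {\<lambda>_. 0}" by (auto simp: deg_def)
  thus ?thesis by (simp add: hpart_def monomial_def)
qed

lemma hpart_dcoef:
  "(\<Sum>k | deg k = Suc m. of_nat (k j) * of_real (monomial (k(j := k j - 1)) x) * a k) = hpart (dcoef j a) m x"
proof -
  have "(\<Sum>k | deg k = Suc m. of_nat (k j) * of_real (monomial (k(j := k j - 1)) x) * a k) =
        (\<Sum>k | deg k = Suc m \<and> k j > 0. of_nat (k j) * of_real (monomial (k(j := k j - 1)) x) * a k)"
    by (rule sum.mono_neutral_right) auto
  also have "\<dots> = (\<Sum>k | deg k = m. of_nat (Suc (k j)) * of_real (monomial k x) * a (k(j := Suc (k j))))"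
  proof (rule sum.reindex_bij_witness[where i = "\<lambda>k. k(j := Suc (k j))" and j = "\<lambda>k. k(j := k j - 1)"])
    fix k assume k: "k \<in> {k. deg k = Suc m \<and> 0 < k j}"
    have "deg k = deg ((k(j := k j - 1))(j := Suc ((k(j := k j - 1)) j)))" using k by simp
    hence "deg k = Suc (deg (k(j := k j - 1)))" by (simp only: deg_upd_Suc)
    thus "k(j := k j - 1) \<in> {k. deg k = m}" using k by simp
  qed (auto simp: deg_upd_Suc)
  finally show ?thesis by (simp add: hpart_def dcoef_def mult_ac)
qed

lemma has_derivative_hpart: "(hpart a m has_derivative hder a m x) (at x)"
proof (cases m)
  case 0
  thus ?thesis by (simp add: hpart_0[abs_def] hder_def[abs_def])
next
  case (Suc m')
  have "(hpart a m has_derivative (\<lambda>h. \<Sum>k | deg k = m.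
      of_real (\<Sum>j\<in>UNIV. h $ j * (of_nat (k j) * monomial (k(j := k j - 1)) x)) * a k)) (at x)"
    unfolding hpart_def[abs_def]
    by (intro has_derivative_sum has_derivative_mult_left has_derivative_of_real has_derivative_monomial)
  also have "(\<lambda>h. \<Sum>k | deg k = m.
      of_real (\<Sum>j\<in>UNIV. h $ j * (of_nat (k j) * monomial (k(j := k j - 1)) x)) * a k) = hder a m x"
  proof
    fix h
    have "(\<Sum>k | deg k = m. of_real (\<Sum>j\<in>UNIV. h $ j * (of_nat (k j) * monomial (k(j := k j - 1)) x)) * a k)
      = (\<Sum>k | deg k = m. \<Sum>j\<in>UNIV. of_real (h $ j) * (of_nat (k j) * of_real (monomial (k(j := k j - 1)) x) * a k))"
      by (simp add: sum_distrib_left sum_distrib_right mult_ac)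
    also have "\<dots> = (\<Sum>j\<in>UNIV. of_real (h $ j) * (\<Sum>k | deg k = m. (of_nat (k j) * of_real (monomial (k(j := k j - 1)) x) * a k)))"
      by (subst sum.swap) (simp add: sum_distrib_left)
    finally show "(\<Sum>k | deg k = m. of_real (\<Sum>j\<in>UNIV. h $ j * (of_nat (k j) * monomial (k(j := k j - 1)) x)) * a k) = hder a m x h"
      by (simp only: hder_def Suc nat.case hpart_dcoef)
  qed
  finally show ?thesis .
qed

section \<open>Polynomials in a matrix and eigenvectors modulo an invariant subspace\<close>

lemma complex_matrix_linear: "linear ((*v) (A :: complex^'n^'m))"
  by (rule linearI) (simp_all add: vec_eq_iff matrix_vector_mult_def scaleR_sum_right distrib_left sum.distrib)

text \<open>This is \<open>q(A) v\<close>, formed directly from the iterates of \<open>A\<close> on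
  \<open>v\<close>.\<close>

definition krylov :: "complex^'n^'n \<Rightarrow> complex^'n \<Rightarrow> complex poly \<Rightarrow> complex^'n" where
  "krylov A v q = (\<Sum>i\<le>degree q. coeff q i *s (((*v) A) ^^ i) v)"

lemma krylov_eq: "degree q \<le> N \<Longrightarrow> krylov A v q = (\<Sum>i\<le>N. coeff q i *s (((*v) A) ^^ i) v)"
  unfolding krylov_def by (rule sum.mono_neutral_left) (auto simp: coeff_eq_0)

lemma krylov_pCons: "krylov A v (pCons c q) = c *s v + A *v krylov A v q"
proof -
  have "krylov A v (pCons c q) = (\<Sum>i\<le>Suc (degree q). coeff (pCons c q) i *s (((*v) A) ^^ i) v)"
    by (rule krylov_eq) (simp add: degree_pCons_le)
  also have "\<dots> = c *s v + (\<Sum>i\<le>degree q. coeff q i *s (A *v (((*v) A) ^^ i) v))"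
    by (subst sum.atMost_Suc_shift) simp
  also have "(\<Sum>i\<le>degree q. coeff q i *s (A *v (((*v) A) ^^ i) v)) = A *v krylov A v q"
    by (simp add: krylov_def linear_sum[OF complex_matrix_linear] vector_scalar_commute)
  finally show ?thesis .
qed

lemma krylov_linear_factor:
  "krylov A v ([:-l, 1:] * q) = A *v krylov A v q - l *s krylov A v q"
proof -
  have *: "[:-l, 1:] * q = pCons 0 q + smult (-l) q" by simp
  define N where "N = max (degree q) (degree (pCons 0 q))"
  have N2: "degree q \<le> N" and N3: "degree (pCons 0 q) \<le> N"
    by (auto simp: N_def)
  have N1: "degree (pCons 0 q + smult (-l) q) \<le> N"
    by (rule degree_add_le[OF N3 order_trans[OF degree_smult_le N2]])
  have "krylov A v (pCons 0 q + smult (-l) q) = krylov A v (pCons 0 q) - l *s krylov A v q"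
    unfolding krylov_eq[OF N1] krylov_eq[OF N2] krylov_eq[OF N3]
    by (simp add: vec_eq_iff sum_subtractf sum_distrib_left algebra_simps)
  thus ?thesis unfolding * krylov_pCons by simp
qed

lemma krylov_annihilator:
  fixes A :: "complex^'n^'n"
  obtains q where "q \<noteq> 0" "krylov A v q = 0"
proof -
  \<comment> \<open>\<open>N\<close> is the real dimension, so the \<open>N + 1\<close> iterates
    with index up to \<open>N\<close> satisfy a linear relation with real coefficients.\<close>
  define N where "N = DIM(complex^'n)"
  define g where "g = (\<lambda>i::nat. (((*v) A) ^^ i) v)"
  have "\<exists>u::nat \<Rightarrow> real. (\<exists>i\<le>N. u i \<noteq> 0) \<and> (\<Sum>i\<le>N. u i *\<^sub>R g i) = 0"
  proof (cases "inj_on g {..N}")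
    case True
    have "dependent (g ` {..N})"
      using independent_bound[of "g ` {..N}"] card_image[OF True] by (auto simp: N_def)
    then obtain u where u: "\<exists>w\<in>g ` {..N}. u w \<noteq> 0" "(\<Sum>w\<in>g ` {..N}. u w *\<^sub>R w) = 0"
      by (auto simp: dependent_finite)
    have "(\<Sum>i\<le>N. u (g i) *\<^sub>R g i) = 0"
      using u(2) by (simp add: sum.reindex[OF True])
    thus ?thesis using u(1) by (intro exI[of _ "u \<circ> g"]) auto
  next
    \<comment> \<open>Dependence is a property of a set of vectors, so repeated iterates are treated
      apart: \<open>g i = g j\<close> is itself a relation, with coefficients 1 and -1.\<close>
    case False
    then obtain i j where ij: "i \<le> N" "j \<le> N" "i \<noteq> j" "g i = g j" by (auto simp: inj_on_def)
    have "(\<Sum>k\<le>N. (if k = i then 1 else if k = j then -1 else 0) *\<^sub>R g k) =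
          (\<Sum>k\<in>{i, j}. (if k = i then 1 else if k = j then -1 else 0) *\<^sub>R g k)"
      by (rule sum.mono_neutral_right) (use ij in auto)
    also have "\<dots> = 0" using ij by simp
    finally show ?thesis using ij(1)
      by (intro exI[of _ "\<lambda>k. if k = i then 1 else if k = j then -1 else (0::real)"]) auto
  qed
  then obtain u i where u: "i \<le> N" "u i \<noteq> 0" "(\<Sum>i\<le>N. u i *\<^sub>R g i) = 0" by auto
  define q where "q = (\<Sum>i\<le>N. monom (complex_of_real (u i)) i)"
  have cq: "coeff q i = (if i \<le> N then of_real (u i) else 0)" for i
    by (simp add: q_def coeff_sum coeff_monom)
  have "q \<noteq> 0" using u(1,2) cq[of i] by auto
  moreover have "degree q \<le> N" by (rule degree_le) (simp add: cq)
  have "krylov A v q = (\<Sum>i\<le>N. u i *\<^sub>R g i)"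
    unfolding krylov_eq[OF \<open>degree q \<le> N\<close>]
    by (intro sum.cong) (auto simp: cq g_def vec_eq_iff scaleR_conv_of_real[where 'a=complex])
  ultimately show ?thesis using that u(3) by simp
qed

text \<open>A polynomial \<open>q\<close> of minimal degree with \<open>q(A) v0 \<in> W\<close> has a root \<open>l\<close>; removing that
  root yields \<open>w\<close>. If \<open>l - A\<close> were invertible, it would map \<open>W\<close> onto itself.\<close>

lemma eigenvector_modulo_invariant_subspace:
  fixes A :: "complex^'n^'n"
  assumes W: "subspace W" "\<And>c v. v \<in> W \<Longrightarrow> c *s v \<in> W" "\<And>v. v \<in> W \<Longrightarrow> A *v v \<in> W"
    and v0: "v0 \<notin> W"
  obtains l w where "w \<notin> W" "A *v w - l *s w \<in> W" "det (mat l - A) = 0"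
proof -
  define P where "P = (\<lambda>q. q \<noteq> 0 \<and> krylov A v0 q \<in> W)"
  obtain q0 where q0: "P q0"
    using krylov_annihilator[of A v0] W(1) subspace_0 unfolding P_def by metis
  define q where "q = arg_min degree P"
  have q: "P q" "\<And>q'. P q' \<Longrightarrow> degree q \<le> degree q'"
    using arg_min_nat_lemma[of P q0 degree] q0 by (auto simp: q_def)
  have "degree q \<noteq> 0"
  proof
    assume "degree q = 0"
    then obtain c where c: "q = [:c:]" by (auto elim: degree_eq_zeroE)
    have "krylov A v0 q = c *s v0" by (simp add: krylov_def c)
    hence "(1 / c) *s (c *s v0) \<in> W" using q(1) W(2)[of "c *s v0" "1 / c"] by (simp add: P_def)
    thus False using v0 q(1) by (simp add: c P_def vector_smult_assoc)
  qed
  then obtain l where "poly q l = 0"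
    using alg_closed_imp_poly_has_root[of q] by auto
  then obtain q' where q': "q = [:-l, 1:] * q'" by (auto simp: poly_eq_0_iff_dvd)
  define w where "w = krylov A v0 q'"
  have "q' \<noteq> 0" using q(1) q' by (auto simp: P_def)
  hence "degree q = Suc (degree q')" unfolding q' by (subst degree_mult_eq) auto
  hence "w \<notin> W" using q(2)[of q'] \<open>q' \<noteq> 0\<close> by (auto simp: P_def w_def)
  have wW: "A *v w - l *s w \<in> W"
    using q(1) unfolding P_def w_def q' krylov_linear_factor by blast
  have "det (mat l - A) = 0"
  proof (rule ccontr)
    assume "det (mat l - A) \<noteq> 0"
    hence "invertible (mat l - A)" by (simp add: invertible_det_nz)
    hence inj: "inj ((*v) (mat l - A))"
      using inj_matrix_vector_mult by blast
    have mv: "(mat l - A) *v v = l *s v - A *v v" for v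
      by (simp add: matrix_vector_mult_diff_rdistrib)
         (simp add: mat_def matrix_vector_mult_def vec_eq_iff if_distrib if_distribR cong: if_cong)
    have sub: "(*v) (mat l - A) ` W \<subseteq> W"
      using W by (auto simp: mv subspace_diff)
    \<comment> \<open>Equal real dimensions turn the inclusion into an equality, so \<open>w\<close>
      would share its image with an element of \<open>W\<close>, against injectivity.\<close>
    have "dim ((*v) (mat l - A) ` W) = dim W"
      by (rule dim_image_eq[OF complex_matrix_linear]) (use inj in \<open>auto intro: inj_on_subset\<close>)
    hence "(*v) (mat l - A) ` W = W"
      using subspace_dim_equal[OF linear_subspace_image[OF complex_matrix_linear W(1)] W(1) sub] by simp
    moreover have "(mat l - A) *v w \<in> W"
      using subspace_neg[OF W(1) wW] by (simp add: mv)
    ultimately obtain w' where "w' \<in> W" "(mat l - A) *v w' = (mat l - A) *v w" by (metis imageE)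
    with inj \<open>w \<notin> W\<close> show False by (metis injD)
  qed
  with that \<open>w \<notin> W\<close> wW show ?thesis by blast
qed

text \<open>If \<open>w\<close> is an eigenvector of \<open>A\<close> for \<open>l\<close> modulo the invariant subspace of directions along
  which the polynomial is constant, then its derivative along \<open>w\<close> is a nonzero
  eigenpolynomial for \<open>\<mu> - l\<close> of degree one less.\<close>

lemma polynomial_eigenvalue:
  fixes A :: "real^'n::finite^'n"
  assumes ev: "eigenvalue_family A lam"
    and nz: "hpart a m x0 \<noteq> 0"
    and eig: "\<And>x. hder a m x (A *v x) = \<mu> * hpart a m x"
  shows "\<exists>k. deg k = m \<and> \<mu> = (\<Sum>j\<in>UNIV. of_nat (k j) * lam j)"
  using nz eig
proof (induction m arbitrary: a \<mu> x0)
  case 0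
  hence "\<mu> = 0" using "0.prems"(2)[of x0] by (simp add: hder_def)
  thus ?case by (intro exI[of _ "\<lambda>_. 0"]) (simp add: deg_def)
next
  case (Suc m)
  define AC where "AC = map_matrix complex_of_real A"
  have AC: "AC $ i $ j = of_real (A $ i $ j)" for i j by (simp add: AC_def map_matrix_def)
  define G where "G = (\<lambda>j. hpart (dcoef j a) m)"
  \<comment> \<open>\<open>b v\<close> holds the coefficients of the derivative along the constant
    complex direction \<open>v\<close>, and \<open>Q v\<close> is that derivative as a
    function.\<close>
  define b where "b = (\<lambda>(v::complex^'n) k. \<Sum>j\<in>UNIV. v $ j * dcoef j a k)"
  define Q where "Q = (\<lambda>v. hpart (b v) m)"
  have hpart_sum: "hpart (\<lambda>k. \<Sum>j\<in>UNIV. v $ j * c j k) m' x = (\<Sum>j\<in>UNIV. v $ j * hpart (c j) m' x)"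
    for v :: "complex^'n" and c :: "'n \<Rightarrow> ('n \<Rightarrow> nat) \<Rightarrow> complex" and m' x
    unfolding hpart_def by (simp add: sum_distrib_left mult_ac) (rule sum.swap)
  have Q: "Q v x = (\<Sum>j\<in>UNIV. v $ j * G j x)" for v x
    by (simp add: Q_def b_def G_def hpart_sum)
  have hder_b: "hder (b v) m x h = (\<Sum>l\<in>UNIV. v $ l * hder (dcoef l a) m x h)" for v x h
  proof (cases m)
    case (Suc m')
    have "dcoef j (b v) = (\<lambda>k. \<Sum>l\<in>UNIV. v $ l * dcoef j (dcoef l a) k)" for j
      by (auto simp: b_def dcoef_def[of j] sum_distrib_left mult_ac)
    hence "hder (b v) m x h = (\<Sum>j\<in>UNIV. of_real (h $ j) * (\<Sum>l\<in>UNIV. v $ l * hpart (dcoef j (dcoef l a)) m' x))"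
      by (simp add: hder_def Suc hpart_sum)
    also have "\<dots> = (\<Sum>l\<in>UNIV. v $ l * (\<Sum>j\<in>UNIV. of_real (h $ j) * hpart (dcoef j (dcoef l a)) m' x))"
      unfolding sum_distrib_left by (subst sum.swap) (simp add: mult_ac)
    finally show ?thesis by (simp add: hder_def Suc)
  qed (simp add: hder_def)
  \<comment> \<open>Differentiate the eigenvalue relation in direction \<open>axis l 1\<close>. The
    product rule adds a term in which the derivative falls on the factor \<open>A *v x\<close>;
    moved to the right, it is what shifts the eigenvalue.\<close>
  have key: "hder (dcoef l a) m x (A *v x) = \<mu> * G l x - (\<Sum>j\<in>UNIV. of_real (A $ j $ l) * G j x)" for l x
  proof -
    have d1: "((\<lambda>x. \<Sum>j\<in>UNIV. of_real ((A *v x) $ j) * G j x) has_derivative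
        (\<lambda>h. \<Sum>j\<in>UNIV. of_real ((A *v x) $ j) * hder (dcoef j a) m x h + of_real ((A *v h) $ j) * G j x)) (at x)"
      unfolding G_def
      by (intro has_derivative_sum has_derivative_mult has_derivative_hpart has_derivative_of_real
        bounded_linear.has_derivative[OF bounded_linear_vec_nth] 
        bounded_linear.has_derivative[OF matrix_vector_mul_bounded_linear] has_derivative_ident)
    have eq: "(\<lambda>x. \<Sum>j\<in>UNIV. of_real ((A *v x) $ j) * G j x) = (\<lambda>x. \<mu> * hpart a (Suc m) x)"
      using Suc.prems(2) by (auto simp: hder_def G_def)
    have d2: "((\<lambda>x. \<mu> * hpart a (Suc m) x) has_derivative (\<lambda>h. \<mu> * hder a (Suc m) x h)) (at x)"
      by (intro has_derivative_mult_right has_derivative_hpart)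
    have "(\<lambda>h. \<Sum>j\<in>UNIV. of_real ((A *v x) $ j) * hder (dcoef j a) m x h + of_real ((A *v h) $ j) * G j x)
        = (\<lambda>h. \<mu> * hder a (Suc m) x h)"
      by (rule has_derivative_unique[OF d1[unfolded eq] d2])
    from fun_cong[OF this, of "axis l 1"]
    have 1: "(\<Sum>j\<in>UNIV. of_real ((A *v x) $ j) * hder (dcoef j a) m x (axis l 1)) + (\<Sum>j\<in>UNIV. of_real (A $ j $ l) * G j x)
       = \<mu> * G l x"
      by (simp add: sum.distrib hder_def[of a] G_def axis_def if_distrib if_distribR matrix_vector_mult_def cong: if_cong)
    have "(\<Sum>j\<in>UNIV. of_real ((A *v x) $ j) * hder (dcoef j a) m x (axis l 1)) = hder (dcoef l a) m x (A *v x)"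
    proof (cases m)
      case (Suc m')
      have "hder (dcoef j a) m x (axis l 1) = hpart (dcoef j (dcoef l a)) m' x" for j
        by (simp add: hder_def Suc axis_def if_distrib if_distribR dcoef_commute[of l j] cong: if_cong)
      thus ?thesis by (simp add: hder_def[of "dcoef l a"] Suc)
    qed (simp add: hder_def)
    with 1 show ?thesis by (simp add: algebra_simps)
  qed
  have keyQ: "hder (b v) m x (A *v x) = \<mu> * Q v x - Q (AC *v v) x" for v x
  proof -
    have "hder (b v) m x (A *v x) = (\<Sum>l\<in>UNIV. v $ l * (\<mu> * G l x)) - (\<Sum>l\<in>UNIV. v $ l * (\<Sum>j\<in>UNIV. of_real (A $ j $ l) * G j x))"
      by (simp add: hder_b key sum_subtractf right_diff_distrib)
    also have "(\<Sum>l\<in>UNIV. v $ l * (\<mu> * G l x)) = \<mu> * Q v x"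
      by (simp add: Q sum_distrib_left mult_ac)
    also have "(\<Sum>l\<in>UNIV. v $ l * (\<Sum>j\<in>UNIV. of_real (A $ j $ l) * G j x)) = Q (AC *v v) x"
      unfolding Q sum_distrib_left matrix_vector_mult_def
      by (subst sum.swap) (simp add: AC sum_distrib_left sum_distrib_right mult_ac)
    finally show ?thesis .
  qed
  define W where "W = {v. \<forall>x. Q v x = 0}"
  have W1: "subspace W"
    unfolding W_def subspace_def
    by (auto simp: Q sum.distrib distrib_right scaleR_conv_of_real[where 'a=complex] mult.assoc simp flip: sum_distrib_left)
  have W2: "c *s v \<in> W" if "v \<in> W" for c v
    using that unfolding W_def by (auto simp: Q mult.assoc simp flip: sum_distrib_left)
  have W3: "AC *v v \<in> W" if "v \<in> W" for v
  proof -
    have "Q v = (\<lambda>_. 0)" using that by (auto simp: W_def)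
    hence "hder (b v) m x = (\<lambda>_. 0)" for x
      using has_derivative_hpart[of "b v" m x] has_derivative_unique[of "\<lambda>_. 0" _ x "\<lambda>_. 0"]
      by (auto simp: Q_def)
    thus ?thesis using keyQ[of v] \<open>Q v = _\<close> by (auto simp: W_def)
  qed
  \<comment> \<open>If every directional derivative vanished, the polynomial would be constant,
    hence equal to its value at 0, which is 0 in positive degree.\<close>
  have "\<exists>v0. v0 \<notin> W"
  proof (rule ccontr)
    assume "\<not> ?thesis"
    hence "Q (axis j 1) x = 0" for j x by (auto simp: W_def)
    hence "G j x = 0" for j x by (simp add: Q axis_def if_distrib if_distribR cong: if_cong)
    hence "hder a (Suc m) x = (\<lambda>_. 0)" for x by (auto simp: hder_def G_def)
    hence "(hpart a (Suc m) has_derivative (\<lambda>_. 0)) (at x)" for x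
      using has_derivative_hpart[of a "Suc m" x] by simp
    then obtain c where "\<And>x. hpart a (Suc m) x = c"
      using has_derivative_zero_constant[of UNIV "hpart a (Suc m)"] by auto
    moreover have "hpart a (Suc m) (0 *\<^sub>R 0) = 0" unfolding hpart_scaleR by simp
    ultimately show False using Suc.prems(1) by simp
  qed
  then obtain v0 where "v0 \<notin> W" by blast
  obtain l w where w: "w \<notin> W" "AC *v w - l *s w \<in> W" "det (mat l - AC) = 0"
    by (rule eigenvector_modulo_invariant_subspace[OF W1 W2 W3 \<open>v0 \<notin> W\<close>])
  obtain j where j: "l = lam j"
    using ev w(3) by (auto simp: eigenvalue_family_def AC_def)
  obtain x1 where "hpart (b w) m x1 \<noteq> 0" using w(1) by (auto simp: W_def Q_def)
  moreover have "hder (b w) m x (A *v x) = (\<mu> - l) * hpart (b w) m x" for x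
  proof -
    have "Q (AC *v w - l *s w) x = 0" using w(2) by (simp add: W_def)
    hence "Q (AC *v w) x = l * Q w x"
      by (simp add: Q left_diff_distrib sum_subtractf mult.assoc sum_distrib_left)
    thus ?thesis using keyQ[of w x] by (simp add: Q_def algebra_simps)
  qed
  ultimately obtain k where k: "deg k = m" "\<mu> - l = (\<Sum>j\<in>UNIV. of_nat (k j) * lam j)"
    using Suc.IH by blast
  \<comment> \<open>Raising the exponent at \<open>j\<close> by one restores the eigenvalue
    \<open>l = lam j\<close> that the differentiation removed.\<close>
  have "(\<Sum>i\<in>UNIV. of_nat ((k(j := Suc (k j))) i) * lam i) = l + (\<Sum>i\<in>UNIV. of_nat (k i) * lam i)"
    by (simp add: j sum.remove[of UNIV j] algebra_simps)
  thus ?case using k deg_upd_Suc[of k j]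
    by (intro exI[of _ "k(j := Suc (k j))"] conjI) (simp_all add: algebra_simps del: fun_upd_apply)
qed

section \<open>Flows of Lipschitz vector fields\<close>

locale lipschitz_flow =
  fixes F :: "real^'n::finite \<Rightarrow> real^'n" and X :: "(real^'n) set"
    and flow :: "real \<Rightarrow> real^'n \<Rightarrow> real^'n" and L :: real
  assumes lip: "L-lipschitz_on X F"
    and is_flow: "is_flow F X flow"
begin

lemma L_nonneg: "L \<ge> 0"
  using lip by (rule lipschitz_on_nonneg)

lemma norm_F_diff_le: "x \<in> X \<Longrightarrow> y \<in> X \<Longrightarrow> norm (F x - F y) \<le> L * norm (x - y)"
  using lipschitz_onD[OF lip] by (simp add: dist_norm)

lemma flow_0 [simp]: "x \<in> X \<Longrightarrow> flow 0 x = x"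
  and flow_in: "x \<in> X \<Longrightarrow> t \<ge> 0 \<Longrightarrow> flow t x \<in> X"
  and flow_deriv: "x \<in> X \<Longrightarrow> t \<ge> 0 \<Longrightarrow>
        ((\<lambda>s. flow s x) has_vector_derivative F (flow t x)) (at t within {0..})"
  using is_flow by (auto simp: is_flow_def)

lemma flow_deriv_within:
  "x \<in> X \<Longrightarrow> t \<in> {a..b} \<Longrightarrow> 0 \<le> a \<Longrightarrow>
     ((\<lambda>s. flow s x) has_vector_derivative F (flow t x)) (at t within {a..b})"
  by (rule has_vector_derivative_within_subset[OF flow_deriv]) auto

lemma flow_continuous_on: "x \<in> X \<Longrightarrow> continuous_on {0..} (\<lambda>t. flow t x)"
  by (auto simp: continuous_on_eq_continuous_within intro!: has_vector_derivative_continuous[OF flow_deriv])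

text \<open>The comparison below is stated for arbitrary forward solutions because it is also
  applied to time-shifted trajectories and to the constant solution 0.\<close>

definition solution :: "(real \<Rightarrow> real^'n) \<Rightarrow> bool" where
  "solution u \<longleftrightarrow> (\<forall>t\<ge>0. u t \<in> X \<and> (u has_vector_derivative F (u t)) (at t within {0..}))"

lemma solution_flow: "x \<in> X \<Longrightarrow> solution (\<lambda>t. flow t x)"
  using flow_in flow_deriv by (auto simp: solution_def)

text \<open>Gronwall's estimate: the squared distance, damped by \<open>exp (- 2 * L * t)\<close>,
  is nonincreasing. Squaring keeps the function differentiable where the solutions meet.\<close>

lemma solution_diff_le:
  assumes u: "solution u" and v: "solution v" and t: "t \<ge> 0"
  shows "norm (u t - v t) \<le> exp (L * t) * norm (u 0 - v 0)"
proof -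
  define g where "g = (\<lambda>t. ((u t - v t) \<bullet> (u t - v t)) * exp (- 2 * L * t))"
  have gd: "(g has_real_derivative
      (2 * ((F (u s) - F (v s)) \<bullet> (u s - v s)) - 2 * L * ((u s - v s) \<bullet> (u s - v s))) * exp (- 2 * L * s))
      (at s within {0..})" if "s \<ge> 0" for s
  proof -
    have "((\<lambda>t. u t - v t) has_vector_derivative (F (u s) - F (v s))) (at s within {0..})"
      using u v that by (intro has_vector_derivative_diff) (auto simp: solution_def)
    note d = this[unfolded has_vector_derivative_def]
    have "((\<lambda>t. (u t - v t) \<bullet> (u t - v t)) has_derivative
       (\<lambda>h. (u s - v s) \<bullet> (h *\<^sub>R (F (u s) - F (v s))) + (h *\<^sub>R (F (u s) - F (v s))) \<bullet> (u s - v s))) (at s within {0..})"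
      by (rule has_derivative_inner[OF d d])
    hence "((\<lambda>t. (u t - v t) \<bullet> (u t - v t)) has_real_derivative
       2 * ((F (u s) - F (v s)) \<bullet> (u s - v s))) (at s within {0..})"
      unfolding has_field_derivative_def
      by (rule has_derivative_eq_rhs) (auto simp: inner_commute algebra_simps fun_eq_iff)
    moreover have "((\<lambda>t. exp (- 2 * L * t)) has_real_derivative exp (- 2 * L * s) * (- 2 * L)) (at s within {0..})"
      by (auto intro!: derivative_eq_intros)
    ultimately show ?thesis
      unfolding g_def by (rule DERIV_cong[OF DERIV_mult]) (simp add: algebra_simps)
  qed
  have le: "(2 * ((F (u s) - F (v s)) \<bullet> (u s - v s)) - 2 * L * ((u s - v s) \<bullet> (u s - v s))) * exp (- 2 * L * s) \<le> 0"
    if "s \<ge> 0" for s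
  proof -
    have "(F (u s) - F (v s)) \<bullet> (u s - v s) \<le> norm (F (u s) - F (v s)) * norm (u s - v s)"
      by (rule norm_cauchy_schwarz)
    also have "\<dots> \<le> (L * norm (u s - v s)) * norm (u s - v s)"
      using u v that by (intro mult_right_mono norm_F_diff_le) (auto simp: solution_def)
    also have "\<dots> = L * ((u s - v s) \<bullet> (u s - v s))"
      by (simp add: power2_norm_eq_inner[symmetric] power2_eq_square)
    finally show ?thesis by (simp add: mult_nonpos_nonneg)
  qed
  have "g t \<le> g 0"
  proof (rule DERIV_nonpos_imp_decreasing_open[OF t])
    fix s assume s: "0 < s" "s < t"
    have "at s within {0..} = at s" by (rule at_within_interior) (use s in auto)
    thus "\<exists>y. (g has_real_derivative y) (at s) \<and> y \<le> 0"
      using gd[of s] le[of s] s by auto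
  next
    have "continuous_on {0..} g"
      by (auto simp: continuous_on_eq_continuous_within intro: DERIV_continuous[OF gd])
    thus "continuous_on {0..t} g" by (rule continuous_on_subset) auto
  qed
  hence "(norm (u t - v t))\<^sup>2 * exp (- 2 * L * t) \<le> (norm (u 0 - v 0))\<^sup>2"
    by (simp add: g_def power2_norm_eq_inner)
  hence "(norm (u t - v t))\<^sup>2 \<le> (exp (L * t) * norm (u 0 - v 0))\<^sup>2"
    by (simp add: power_mult_distrib exp_minus field_simps flip: exp_double)
  thus ?thesis by (rule power2_le_imp_le) auto
qed

lemma flow_add:
  assumes "x \<in> X" "s \<ge> 0" "t \<ge> 0"
  shows "flow (s + t) x = flow t (flow s x)"
proof -
  have "solution (\<lambda>t. flow (s + t) x)"
    unfolding solution_def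
  proof (intro allI impI conjI)
    fix t :: real assume t: "t \<ge> 0"
    show "flow (s + t) x \<in> X" using flow_in assms t by simp
    have "((\<lambda>t. flow t x) \<circ> (\<lambda>t. s + t) has_vector_derivative 1 *\<^sub>R F (flow (s + t) x)) (at t within {0..})"
    proof (rule vector_diff_chain_within)
      show "((\<lambda>t. s + t) has_vector_derivative 1) (at t within {0..})"
        by (auto intro!: derivative_eq_intros)
      show "((\<lambda>t. flow t x) has_vector_derivative F (flow (s + t) x)) (at (s + t) within (+) s ` {0..})"
        by (rule has_vector_derivative_within_subset[OF flow_deriv]) (use assms t in auto)
    qed
    thus "((\<lambda>t. flow (s + t) x) has_vector_derivative F (flow (s + t) x)) (at t within {0..})"
      by (simp add: o_def)
  qed
  from solution_diff_le[OF this solution_flow[OF flow_in[OF assms(1,2)]] assms(3)]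
  show ?thesis using assms flow_in by simp
qed

lemma flow_diff_le:
  "x \<in> X \<Longrightarrow> y \<in> X \<Longrightarrow> t \<ge> 0 \<Longrightarrow> norm (flow t x - flow t y) \<le> exp (L * t) * norm (x - y)"
  using solution_diff_le[OF solution_flow solution_flow, of x y t] by simp

lemma flow_speed_le:
  assumes x: "x \<in> X" and B: "\<And>s. 0 \<le> s \<Longrightarrow> s \<le> t \<Longrightarrow> norm (F (flow s x)) \<le> B" and t: "t \<ge> 0"
  shows "norm (flow t x - x) \<le> B * t"
proof -
  have "norm (flow t x - flow 0 x) \<le> B * norm (t - 0)"
  proof (rule differentiable_bound[of "{0..t}"])
    fix s assume s: "s \<in> {0..t}"
    show "((\<lambda>s. flow s x) has_derivative (\<lambda>h. h *\<^sub>R F (flow s x))) (at s within {0..t})"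
      using flow_deriv_within[OF x s] by (simp add: has_vector_derivative_def)
    show "onorm (\<lambda>h. h *\<^sub>R F (flow s x)) \<le> B"
      by (rule onorm_le) (use B[of s] s in \<open>auto simp: mult.commute[of B] intro!: mult_left_mono\<close>)
  qed (use t in auto)
  thus ?thesis using x t by simp
qed

text \<open>Local error of one Euler step. The speed bound \<open>B\<close> is a parameter because
  two of them are used: a global one on \<open>X\<close> for the convergence of Euler polygons, and
  one proportional to the size of the starting point near the equilibrium.\<close>

lemma flow_euler_step_le:
  assumes x: "x \<in> X" and B: "\<And>s. 0 \<le> s \<Longrightarrow> s \<le> t \<Longrightarrow> norm (F (flow s x)) \<le> B" and t: "t \<ge> 0"
  shows "norm (flow t x - x - t *\<^sub>R F x) \<le> L * B * t\<^sup>2"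
proof -
  have B0: "B \<ge> 0" using order_trans[OF norm_ge_zero B[of 0]] t by simp
  have "norm (flow t x - flow 0 x - (t - 0) *\<^sub>R F (flow 0 x)) \<le> norm (t - 0) * (L * B * t)"
  proof (rule vector_differentiable_bound_linearization[of "{0..t}" "\<lambda>s. flow s x" "\<lambda>s. F (flow s x)"])
    fix s assume s: "s \<in> {0..t}"
    show "((\<lambda>s. flow s x) has_vector_derivative F (flow s x)) (at s within {0..t})"
      using flow_deriv_within[OF x s] by simp
    have "norm (F (flow s x) - F x) \<le> L * norm (flow s x - x)"
      using x s by (intro norm_F_diff_le flow_in) auto
    also have "norm (flow s x - x) \<le> B * s"
      by (rule flow_speed_le) (use x B s in auto)
    also have "B * s \<le> B * t" using s B0 by (intro mult_left_mono) auto
    finally show "norm (F (flow s x) - F (flow 0 x)) \<le> L * B * t"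
      using L_nonneg x by (simp add: mult_left_mono mult.assoc)
  qed (use t in \<open>auto simp: closed_segment_eq_real_ivl\<close>)
  thus ?thesis using x t by (simp add: power2_eq_square mult_ac)
qed

text \<open>The product of \<open>exp (- l * t)\<close> with \<open>f\<close> along the trajectory
  has derivative 0. Only the piece between times \<open>a\<close> and \<open>b\<close> must lie in
  \<open>U\<close>; the earlier part may run anywhere in \<open>X\<close>.\<close>

lemma eigenfunction_flow:
  fixes f :: "real^'n \<Rightarrow> complex"
  assumes f: "\<And>x. x \<in> U \<Longrightarrow> f differentiable (at x) \<and> generator F f x = l * f x"
    and y: "y \<in> X" and ab: "0 \<le> a" "a \<le> b" and U: "\<And>t. t \<in> {a..b} \<Longrightarrow> flow t y \<in> U"
  shows "f (flow b y) = exp (l * of_real (b - a)) * f (flow a y)"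
proof -
  define g where "g = (\<lambda>t. exp (- l * of_real t) * f (flow t y))"
  have "(g has_vector_derivative 0) (at t within {a..b})" if t: "t \<in> {a..b}" for t
  proof -
    have fd: "(f has_derivative frechet_derivative f (at (flow t y))) (at (flow t y))"
      using f[OF U[OF t]] frechet_derivative_works by blast
    have "(f \<circ> (\<lambda>t. flow t y) has_vector_derivative frechet_derivative f (at (flow t y)) (F (flow t y))) (at t within {a..b})"
      by (rule vector_derivative_diff_chain_within[OF flow_deriv_within[OF y t ab(1)] has_derivative_at_withinI[OF fd]])
    hence "((\<lambda>t. f (flow t y)) has_vector_derivative l * f (flow t y)) (at t within {a..b})"
      using f[OF U[OF t]] by (simp add: generator_def o_def)
    moreover have "((\<lambda>t. exp (- l * of_real t)) has_vector_derivative - l * exp (- l * of_real t)) (at t within {a..b})"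
      by (auto intro!: derivative_eq_intros has_vector_derivative_real_field)
    ultimately show ?thesis
      unfolding g_def by (auto intro!: derivative_eq_intros simp: algebra_simps)
  qed
  then obtain c where "\<And>t. t \<in> {a..b} \<Longrightarrow> g t = c"
    using has_vector_derivative_zero_constant[of "{a..b}" g] by auto
  hence "g b = g a" using ab by simp
  hence "exp (l * of_real b) * (exp (- l * of_real b) * f (flow b y)) = exp (l * of_real b) * (exp (- l * of_real a) * f (flow a y))"
    by (simp add: g_def)
  thus ?thesis
    by (simp add: mult.assoc[symmetric] flip: exp_add) (simp add: algebra_simps)
qed

end

section \<open>Analyticity of the flow\<close>

text \<open>Real analyticity at \<open>s0\<close> in the form in which it is used: restriction of a
  holomorphic curve on a disc.\<close>

definition analytic_curve :: "(real \<Rightarrow> real^'n) \<Rightarrow> real \<Rightarrow> bool" where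
  "analytic_curve c s0 \<longleftrightarrow> (\<exists>\<delta>>0. \<exists>z. holo_curve z (ball (of_real s0) \<delta>) \<and>
     (\<forall>s. \<bar>s - s0\<bar> < \<delta> \<longrightarrow> z (of_real s) = cvec (c s)))"

definition analytic_real :: "(real \<Rightarrow> complex) \<Rightarrow> real \<Rightarrow> bool" where
  "analytic_real f s0 \<longleftrightarrow> (\<exists>\<delta>>0. \<exists>g. g holomorphic_on ball (of_real s0) \<delta> \<and>
     (\<forall>s. \<bar>s - s0\<bar> < \<delta> \<longrightarrow> g (of_real s) = f s))"

lemma holo_curve_subset: "holo_curve z U \<Longrightarrow> V \<subseteq> U \<Longrightarrow> holo_curve z V"
  unfolding holo_curve_def using holomorphic_on_subset by blast

lemma holo_curve_continuous:
  assumes "holo_curve z U"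
  shows "continuous_on U z"
proof -
  have "continuous_on U (\<lambda>s. \<chi> i. z s $ i)"
    using assms by (intro continuous_on_vec_lambda holomorphic_on_imp_continuous_on) (auto simp: holo_curve_def)
  thus ?thesis by simp
qed

lemma of_real_in_ball: "\<bar>s - s0\<bar> < \<delta> \<longleftrightarrow> complex_of_real s \<in> ball (of_real s0) \<delta>"
  by (simp add: dist_real_def abs_minus_commute)

text \<open>Holomorphic extensions of \<open>F\<close> and of the eigenfunctions exist only near a
  given point, so before a composition the disc is shrunk until the extended curve stays close to
  that point.\<close>

lemma analytic_curve_near:
  assumes c: "analytic_curve c s0" and near: "norm (c s0 - p) < \<rho>" and "\<delta>0 > 0"
  obtains \<delta> z where "\<delta> > 0" "\<delta> \<le> \<delta>0" "holo_curve z (ball (of_real s0) \<delta>)"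
    "\<And>s. \<bar>s - s0\<bar> < \<delta> \<Longrightarrow> z (of_real s) = cvec (c s)"
    "\<And>s. s \<in> ball (of_real s0) \<delta> \<Longrightarrow> norm (z s - cvec p) < \<rho>"
proof -
  obtain \<delta>1 z where 1: "\<delta>1 > 0" "holo_curve z (ball (of_real s0) \<delta>1)"
    "\<And>s. \<bar>s - s0\<bar> < \<delta>1 \<Longrightarrow> z (of_real s) = cvec (c s)"
    using c by (auto simp: analytic_curve_def)
  have "continuous_on (ball (of_real s0) \<delta>1) (\<lambda>s. norm (z s - cvec p))"
    by (intro continuous_intros holo_curve_continuous 1)
  hence "open (ball (of_real s0) \<delta>1 \<inter> (\<lambda>s. norm (z s - cvec p)) -` {..<\<rho>})"
    by (rule continuous_open_preimage) auto
  also have "ball (of_real s0) \<delta>1 \<inter> (\<lambda>s. norm (z s - cvec p)) -` {..<\<rho>} =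
      {s \<in> ball (of_real s0) \<delta>1. norm (z s - cvec p) < \<rho>}" by auto
  finally have "open {s \<in> ball (of_real s0) \<delta>1. norm (z s - cvec p) < \<rho>}" .
  moreover have "norm (z (of_real s0) - cvec p) < \<rho>"
    using 1(1) 1(3)[of s0] near by (simp flip: cvec_simps)
  ultimately obtain \<delta>2 where 2: "\<delta>2 > 0" "ball (of_real s0) \<delta>2 \<subseteq> {s \<in> ball (of_real s0) \<delta>1. norm (z s - cvec p) < \<rho>}"
    using 1(1) by (metis (no_types, lifting) centre_in_ball mem_Collect_eq openE)
  define \<delta> where "\<delta> = min \<delta>0 (min \<delta>1 \<delta>2)"
  show ?thesis
  proof (rule that[of \<delta> z])
    show "holo_curve z (ball (of_real s0) \<delta>)"
      by (rule holo_curve_subset[OF 1(2)]) (auto simp: \<delta>_def)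
    fix s assume "s \<in> ball (complex_of_real s0) \<delta>"
    hence "s \<in> ball (of_real s0) \<delta>2" by (simp add: \<delta>_def)
    thus "norm (z s - cvec p) < \<rho>" using 2(2) by blast
  qed (use 1 2 assms in \<open>auto simp: \<delta>_def\<close>)
qed

lemma analytic_real_compose:
  fixes f :: "real^'n::finite \<Rightarrow> complex"
  assumes f: "power_series_at f (c s0) a" and c: "analytic_curve c s0"
  shows "analytic_real (\<lambda>s. f (c s)) s0"
proof -
  obtain r fh M where r: "r > 0" and fh: "\<And>x. norm (x - c s0) \<le> r \<Longrightarrow> fh (cvec x) = f x"
    "\<And>z U. open U \<Longrightarrow> holo_curve z U \<Longrightarrow> (\<And>s. s \<in> U \<Longrightarrow> norm (z s - cvec (c s0)) \<le> r) \<Longrightarrow>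
       (\<lambda>s. fh (z s)) holomorphic_on U"
    using complexification[OF f] by metis
  obtain \<delta> z where z: "\<delta> > 0" "holo_curve z (ball (of_real s0) \<delta>)"
    "\<And>s. \<bar>s - s0\<bar> < \<delta> \<Longrightarrow> z (of_real s) = cvec (c s)"
    "\<And>s. s \<in> ball (of_real s0) \<delta> \<Longrightarrow> norm (z s - cvec (c s0)) < r"
    by (rule analytic_curve_near[OF c, of "c s0" r 1]) (use r that in auto)
  have "(\<lambda>s. fh (z s)) holomorphic_on ball (of_real s0) \<delta>"
    by (rule fh(2)) (use z in \<open>auto intro: less_imp_le\<close>)
  moreover have "fh (z (of_real s)) = f (c s)" if "\<bar>s - s0\<bar> < \<delta>" for s
  proof -
    have "norm (cvec (c s - c s0)) < r"
      using z(3)[OF that] z(4)[of "of_real s"] that by (simp add: of_real_in_ball)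
    thus ?thesis using fh(1)[of "c s"] z(3)[OF that] by (simp del: cvec_simps)
  qed
  ultimately show ?thesis using z(1) by (auto simp: analytic_real_def)
qed

lemma analytic_real_diff:
  assumes "analytic_real f s0" "analytic_real g s0"
  shows "analytic_real (\<lambda>s. f s - g s) s0"
proof -
  from assms obtain \<delta>1 F \<delta>2 G where
    *: "\<delta>1 > 0" "F holomorphic_on ball (of_real s0) \<delta>1" "\<forall>s. \<bar>s - s0\<bar> < \<delta>1 \<longrightarrow> F (of_real s) = f s"
       "\<delta>2 > 0" "G holomorphic_on ball (of_real s0) \<delta>2" "\<forall>s. \<bar>s - s0\<bar> < \<delta>2 \<longrightarrow> G (of_real s) = g s"
    unfolding analytic_real_def by blast
  have "(\<lambda>s. F s - G s) holomorphic_on ball (of_real s0) (min \<delta>1 \<delta>2)"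
    by (intro holomorphic_intros holomorphic_on_subset[OF *(2)] holomorphic_on_subset[OF *(5)]) auto
  thus ?thesis unfolding analytic_real_def using *
    by (intro exI[of _ "min \<delta>1 \<delta>2"] conjI exI[of _ "\<lambda>s. F s - G s"]) auto
qed

lemma analytic_real_cmult:
  assumes "analytic_real f s0"
  shows "analytic_real (\<lambda>s. k * f s) s0"
proof -
  from assms obtain \<delta>1 F where
    *: "\<delta>1 > 0" "F holomorphic_on ball (of_real s0) \<delta>1" "\<forall>s. \<bar>s - s0\<bar> < \<delta>1 \<longrightarrow> F (of_real s) = f s"
    unfolding analytic_real_def by blast
  have "(\<lambda>s. k * F s) holomorphic_on ball (of_real s0) \<delta>1"
    by (intro holomorphic_intros *)
  thus ?thesis unfolding analytic_real_def using *
    by (intro exI[of _ "\<delta>1"] conjI exI[of _ "\<lambda>s. k * F s"]) auto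
qed

lemma analytic_curve_line: "analytic_curve (\<lambda>s. s *\<^sub>R x) s0"
  unfolding analytic_curve_def
proof (intro exI conjI allI impI)
  show "holo_curve (\<lambda>s. s *s cvec x) (ball (of_real s0) 1)"
    by (auto simp: holo_curve_def intro!: holomorphic_intros)
  show "of_real s *s cvec x = cvec (s *\<^sub>R x)" for s by (simp add: vec_eq_iff del: cvec_simps)
qed simp

text \<open>The set of points near which \<open>f\<close> vanishes is open and closed in
  \<open>J\<close>. Closedness is the identity theorem for the holomorphic extension, applied to its
  zeros on a real interval.\<close>

lemma analytic_real_identity:
  assumes J: "connected J" "open J" and an: "\<And>s. s \<in> J \<Longrightarrow> analytic_real f s"
    and s0: "s0 \<in> J" and e: "e > 0" "\<And>s. \<bar>s - s0\<bar> < e \<Longrightarrow> f s = 0" and s: "s \<in> J"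
  shows "f s = 0"
proof -
  define Z where "Z = {s \<in> J. \<exists>e>0. \<forall>t. \<bar>t - s\<bar> < e \<longrightarrow> f t = 0}"
  have op: "open Z"
    unfolding open_dist
  proof
    fix s assume "s \<in> Z"
    then obtain e where e: "s \<in> J" "e > 0" "\<And>t. \<bar>t - s\<bar> < e \<Longrightarrow> f t = 0" by (auto simp: Z_def)
    obtain d where d: "d > 0" "\<And>t. dist t s < d \<Longrightarrow> t \<in> J"
      using J(2) e(1) by (auto simp: open_dist)
    show "\<exists>d>0. \<forall>t. dist t s < d \<longrightarrow> t \<in> Z"
    proof (intro exI conjI allI impI)
      show "min d (e / 2) > 0" using d e by simp
      fix t assume t: "dist t s < min d (e / 2)"
      have "\<forall>u. \<bar>u - t\<bar> < e / 2 \<longrightarrow> f u = 0"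
      proof (intro allI impI e(3))
        fix u assume "\<bar>u - t\<bar> < e / 2"
        moreover have "\<bar>t - s\<bar> < e / 2" using t by (simp add: dist_real_def)
        ultimately show "\<bar>u - s\<bar> < e" by linarith
      qed
      thus "t \<in> Z" using t d(2)[of t] e(2) unfolding Z_def by (auto intro!: exI[of _ "e / 2"])
    qed
  qed
  have cl: "s \<in> Z" if sJ: "s \<in> J" and lim: "\<And>\<epsilon>. \<epsilon> > 0 \<Longrightarrow> \<exists>t\<in>Z. \<bar>t - s\<bar> < \<epsilon>" for s
  proof -
    obtain \<delta> g where g: "\<delta> > 0" "g holomorphic_on ball (of_real s) \<delta>"
      "\<And>t. \<bar>t - s\<bar> < \<delta> \<Longrightarrow> g (of_real t) = f t"
      using an[OF sJ] by (auto simp: analytic_real_def)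
    obtain t where t: "t \<in> Z" "\<bar>t - s\<bar> < \<delta>" using lim g(1) by blast
    then obtain e where e: "e > 0" "\<And>u. \<bar>u - t\<bar> < e \<Longrightarrow> f u = 0" by (auto simp: Z_def)
    \<comment> \<open>The interval of zeros around \<open>t\<close> is cut so that it lies in the
      disc around \<open>s\<close>.\<close>
    define e' where "e' = min e (\<delta> - \<bar>t - s\<bar>)"
    have e': "e' > 0" using e t by (simp add: e'_def)
    define U where "U = complex_of_real ` {u. \<bar>u - t\<bar> < e'}"
    have "of_real t islimpt U"
      unfolding islimpt_approachable
    proof (intro allI impI)
      fix \<epsilon> :: real assume "\<epsilon> > 0"
      define u where "u = t + min e' \<epsilon> / 2"
      have "\<bar>u - t\<bar> < e'" "u \<noteq> t" "\<bar>u - t\<bar> < \<epsilon>" using e' \<open>\<epsilon> > 0\<close> by (auto simp: u_def)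
      thus "\<exists>x'\<in>U. x' \<noteq> of_real t \<and> dist x' (of_real t) < \<epsilon>"
        by (intro bexI[of _ "of_real u"]) (auto simp: U_def dist_real_def)
    qed
    moreover have "U \<subseteq> ball (of_real s) \<delta>"
      using t by (auto simp: U_def e'_def dist_real_def)
    moreover have "g w = 0" if "w \<in> U" for w
      using that e(2) g(3) by (auto simp: U_def e'_def)
    ultimately have "g w = 0" if "w \<in> ball (of_real s) \<delta>" for w
      using analytic_continuation[OF g(2), of U "of_real t" w] t that
      by (auto simp: dist_real_def)
    hence "f u = 0" if "\<bar>u - s\<bar> < \<delta>" for u
      using g(3)[OF that] that by (simp add: of_real_in_ball)
    thus ?thesis using g(1) sJ by (auto simp: Z_def)
  qed
  have "open (J - Z)"
    unfolding open_dist
  proof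
    fix s assume s: "s \<in> J - Z"
    then obtain \<epsilon> where \<epsilon>: "\<epsilon> > 0" "\<And>t. t \<in> Z \<Longrightarrow> \<not> \<bar>t - s\<bar> < \<epsilon>" using cl[of s] by blast
    obtain d where d: "d > 0" "\<And>t. dist t s < d \<Longrightarrow> t \<in> J"
      using J(2) s by (auto simp: open_dist)
    show "\<exists>d>0. \<forall>t. dist t s < d \<longrightarrow> t \<in> J - Z"
      using d \<epsilon> by (intro exI[of _ "min d \<epsilon>"]) (auto simp: dist_real_def)
  qed
  moreover have "s0 \<in> Z" using s0 e by (auto simp: Z_def)
  ultimately have "J - Z = {}"
    using J(1) op unfolding connected_def Z_def by blast
  hence "s \<in> Z" using s by blast
  then obtain e where "e > 0" "\<And>t. \<bar>t - s\<bar> < e \<Longrightarrow> f t = 0" by (auto simp: Z_def)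
  thus ?thesis by simp
qed

section \<open>Holomorphic extension of an analytic vector field\<close>

lemma complexification_vec:
  fixes f :: "real^'n::finite \<Rightarrow> real^'n"
  assumes f: "power_series_at f p a"
  obtains r fh M where "r > 0" "M \<ge> 0"
    "\<And>x. norm (x - p) \<le> r \<Longrightarrow> fh (cvec x) = cvec (f x)"
    "\<And>z. norm (z - cvec p) \<le> r \<Longrightarrow> norm (fh z) \<le> M"
    "\<And>z U. open U \<Longrightarrow> holo_curve z U \<Longrightarrow> (\<And>s. s \<in> U \<Longrightarrow> norm (z s - cvec p) \<le> r) \<Longrightarrow>
       holo_curve (\<lambda>s. fh (z s)) U"
proof -
  \<comment> \<open>One predicate for all four properties allows radius, extension and bound to be
    chosen for all components at once; the smallest radius and the sum of the absolute bounds then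
    serve the vector.\<close>
  define Q where "Q = (\<lambda>i r (fh :: complex^'n \<Rightarrow> complex) M. r > 0 \<and>
    (\<forall>x. norm (x - p) \<le> r \<longrightarrow> fh (cvec x) = of_real (f x $ i)) \<and>
    (\<forall>z. norm (z - cvec p) \<le> r \<longrightarrow> norm (fh z) \<le> M) \<and>
    (\<forall>z U. open U \<longrightarrow> holo_curve z U \<longrightarrow> (\<forall>s\<in>U. norm (z s - cvec p) \<le> r) \<longrightarrow>
       (\<lambda>s. fh (z s)) holomorphic_on U))"
  have "\<exists>r fh M. Q i r fh M" for i
  proof -
    have "power_series_at (\<lambda>x. complex_of_real (f x $ i)) p (\<lambda>k. of_real (a k $ i))"
    proof -
      obtain r where r: "r > 0" "\<And>x. (\<forall>i. \<bar>x $ i - p $ i\<bar> < r) \<Longrightarrow>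
          ((\<lambda>k. monomial k (x - p) *\<^sub>R a k) has_sum f x) UNIV"
        using f by (auto simp: power_series_at_def)
      have "bounded_linear (\<lambda>v::real^'n. complex_of_real (v $ i))"
        by (intro bounded_linear_compose[OF bounded_linear_of_real bounded_linear_vec_nth])
      from has_sum_bounded_linear[OF this r(2)] show ?thesis
        unfolding power_series_at_def using r(1) by (auto simp: scaleR_conv_of_real[where 'a=complex])
    qed
    from complexification[OF this] show ?thesis unfolding Q_def by metis
  qed
  then obtain r fh M where Q: "\<And>i. Q i (r i) (fh i) (M i)" by metis
  define r0 where "r0 = Min (range r)"
  have r0: "r0 \<le> r i" "r0 > 0" for i using Q by (auto simp: r0_def Q_def)
  define M0 where "M0 = (\<Sum>i\<in>UNIV. \<bar>M i\<bar>)"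
  show ?thesis
  proof (rule that[of r0 M0 "\<lambda>z. \<chi> i. fh i z"])
    show "r0 > 0" "M0 \<ge> 0" using r0 by (auto simp: M0_def sum_nonneg)
    show "(\<chi> i. fh i (cvec x)) = cvec (f x)" if "norm (x - p) \<le> r0" for x
      using that Q r0 order_trans unfolding Q_def vec_eq_iff by (metis cvec_nth vec_lambda_beta)
    show "norm (\<chi> i. fh i z) \<le> M0" if "norm (z - cvec p) \<le> r0" for z
    proof -
      have "norm (\<chi> i. fh i z) \<le> (\<Sum>i\<in>UNIV. norm (fh i z))"
        by (simp add: norm_vec_def L2_set_le_sum)
      also have "\<dots> \<le> M0" unfolding M0_def
      proof (rule sum_mono)
        fix i show "norm (fh i z) \<le> \<bar>M i\<bar>"
          using Q[of i] order_trans[OF that r0(1)[of i]] by (auto simp: Q_def intro: order_trans)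
      qed
      finally show ?thesis .
    qed
    show "holo_curve (\<lambda>s. \<chi> i. fh i (z s)) U"
      if "open U" "holo_curve z U" "\<And>s. s \<in> U \<Longrightarrow> norm (z s - cvec p) \<le> r0" for z U
    proof -
      have "(\<lambda>s. fh i (z s)) holomorphic_on U" for i
        using Q[of i] that order_trans[OF that(3) r0(1)[of i]] by (auto simp: Q_def)
      thus ?thesis by (simp add: holo_curve_def)
    qed
  qed
qed

lemma norm_vector_smult: "norm (c *s v) = norm c * norm (v :: complex^'n)"
  by (simp add: norm_vec_def norm_mult L2_set_right_distrib)

text \<open>Cauchy's estimate along the complex line through \<open>x\<close> and \<open>y\<close>.
  The Lipschitz constant of \<open>F\<close> on \<open>X\<close> does not cover Euler polygons,
  whose vertices may leave \<open>X\<close>; this one holds on a full ball around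
  \<open>p\<close>.\<close>

lemma complexification_lipschitz:
  fixes f :: "real^'n::finite \<Rightarrow> real^'n"
  assumes r: "r > 0" and M: "M \<ge> 0"
    and fh: "\<And>x. norm (x - p) \<le> r \<Longrightarrow> fh (cvec x) = cvec (f x)"
    and bd: "\<And>z. norm (z - cvec p) \<le> r \<Longrightarrow> norm (fh z) \<le> M"
    and hol: "\<And>z U. open U \<Longrightarrow> holo_curve z U \<Longrightarrow> (\<And>s. s \<in> U \<Longrightarrow> norm (z s - cvec p) \<le> r) \<Longrightarrow>
       holo_curve (\<lambda>s. fh (z s)) U"
  shows "\<exists>K\<ge>0. \<forall>x y. norm (x - p) \<le> r / 4 \<longrightarrow> norm (y - p) \<le> r / 4 \<longrightarrow> norm (f x - f y) \<le> K * norm (x - y)"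
proof -
  define K where "K = (\<Sum>i\<in>(UNIV :: 'n set). 8 * M / r)"
  have "norm (f x - f y) \<le> K * norm (x - y)"
    if x: "norm (x - p) \<le> r / 4" and y: "norm (y - p) \<le> r / 4" for x y
  proof (cases "x = y")
    case False
    define d where "d = norm (x - y)"
    have d: "d > 0" using False by (simp add: d_def)
    have dr: "d \<le> r / 2"
      using norm_triangle_ineq4[of "x - p" "y - p"] x y by (simp add: d_def)
    define z where "z = (\<lambda>s::complex. cvec y + s *s cvec (x - y))"
    \<comment> \<open>For \<open>norm s < R\<close> the displacement along the line is at most
      \<open>3 * r / 4\<close>; together with the distance \<open>r / 4\<close> of \<open>y\<close>
      from \<open>p\<close> this stays within \<open>r\<close>.\<close>
    define R where "R = 3 * r / (4 * d)"
    have zr: "norm (z s - cvec p) \<le> r" if "s \<in> ball 0 R" for s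
    proof -
      have "norm (s *s cvec (x - y)) = norm s * d"
        by (simp add: d_def norm_vector_smult del: cvec_simps)
      also have "\<dots> \<le> 3 * r / 4" using that d by (simp add: R_def field_simps)
      finally have "norm (s *s cvec (x - y)) \<le> 3 * r / 4" .
      moreover have "norm (cvec y - cvec p) \<le> r / 4" using y by (simp flip: cvec_simps)
      moreover have zs: "z s - cvec p = (cvec y - cvec p) + s *s cvec (x - y)" by (simp add: z_def)
      ultimately show ?thesis unfolding zs using norm_triangle_ineq[of "cvec y - cvec p" "s *s cvec (x - y)"]
        by linarith
    qed
    have hz: "holo_curve z (ball 0 R)"
      unfolding holo_curve_def z_def by (auto intro!: holomorphic_intros)
    have hf: "holo_curve (\<lambda>s. fh (z s)) (ball 0 R)"
      by (rule hol[OF _ hz zr]) auto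
    \<comment> \<open>As \<open>d \<le> r / 2\<close>, discs of radius \<rho> around points of the
      segment from 0 to 1 fit into \<open>ball 0 R\<close>, and Cauchy's inequality bounds the
      derivative by \<open>M / \<rho>\<close>, which is \<open>8 * M / r * d\<close>.\<close>
    define \<rho> where "\<rho> = r / (8 * d)"
    have \<rho>: "\<rho> > 0" "1 + \<rho> < R"
      using d r dr by (auto simp: \<rho>_def R_def field_simps)
    have "\<bar>(f x - f y) $ i\<bar> \<le> 8 * M / r * d" for i
    proof -
      define g where "g = (\<lambda>s. fh (z s) $ i)"
      have g: "g holomorphic_on ball 0 R" using hf by (simp add: holo_curve_def g_def)
      have "norm (g 1 - g 0) \<le> M / \<rho> * norm (1 - (0::complex))"
      proof (rule field_differentiable_bound[of "closed_segment 0 1"])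
        fix w :: complex assume w: "w \<in> closed_segment 0 1"
        have "norm w \<le> 1" using segment_bound1[OF w] by simp
        hence sub: "cball w \<rho> \<subseteq> ball 0 R"
          using \<rho>(2) norm_triangle_ineq2 by (auto simp: dist_norm) (smt (verit) norm_triangle_ineq3 norm_minus_commute)
        have "w \<in> cball w \<rho>" using \<rho>(1) by simp
        hence "w \<in> ball 0 R" using sub by blast
        thus "(g has_field_derivative deriv g w) (at w within closed_segment 0 1)"
          using g holomorphic_derivI[OF g open_ball] has_field_derivative_at_within by blast
        have "norm ((deriv ^^ 1) g w) \<le> fact 1 * M / \<rho> ^ 1"
        proof (rule Cauchy_inequality)
          show "g holomorphic_on ball w \<rho>" using g sub ball_subset_cball holomorphic_on_subset by (metis order_trans)
          show "continuous_on (cball w \<rho>) g"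
            using holomorphic_on_imp_continuous_on[OF g] sub continuous_on_subset by blast
          fix u assume "norm (w - u) = \<rho>"
          hence "u \<in> ball 0 R" using sub by (auto simp: dist_norm)
          from bd[OF zr[OF this]] show "norm (g u) \<le> M"
            using Finite_Cartesian_Product.norm_nth_le[of "fh (z u)" i] by (simp add: g_def)
        qed (use \<rho> in auto)
        thus "norm (deriv g w) \<le> M / \<rho>" by simp
      qed auto
      moreover have "g 1 - g 0 = of_real ((f x - f y) $ i)"
      proof -
        have "z 1 = cvec x" "z 0 = cvec y" by (simp_all add: z_def)
        thus ?thesis using fh[of x] fh[of y] x y r by (simp add: g_def)
      qed
      ultimately have "norm (complex_of_real ((f x - f y) $ i)) \<le> M / \<rho>"
        by (simp del: vector_minus_component)
      hence "\<bar>(f x - f y) $ i\<bar> \<le> M / \<rho>" by (simp only: norm_of_real)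
      thus ?thesis using d r by (simp add: \<rho>_def mult_ac)
    qed
    hence "(\<Sum>i\<in>UNIV. \<bar>(f x - f y) $ i\<bar>) \<le> (\<Sum>i\<in>(UNIV :: 'n set). 8 * M / r * d)" by (intro sum_mono)
    thus ?thesis using norm_le_l1_cart[of "f x - f y"] by (simp add: K_def d_def sum_distrib_right)
  qed simp
  moreover have "K \<ge> 0" using r M by (auto simp: K_def)
  ultimately show ?thesis by blast
qed
text \<open>A discrete Gronwall inequality. Bounding each of the \<open>j\<close> terms of the
  geometric sum by \<open>b * q ^ j\<close> is sharp enough for first-order convergence.\<close>

lemma power_iterate_bound:
  fixes e :: "nat \<Rightarrow> real"
  assumes "e 0 \<le> 0" and "\<And>j. j < n \<Longrightarrow> e (Suc j) \<le> q * e j + b" and "q \<ge> 1" "b \<ge> 0" and "j \<le> n"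
  shows "e j \<le> real j * b * q ^ j"
  using \<open>j \<le> n\<close>
proof (induction j)
  case (Suc j)
  have "e (Suc j) \<le> q * e j + b" using assms(2) Suc by simp
  also have "\<dots> \<le> q * (real j * b * q ^ j) + b"
    using Suc assms(3) by (intro add_right_mono mult_left_mono) auto
  also have "\<dots> \<le> q * (real j * b * q ^ j) + b * q ^ Suc j"
    using mult_left_mono[OF one_le_power[OF assms(3), of "Suc j"] assms(4)] by simp
  also have "\<dots> = real (Suc j) * b * q ^ Suc j" by (simp add: algebra_simps)
  finally show ?case .
qed (use assms in auto)

section \<open>Analytic dependence of the flow on its starting point\<close>

locale analytic_flow = lipschitz_flow +
  assumes analytic: "real_analytic_on F X" and compact: "compact X"
begin

lemma F_bounded: obtains B where "B > 0" "\<And>x. x \<in> X \<Longrightarrow> norm (F x) \<le> B"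
proof -
  have "continuous_on X F" using lip by (rule lipschitz_on_continuous_on)
  hence "bounded (F ` X)" using compact compact_continuous_image compact_imp_bounded by blast
  then obtain B where "B > 0" "\<forall>y\<in>F ` X. norm y \<le> B" using bounded_pos by blast
  thus ?thesis using that by blast
qed

text \<open>The Euler polygons of the complexified field are holomorphic in the parameter and
  uniformly bounded; at real parameters they converge to the flow. Montel's theorem therefore
  provides a holomorphic limit extending the flow, without solving a complex differential equation.\<close>

lemma local_flow_analytic:
  assumes p: "p \<in> X"
  obtains \<eta> \<tau> where "\<eta> > 0" "\<tau> > 0"
    "\<And>c s0 t. analytic_curve c s0 \<Longrightarrow> norm (c s0 - p) < \<eta> \<Longrightarrow> (\<exists>\<delta>>0. \<forall>s. \<bar>s - s0\<bar> < \<delta> \<longrightarrow> c s \<in> X) \<Longrightarrow>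
       0 \<le> t \<Longrightarrow> t \<le> \<tau> \<Longrightarrow> analytic_curve (\<lambda>s. flow t (c s)) s0"
proof -
  obtain a where a: "power_series_at F p a" using analytic p by (auto simp: real_analytic_on_def)
  obtain r fh M where r: "r > 0" and M: "M \<ge> 0"
    and fh: "\<And>x. norm (x - p) \<le> r \<Longrightarrow> fh (cvec x) = cvec (F x)"
    and bd: "\<And>z. norm (z - cvec p) \<le> r \<Longrightarrow> norm (fh z) \<le> M"
    and hol: "\<And>z U. open U \<Longrightarrow> holo_curve z U \<Longrightarrow> (\<And>s. s \<in> U \<Longrightarrow> norm (z s - cvec p) \<le> r) \<Longrightarrow>
       holo_curve (\<lambda>s. fh (z s)) U"
  proof (rule complexification_vec[OF a], goal_cases)
    case 1
    show ?case by (rule 1(1)) (fact 1)+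
  qed
  have "\<exists>K\<ge>0. \<forall>x y. norm (x - p) \<le> r / 4 \<longrightarrow> norm (y - p) \<le> r / 4 \<longrightarrow> norm (F x - F y) \<le> K * norm (x - y)"
    by (rule complexification_lipschitz[where fh = fh and M = M]) (fact r M fh bd hol)+
  then obtain K where K: "K \<ge> 0"
    "\<And>x y. norm (x - p) \<le> r / 4 \<Longrightarrow> norm (y - p) \<le> r / 4 \<Longrightarrow> norm (F x - F y) \<le> K * norm (x - y)"
    by blast
  obtain B where B: "B > 0" "\<And>x. x \<in> X \<Longrightarrow> norm (F x) \<le> B" using F_bounded by blast
  \<comment> \<open>Within time \<tau>, neither a polygon of speed at most \<open>M\<close> nor a
    trajectory of speed at most \<open>B\<close> moves farther than \<open>r / 16\<close>.\<close>
  define \<tau> where "\<tau> = r / (16 * (M + B))"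
  have \<tau>: "\<tau> > 0" "\<tau> * M \<le> r / 16" "\<tau> * B \<le> r / 16"
    using r M B by (auto simp: \<tau>_def field_simps)
  have "analytic_curve (\<lambda>s. flow t (c s)) s0"
    if c: "analytic_curve c s0" and near: "norm (c s0 - p) < r / 16"
      and cX: "\<exists>\<delta>>0. \<forall>s. \<bar>s - s0\<bar> < \<delta> \<longrightarrow> c s \<in> X" and t: "0 \<le> t" "t \<le> \<tau>" for c s0 t
  proof -
    obtain \<delta>0 where \<delta>0: "\<delta>0 > 0" "\<And>s. \<bar>s - s0\<bar> < \<delta>0 \<Longrightarrow> c s \<in> X" using cX by blast
    obtain \<delta> z where \<delta>: "\<delta> > 0" "\<delta> \<le> \<delta>0" and hz: "holo_curve z (ball (of_real s0) \<delta>)"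
      and zc: "\<And>s. \<bar>s - s0\<bar> < \<delta> \<Longrightarrow> z (of_real s) = cvec (c s)"
      and zr: "\<And>s. s \<in> ball (of_real s0) \<delta> \<Longrightarrow> norm (z s - cvec p) < r / 16"
      by (rule analytic_curve_near[OF c near \<delta>0(1)]) (rule that)
    define U where "U = ball (complex_of_real s0) \<delta>"
    \<comment> \<open>There are \<open>Suc N\<close> steps, so the step size makes sense for
      \<open>N = 0\<close> too.\<close>
    define h where "h = (\<lambda>N. t / real (Suc N))"
    have h: "h N \<ge> 0" "real (Suc N) * h N = t" for N using t by (auto simp: h_def)
    define e where "e = (\<lambda>N j s. ((\<lambda>v. v + h N *\<^sub>R fh v) ^^ j) (z s))"
    have e_simps: "e N 0 s = z s" "e N (Suc j) s = e N j s + h N *\<^sub>R fh (e N j s)" for N j s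
      by (simp_all add: e_def)
    have jh: "real j * h N \<le> t" if "j \<le> Suc N" for j N
      using mult_right_mono[of "real j" "real (Suc N)" "h N"] that h[of N] by simp
    have e_near: "norm (e N j s - z s) \<le> real j * h N * M" if "j \<le> Suc N" "s \<in> U" for N j s
      using that
    proof (induction j)
      case (Suc j)
      hence IH: "norm (e N j s - z s) \<le> real j * h N * M" by simp
      also have "\<dots> \<le> \<tau> * M"
        using jh[of j N] Suc.prems t M by (intro mult_right_mono) auto
      finally have "norm (e N j s - z s) \<le> r / 16" using \<tau> by simp
      hence "norm (e N j s - cvec p) \<le> r"
        using zr[of s] Suc.prems norm_triangle_ineq[of "e N j s - z s" "z s - cvec p"] r by (simp add: U_def)
      hence "norm (h N *\<^sub>R fh (e N j s)) \<le> h N * M"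
        using bd h by (simp add: mult_left_mono)
      moreover have "norm (e N (Suc j) s - z s) \<le> norm (e N j s - z s) + norm (h N *\<^sub>R fh (e N j s))"
        using norm_triangle_ineq[of "e N j s - z s" "h N *\<^sub>R fh (e N j s)"] by (simp add: e_simps algebra_simps)
      ultimately show ?case using IH by (simp add: algebra_simps)
    qed (simp add: e_simps)
    have e_r: "norm (e N j s - cvec p) \<le> r / 8" if "j \<le> Suc N" "s \<in> U" for N j s
    proof -
      have "norm (e N j s - z s) \<le> real j * h N * M" using e_near that by blast
      also have "\<dots> \<le> \<tau> * M" using jh[of j N] that t M by (intro mult_right_mono) auto
      finally have "norm (e N j s - z s) \<le> r / 16" using \<tau> by simp
      thus ?thesis
        using zr[of s] that norm_triangle_ineq[of "e N j s - z s" "z s - cvec p"] r by (simp add: U_def)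
    qed
    have e_hol: "holo_curve (e N j) U" if "j \<le> Suc N" for N j
      using that
    proof (induction j)
      case 0
      thus ?case using hz by (simp add: e_simps[abs_def] U_def)
    next
      case (Suc j)
      have "holo_curve (\<lambda>s. fh (e N j s)) U"
      proof (rule hol)
        show "norm (e N j s - cvec p) \<le> r" if "s \<in> U" for s
          using e_r[of j N s] that Suc.prems r by simp
      qed (use Suc in \<open>auto simp: U_def\<close>)
      with Suc show ?case
        by (auto simp: holo_curve_def e_simps[abs_def] scaleR_conv_of_real[where 'a=complex] intro!: holomorphic_intros)
    qed
    have lim: "(\<lambda>N. e N (Suc N) (of_real s)) \<longlonglongrightarrow> cvec (flow t (c s))" if s: "\<bar>s - s0\<bar> < \<delta>" for s
    proof -
      define y where "y = c s"
      have y: "y \<in> X" using \<delta>0(2) s \<delta> by (simp add: y_def)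
      have sU: "of_real s \<in> U" using s by (simp add: U_def of_real_in_ball)
      have yp: "norm (y - p) < r / 16" using zr[of "of_real s"] sU zc[OF s] by (simp add: U_def y_def flip: cvec_simps)
      define x where "x = (\<lambda>N j. ((\<lambda>v. v + h N *\<^sub>R F v) ^^ j) y)"
      have x_simps: "x N 0 = y" "x N (Suc j) = x N j + h N *\<^sub>R F (x N j)" for N j
        by (simp_all add: x_def)
      have ex: "e N j (of_real s) = cvec (x N j)" if "j \<le> Suc N" for N j
        using that
      proof (induction j)
        case 0
        thus ?case using zc[OF s] by (simp add: e_simps x_simps y_def)
      next
        case (Suc j)
        hence "norm (cvec (x N j) - cvec p) \<le> r / 8" using e_r[of j N "of_real s"] sU by simp
        hence "norm (x N j - p) \<le> r" using r by (simp flip: cvec_simps)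
        thus ?case using Suc fh by (simp add: e_simps x_simps)
      qed
      have x_r: "norm (x N j - p) \<le> r / 4" if "j \<le> Suc N" for N j
        using e_r[OF that sU] ex[OF that] r by (simp flip: cvec_simps)
      \<comment> \<open>One step multiplies the old error by at most \<open>1 + h N * K\<close> and
        adds the local Euler error. \<open>K\<close> compares \<open>F\<close> at a trajectory point
        with \<open>F\<close> at a vertex that may lie outside \<open>X\<close>, which is why both
        are kept within \<open>r / 4\<close> of \<open>p\<close>.\<close>
      have err: "norm (flow (real j * h N) y - x N j) \<le> real j * (L * B * (h N)\<^sup>2) * (1 + h N * K) ^ j"
        if "j \<le> Suc N" for N j
      proof (rule power_iterate_bound[where n = "Suc N"])
        fix j assume j: "j < Suc N"
        define u where "u = flow (real j * h N) y"
        have u: "u \<in> X" using y h by (simp add: u_def flow_in)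
        have uS: "flow (real (Suc j) * h N) y = flow (h N) u"
          using flow_add[OF y, of "real j * h N" "h N"] h by (simp add: u_def algebra_simps)
        have "norm (u - y) \<le> B * (real j * h N)"
          unfolding u_def by (rule flow_speed_le) (use y h B flow_in in auto)
        also have "\<dots> \<le> B * \<tau>" using jh[of j N] j t B by (intro mult_left_mono) auto
        finally have "norm (u - p) \<le> r / 4"
          using r yp \<tau> norm_triangle_ineq[of "u - y" "y - p"] by (simp add: mult.commute)
        hence "norm (F u - F (x N j)) \<le> K * norm (u - x N j)"
          using x_r[of j N] j by (intro K) auto
        hence 1: "norm (h N *\<^sub>R (F u - F (x N j))) \<le> h N * (K * norm (u - x N j))"
          using h by (simp add: mult_left_mono)
        have 2: "norm (flow (h N) u - u - h N *\<^sub>R F u) \<le> L * B * (h N)\<^sup>2"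
          by (rule flow_euler_step_le) (use u h B flow_in in auto)
        have "flow (h N) u - x N (Suc j) = (flow (h N) u - u - h N *\<^sub>R F u) + (u - x N j) + h N *\<^sub>R (F u - F (x N j))"
          by (simp add: x_simps algebra_simps)
        also have "norm \<dots> \<le> L * B * (h N)\<^sup>2 + norm (u - x N j) + h N * (K * norm (u - x N j))"
          using 1 2 by (intro order_trans[OF norm_triangle_ineq] add_mono) auto
        finally show "norm (flow (real (Suc j) * h N) y - x N (Suc j)) \<le>
            (1 + h N * K) * norm (flow (real j * h N) y - x N j) + L * B * (h N)\<^sup>2"
          unfolding uS u_def[symmetric] by (simp add: algebra_simps)
      qed (use that y h K L_nonneg B in \<open>auto simp: x_simps\<close>)
      have "norm (e N (Suc N) (of_real s) - cvec (flow t y)) \<le> (L * B * t\<^sup>2 * exp (t * K)) * inverse (real (Suc N))" for N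
      proof -
        have "norm (e N (Suc N) (of_real s) - cvec (flow t y)) = norm (x N (Suc N) - flow t y)"
          by (simp add: ex flip: cvec_simps)
        also have "\<dots> \<le> real (Suc N) * (L * B * (h N)\<^sup>2) * (1 + h N * K) ^ Suc N"
          using err[of "Suc N" N] by (simp only: h norm_minus_commute)
        also have "\<dots> \<le> real (Suc N) * (L * B * (h N)\<^sup>2) * exp (t * K)"
        proof (intro mult_left_mono)
          have "(1 + h N * K) ^ Suc N \<le> exp (h N * K) ^ Suc N"
            using h K by (intro power_mono exp_ge_add_one_self) auto
          also have "\<dots> = exp (t * K)"
            unfolding exp_of_nat_mult[symmetric] by (simp only: h mult.assoc[symmetric])
          finally show "(1 + h N * K) ^ Suc N \<le> exp (t * K)" .
        qed (use L_nonneg B in auto)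
        also have "real (Suc N) * (L * B * (h N)\<^sup>2) = L * B * t\<^sup>2 * inverse (real (Suc N))"
          by (simp add: h_def power2_eq_square divide_simps del: of_nat_Suc)
        finally show ?thesis by (simp only: mult_ac)
      qed
      moreover have "(\<lambda>N. (L * B * t\<^sup>2 * exp (t * K)) * inverse (real (Suc N))) \<longlonglongrightarrow> 0"
        by (rule tendsto_mult_right_zero[OF LIMSEQ_inverse_real_of_nat])
      ultimately have "(\<lambda>N. e N (Suc N) (of_real s) - cvec (flow t y)) \<longlonglongrightarrow> 0"
        by (intro Lim_null_comparison[of "\<lambda>N. e N (Suc N) (of_real s) - cvec (flow t y)"] always_eventually) auto
      thus ?thesis by (simp add: y_def LIM_zero_iff)
    qed
    have "\<exists>g. g holomorphic_on U \<and> (\<forall>s. \<bar>s - s0\<bar> < \<delta> \<longrightarrow> g (of_real s) = of_real (flow t (c s) $ i))" for i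
    proof -
      have ho: "(\<lambda>s. e N (Suc N) s $ i) holomorphic_on U" for N
        using e_hol[of "Suc N" N] by (simp add: holo_curve_def)
      have bo: "norm (e N (Suc N) s $ i) \<le> norm (cvec p) + r" if "s \<in> U" for N s
      proof -
        have "norm (e N (Suc N) s $ i) \<le> norm (e N (Suc N) s)" by (rule Finite_Cartesian_Product.norm_nth_le)
        also have "\<dots> \<le> norm (cvec p) + norm (e N (Suc N) s - cvec p)"
          using norm_triangle_ineq[of "cvec p" "e N (Suc N) s - cvec p"] by simp
        also have "\<dots> \<le> norm (cvec p) + r" using e_r[of "Suc N" N s] that r by simp
        finally show ?thesis .
      qed
      obtain g k where g: "g holomorphic_on U" "strict_mono (k :: nat \<Rightarrow> nat)"
        "\<And>x. x \<in> U \<Longrightarrow> (\<lambda>n. e (k n) (Suc (k n)) x $ i) \<longlonglongrightarrow> g x"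
      proof (rule Montel[of U "range (\<lambda>N s. e N (Suc N) s $ i)" "\<lambda>N s. e N (Suc N) s $ i"])
        show "\<exists>B. \<forall>h\<in>range (\<lambda>N s. e N (Suc N) s $ i). \<forall>z\<in>K. norm (h z) \<le> B" if "K \<subseteq> U" for K
          using bo that by blast
      qed (use ho in \<open>auto simp: U_def\<close>)
      have "g (of_real s) = of_real (flow t (c s) $ i)" if s: "\<bar>s - s0\<bar> < \<delta>" for s
      proof (rule LIMSEQ_unique)
        show "(\<lambda>n. e (k n) (Suc (k n)) (of_real s) $ i) \<longlonglongrightarrow> g (of_real s)"
          by (rule g(3)) (use s in \<open>simp add: U_def of_real_in_ball\<close>)
        have "(\<lambda>N. e N (Suc N) (of_real s) $ i) \<longlonglongrightarrow> cvec (flow t (c s)) $ i"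
          by (intro tendsto_vec_nth lim s)
        from LIMSEQ_subseq_LIMSEQ[OF this g(2)]
        show "(\<lambda>n. e (k n) (Suc (k n)) (of_real s) $ i) \<longlonglongrightarrow> of_real (flow t (c s) $ i)"
          by (simp add: o_def)
      qed
      thus ?thesis using g(1) by blast
    qed
    then obtain g where g: "\<And>i. g i holomorphic_on U"
      "\<And>i s. \<bar>s - s0\<bar> < \<delta> \<Longrightarrow> g i (of_real s) = of_real (flow t (c s) $ i)" by metis
    show ?thesis
      unfolding analytic_curve_def
    proof (intro exI conjI allI impI)
      show "holo_curve (\<lambda>s. \<chi> i. g i s) (ball (of_real s0) \<delta>)"
        using g(1) by (simp add: holo_curve_def U_def)
      show "(\<chi> i. g i (of_real s)) = cvec (flow t (c s))" if "\<bar>s - s0\<bar> < \<delta>" for s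
        using g(2)[OF that] by (simp add: vec_eq_iff)
    qed (rule \<delta>)
  qed
  thus ?thesis using that[of "r / 16" \<tau>] r \<tau> by simp
qed

text \<open>Times at which analyticity fails would have an infimum \<open>T0\<close>. The local
  result at the point reached at time \<open>T0\<close> comes with a positive time step \<tau>;
  started a little before \<open>T0\<close>, it reaches beyond \<open>T0\<close> and contradicts the
  infimum.\<close>

lemma flow_analytic:
  assumes c: "analytic_curve c s0" and cX: "\<delta> > 0" "\<And>s. \<bar>s - s0\<bar> < \<delta> \<Longrightarrow> c s \<in> X" and T: "T \<ge> 0"
  shows "analytic_curve (\<lambda>s. flow T (c s)) s0"
proof (rule ccontr)
  assume neg: "\<not> ?thesis"
  define A where "A = (\<lambda>T. analytic_curve (\<lambda>s. flow T (c s)) s0)"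
  define C where "C = {T. T \<ge> 0 \<and> \<not> A T}"
  have "C \<noteq> {}" using neg T by (auto simp: C_def A_def)
  have bdd: "bdd_below C" by (auto simp: C_def bdd_below_def)
  define T0 where "T0 = Inf C"
  have T0: "T0 \<ge> 0" unfolding T0_def by (rule cInf_greatest) (use \<open>C \<noteq> {}\<close> in \<open>auto simp: C_def\<close>)
  have below: "A t" if "0 \<le> t" "t < T0" for t
    using cInf_lower[OF _ bdd, of t] that by (force simp: C_def T0_def)
  have c0: "c s0 \<in> X" using cX by simp
  \<comment> \<open>\<open>flow 0\<close> is the identity on \<open>X\<close>, so the disc is shrunk
    until the real part of the curve stays in \<open>X\<close>.\<close>
  have A0: "A 0"
  proof -
    obtain \<delta>' z where z: "\<delta>' > 0" "\<delta>' \<le> \<delta>" "holo_curve z (ball (of_real s0) \<delta>')"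
      "\<And>s. \<bar>s - s0\<bar> < \<delta>' \<Longrightarrow> z (of_real s) = cvec (c s)"
      by (rule analytic_curve_near[OF c, of "c s0" 1 \<delta>]) (use cX(1) that in auto)
    thus ?thesis unfolding A_def analytic_curve_def using cX(2)
      by (intro exI[of _ \<delta>'] conjI exI[of _ z]) auto
  qed
  define p where "p = flow T0 (c s0)"
  obtain \<eta> \<tau> where \<eta>: "\<eta> > 0" "\<tau> > 0" and loc:
    "\<And>c s0 t. analytic_curve c s0 \<Longrightarrow> norm (c s0 - p) < \<eta> \<Longrightarrow> (\<exists>\<delta>>0. \<forall>s. \<bar>s - s0\<bar> < \<delta> \<longrightarrow> c s \<in> X) \<Longrightarrow>
       0 \<le> t \<Longrightarrow> t \<le> \<tau> \<Longrightarrow> analytic_curve (\<lambda>s. flow t (c s)) s0"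
    by (rule local_flow_analytic[of p]) (use flow_in[OF c0 T0] that in \<open>auto simp: p_def\<close>)
  have step: "A (T' + t)" if "A T'" "T' \<ge> 0" "norm (flow T' (c s0) - p) < \<eta>" "0 \<le> t" "t \<le> \<tau>" for T' t
  proof -
    have "analytic_curve (\<lambda>s. flow t (flow T' (c s))) s0"
      by (rule loc) (use that cX flow_in in \<open>auto simp: A_def\<close>)
    then obtain d z where z: "d > 0" "holo_curve z (ball (of_real s0) d)"
      "\<And>s. \<bar>s - s0\<bar> < d \<Longrightarrow> z (of_real s) = cvec (flow t (flow T' (c s)))"
      by (auto simp: analytic_curve_def)
    show ?thesis unfolding A_def analytic_curve_def
    proof (intro exI conjI allI impI)
      show "min d \<delta> > 0" using z cX by simp
      show "holo_curve z (ball (of_real s0) (min d \<delta>))" by (rule holo_curve_subset[OF z(2)]) auto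
      show "z (of_real s) = cvec (flow (T' + t) (c s))" if "\<bar>s - s0\<bar> < min d \<delta>" for s
        using z(3)[of s] flow_add[OF cX(2)[of s], of T' t] that \<open>0 \<le> t\<close> \<open>T' \<ge> 0\<close> by simp
    qed
  qed
  \<comment> \<open>A time of known analyticity, less than \<tau> before \<open>T0\<close> and with
    position close to \<open>p\<close>; for \<open>T0 = 0\<close> it can only be 0 itself.\<close>
  obtain T' where T': "0 \<le> T'" "A T'" "T' \<le> T0" "T0 < T' + \<tau>" "norm (flow T' (c s0) - p) < \<eta>"
  proof (cases "T0 = 0")
    case True
    thus ?thesis using that[of 0] A0 \<eta> c0 by (simp add: p_def)
  next
    case False
    have "continuous (at T0 within {0..}) (\<lambda>t. flow t (c s0))"
      using flow_continuous_on[OF c0] T0 by (simp add: continuous_on_eq_continuous_within)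
    then obtain d where d: "d > 0" "\<And>t. t \<ge> 0 \<Longrightarrow> \<bar>t - T0\<bar> < d \<Longrightarrow> norm (flow t (c s0) - p) < \<eta>"
      using \<eta>(1) unfolding continuous_within_eps_delta p_def dist_norm real_norm_def by force
    define T' where "T' = max 0 (T0 - min d \<tau> / 2)"
    have "0 \<le> T'" "T' < T0" "T0 - T' < d" "T0 - T' < \<tau>" using d(1) \<eta>(2) False T0 by (auto simp: T'_def)
    thus ?thesis using that[of T'] below[of T'] d(2)[of T'] by simp
  qed
  obtain T1 where T1: "T1 \<in> C" "T1 < T' + \<tau>"
    using cInf_lessD[OF \<open>C \<noteq> {}\<close>] T'(4) unfolding T0_def by blast
  have "T0 \<le> T1" unfolding T0_def by (rule cInf_lower[OF T1(1) bdd])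
  hence "A T1" using step[OF T'(2,1,5), of "T1 - T'"] T1(2) T'(3) by simp
  thus False using T1(1) by (simp add: C_def)
qed

end

section \<open>Leading parts of Koopman eigenfunctions\<close>

text \<open>The remainder after degree one is quadratic in \<open>norm x\<close>, so it has
  derivative 0 at the origin.\<close>

lemma power_series_at_has_derivative_0:
  fixes f :: "real^'n::finite \<Rightarrow> complex"
  assumes "power_series_at f 0 a"
  shows "(f has_derivative hder a 1 0) (at 0)"
proof -
  obtain r C where r: "r > 0" "C \<ge> 0"
    "\<And>m x. norm x \<le> r \<Longrightarrow> norm (f x - (\<Sum>j\<le>m. hpart a j x)) \<le> C * (norm x / r) ^ Suc m"
    by (rule hpart_remainder[OF assms]) (rule that)
  define R where "R = (\<lambda>x. f x - (hpart a 0 x + hpart a 1 x))"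
  have R: "norm (R x) \<le> C * (norm x / r)\<^sup>2" if "norm x \<le> r" for x
    using r(3)[OF that, of 1] by (simp add: R_def power2_eq_square)
  have R0: "R 0 = 0" using R[of 0] r(1) by simp
  have "(R has_derivative (\<lambda>_. 0)) (at 0)"
  proof (rule has_derivativeI_sandwich[OF r(1)])
    fix y :: "real^'n" assume y: "y \<noteq> 0" "dist y 0 < r"
    have "norm (R y) / norm y \<le> C * (norm y / r)\<^sup>2 / norm y"
      using y R[of y] by (intro divide_right_mono) auto
    also have "\<dots> = (C / r\<^sup>2) * norm y" using y r(1) by (simp add: power2_eq_square)
    finally show "norm (R y - R 0 - 0) / norm (y - 0) \<le> (C / r\<^sup>2) * norm y" by (simp add: R0)
  next
    show "((\<lambda>y. C / r\<^sup>2 * norm y) \<longlongrightarrow> 0) (at (0 :: real^'n))"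
      by (intro tendsto_mult_right_zero tendsto_norm_zero tendsto_ident_at)
  qed auto
  hence "((\<lambda>x. R x + (hpart a 0 x + hpart a 1 x)) has_derivative
      (\<lambda>h. 0 + (hder a 0 0 h + hder a 1 0 h))) (at 0)"
    by (intro has_derivative_add has_derivative_hpart)
  thus ?thesis by (simp add: R_def hder_def[of a 0] del: One_nat_def)
qed

text \<open>A linear form is its own derivative. This is computed at the origin along a ray and
  carries over to every \<open>y\<close>, as the coefficients of \<open>hder a 1 y\<close> are
  constants.\<close>

lemma hpart_1_eq_hder: "hder a 1 y x = hpart a 1 x"
proof -
  have "((\<lambda>s::real. s *\<^sub>R x) has_derivative (\<lambda>s. s *\<^sub>R x)) (at 0)"
    by (auto intro!: derivative_eq_intros)
  from diff_chain_at[OF this has_derivative_hpart[of a 1]]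
  have "((\<lambda>s. hpart a 1 (s *\<^sub>R x)) has_derivative (\<lambda>s. hder a 1 0 (s *\<^sub>R x))) (at 0)"
    by (simp add: o_def)
  moreover have "((\<lambda>s. hpart a 1 (s *\<^sub>R x)) has_derivative (\<lambda>s. of_real s * hpart a 1 x)) (at 0)"
    unfolding hpart_scaleR by (auto intro!: derivative_eq_intros)
  ultimately have "(\<lambda>s. hder a 1 0 (s *\<^sub>R x)) = (\<lambda>s. of_real s * hpart a 1 x)"
    by (rule has_derivative_unique)
  from fun_cong[OF this, of 1] have "hder a 1 0 x = hpart a 1 x" by simp
  thus ?thesis by (simp add: hder_def hpart_0)
qed

lemma power_series_at_0:
  assumes "power_series_at f 0 a"
  shows "hpart a 0 x = f 0"
proof -
  obtain r C where r: "r > 0" "C \<ge> 0"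
    "\<And>m x. norm x \<le> r \<Longrightarrow> norm (f x - (\<Sum>j\<le>m. hpart a j x)) \<le> C * (norm x / r) ^ Suc m"
    by (rule hpart_remainder[OF assms]) (rule that)
  from r(3)[of 0 0] r(1) show ?thesis by (simp add: hpart_0)
qed

text \<open>The remainder bound holds for all \<open>m\<close> with the same constants, so letting
  \<open>m\<close> tend to infinity gives 0 wherever \<open>norm x < r\<close>.\<close>

lemma hpart_zero_imp_zero:
  fixes f :: "real^'n::finite \<Rightarrow> complex"
  assumes f: "power_series_at f 0 a" and z: "\<And>m x. hpart a m x = 0"
  obtains r where "r > 0" "\<And>x. norm x < r \<Longrightarrow> f x = 0"
proof -
  obtain r C where r: "r > 0" "C \<ge> 0"
    "\<And>m x. norm x \<le> r \<Longrightarrow> norm (f x - (\<Sum>j\<le>m. hpart a j x)) \<le> C * (norm x / r) ^ Suc m"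
    by (rule hpart_remainder[OF f]) (rule that)
  have "f x = 0" if "norm x < r" for x
  proof -
    have "(\<lambda>m. C * (norm x / r) ^ Suc m) \<longlonglongrightarrow> 0"
      using that r by (intro tendsto_mult_right_zero LIMSEQ_Suc LIMSEQ_power_zero) auto
    moreover have "norm (f x) \<le> C * (norm x / r) ^ Suc m" for m
      using r(3)[of x m] that by (simp add: z)
    ultimately have "norm (f x) \<le> 0"
      by (intro LIMSEQ_le_const[of "\<lambda>m. C * (norm x / r) ^ Suc m"]) auto
    thus ?thesis by simp
  qed
  with that r(1) show ?thesis by blast
qed

lemma real_analytic_on_combination:
  fixes f :: "'i \<Rightarrow> real^'n::finite \<Rightarrow> complex"
  assumes "finite I" "\<And>i. i \<in> I \<Longrightarrow> real_analytic_on (f i) A"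
  shows "real_analytic_on (\<lambda>x. \<Sum>i\<in>I. c i * f i x) A"
  using assms
proof (induction I rule: finite_induct)
  case empty
  have "power_series_at (\<lambda>x. 0 :: complex) p (\<lambda>k. 0)" for p :: "real^'n"
    unfolding power_series_at_def by (auto intro!: exI[of _ "1::real"])
  thus ?case by (auto simp: real_analytic_on_def)
next
  case (insert i I)
  show ?case
    unfolding real_analytic_on_def
  proof
    fix p assume p: "p \<in> A"
    obtain a where "power_series_at (f i) p a"
      using insert.prems[of i] p by (auto simp: real_analytic_on_def)
    then obtain r where r: "r > 0" "\<And>x. (\<forall>j. \<bar>x $ j - p $ j\<bar> < r) \<Longrightarrow>
        ((\<lambda>k. monomial k (x - p) *\<^sub>R a k) has_sum f i x) UNIV"
      by (auto simp: power_series_at_def)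
    have "real_analytic_on (\<lambda>x. \<Sum>i\<in>I. c i * f i x) A"
      using insert by blast
    then obtain b where "power_series_at (\<lambda>x. \<Sum>i\<in>I. c i * f i x) p b"
      using p by (auto simp: real_analytic_on_def)
    then obtain r' where r': "r' > 0" "\<And>x. (\<forall>j. \<bar>x $ j - p $ j\<bar> < r') \<Longrightarrow>
        ((\<lambda>k. monomial k (x - p) *\<^sub>R b k) has_sum (\<Sum>i\<in>I. c i * f i x)) UNIV"
      by (auto simp: power_series_at_def)
    have "power_series_at (\<lambda>x. \<Sum>i\<in>insert i I. c i * f i x) p (\<lambda>k. c i * a k + b k)"
      unfolding power_series_at_def
    proof (intro exI[of _ "min r r'"] conjI allI impI)
      fix x assume x: "\<forall>j. \<bar>x $ j - p $ j\<bar> < min r r'"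
      have "((\<lambda>k. c i * (monomial k (x - p) *\<^sub>R a k) + monomial k (x - p) *\<^sub>R b k) has_sum
          (c i * f i x + (\<Sum>i\<in>I. c i * f i x))) UNIV"
        using x by (intro has_sum_add has_sum_cmult_right r r') auto
      thus "((\<lambda>k. monomial k (x - p) *\<^sub>R (c i * a k + b k)) has_sum (\<Sum>i\<in>insert i I. c i * f i x)) UNIV"
        using insert by (simp add: algebra_simps)
    qed (use r r' in auto)
    thus "\<exists>a. power_series_at (\<lambda>x. \<Sum>i\<in>insert i I. c i * f i x) p a" by blast
  qed
qed

lemma has_vector_derivative_right_sandwich:
  fixes g :: "real \<Rightarrow> 'b::real_normed_vector"
  assumes e: "e > 0" and le: "\<And>t. 0 < t \<Longrightarrow> t < e \<Longrightarrow> norm (g t - g 0 - t *\<^sub>R D) \<le> t * H t"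
    and H: "(H \<longlongrightarrow> 0) (at_right 0)"
  shows "(g has_vector_derivative D) (at 0 within {0..})"
  unfolding has_vector_derivative_def
proof (rule has_derivativeI_sandwich[OF e bounded_linear_scaleR_left])
  fix t :: real assume "t \<in> {0..}" "t \<noteq> 0" "dist t 0 < e"
  thus "norm (g t - g 0 - (t - 0) *\<^sub>R D) / norm (t - 0) \<le> H t"
    using le[of t] by (simp add: field_simps)
next
  show "(H \<longlongrightarrow> 0) (at 0 within {0..})"
    using H by (simp add: at_within_Ici_at_right)
qed

locale koopman = analytic_flow F X flow L
  for F :: "real^'n::finite \<Rightarrow> real^'n" and X flow L +
  fixes S :: real and lam :: "'n \<Rightarrow> complex" and \<phi> :: "'n \<Rightarrow> real^'n \<Rightarrow> complex"
  assumes F_0: "F 0 = 0"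
    and eigenvalues: "eigenvalue_family (jacobian F (at 0)) lam"
    and stable: "\<And>i. Re (lam i) < 0"
    and nonres: "nonresonant lam"
    and S_pos: "S > 0" and cube_sub: "cube S \<subseteq> X"
    and principal: "principal_eigenfunctions F (cube S) lam \<phi>"
    and \<phi>_analytic: "\<And>i. real_analytic_on (\<phi> i) (cube S)"
begin

abbreviation A :: "real^'n^'n" where "A \<equiv> jacobian F (at 0)"

lemma small_in_cube: "norm x < S \<Longrightarrow> x \<in> cube S"
  using component_le_norm_cart[of x] by (auto simp: cube_def intro: le_less_trans)

lemma zero_in_cube: "0 \<in> cube S"
  using S_pos by (simp add: cube_def)

lemma zero_in_X: "0 \<in> X"
  using zero_in_cube cube_sub by blast

lemma open_cube: "open (cube S :: (real^'n) set)"
proof -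
  have "cube S = (\<Inter>i. {x :: real^'n. \<bar>x $ i\<bar> < S})" by (auto simp: cube_def)
  also have "open \<dots>"
    by (intro open_INT ballI open_Collect_less continuous_intros) auto
  finally show ?thesis .
qed

lemma flow_zero: "t \<ge> 0 \<Longrightarrow> flow t 0 = 0"
proof -
  assume t: "t \<ge> 0"
  have "solution (\<lambda>_. 0)" by (simp add: solution_def zero_in_X F_0)
  from solution_diff_le[OF solution_flow[OF zero_in_X] this t] show ?thesis
    using zero_in_X by simp
qed

lemma norm_flow_le: "x \<in> X \<Longrightarrow> t \<ge> 0 \<Longrightarrow> norm (flow t x) \<le> exp (L * t) * norm x"
  using flow_diff_le[OF _ zero_in_X, of x t] flow_zero[of t] by simp

lemma norm_F_le: "x \<in> X \<Longrightarrow> norm (F x) \<le> L * norm x"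
  using norm_F_diff_le[OF _ zero_in_X, of x] F_0 by simp

text \<open>\<open>jacobian\<close> describes the derivative once differentiability is known, and
  that is read off the power series component by component.\<close>

lemma F_has_derivative: "(F has_derivative (*v) A) (at 0)"
proof -
  obtain a where a: "power_series_at F 0 a" using analytic zero_in_X by (auto simp: real_analytic_on_def)
  have "(\<lambda>x. F x $ i) differentiable (at 0)" for i
  proof -
    have bl: "bounded_linear (\<lambda>v::real^'n. complex_of_real (v $ i))"
      by (intro bounded_linear_compose[OF bounded_linear_of_real bounded_linear_vec_nth])
    obtain r where r: "r > 0" "\<And>x. (\<forall>i. \<bar>x $ i - 0 $ i\<bar> < r) \<Longrightarrow>
        ((\<lambda>k. monomial k (x - 0) *\<^sub>R a k) has_sum F x) UNIV"
      using a by (auto simp: power_series_at_def)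
    have "power_series_at (\<lambda>x. complex_of_real (F x $ i)) 0 (\<lambda>k. of_real (a k $ i))"
      unfolding power_series_at_def using r(1) has_sum_bounded_linear[OF bl r(2)]
      by (auto simp: scaleR_conv_of_real[where 'a=complex])
    from power_series_at_has_derivative_0[OF this]
    have "((\<lambda>x. Re (complex_of_real (F x $ i))) has_derivative (\<lambda>h. Re (hder (\<lambda>k. of_real (a k $ i)) 1 0 h))) (at 0)"
      by (rule bounded_linear.has_derivative[OF bounded_linear_Re])
    thus ?thesis by (auto simp: differentiable_def)
  qed
  hence "F differentiable (at 0)"
    by (subst differentiable_componentwise_within) (auto simp: Basis_vec_def inner_axis)
  thus ?thesis by (simp add: jacobian_works)
qed

text \<open>The rescaled trajectory \<open>w(t) = flow t (t\<^sup>2 x) / t\<^sup>2\<close> leaves \<open>x\<close> with velocity \<open>A x\<close>, while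
  \<open>\<psi> (flow t y) = exp (\<mu> t) \<psi> y\<close> forces \<open>P (w t) = exp (\<mu> t) P x + O(t\<^sup>2)\<close> for the leading part \<open>P\<close>.\<close>

lemma leading_part_eigen:
  fixes \<psi> :: "real^'n \<Rightarrow> complex"
  assumes a: "power_series_at \<psi> 0 a"
    and eig: "\<And>x. x \<in> cube S \<Longrightarrow> \<psi> differentiable (at x) \<and> generator F \<psi> x = \<mu> * \<psi> x"
    and low: "\<And>j x. j < m \<Longrightarrow> hpart a j x = 0"
  shows "hder a m x (A *v x) = \<mu> * hpart a m x"
proof -
  obtain r C where r: "r > 0" "C \<ge> 0" and rem0:
    "\<And>m x. norm x \<le> r \<Longrightarrow> norm (\<psi> x - (\<Sum>j\<le>m. hpart a j x)) \<le> C * (norm x / r) ^ Suc m"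
    by (rule hpart_remainder[OF a]) (rule that)
  define P where "P = hpart a m"
  have rem: "norm (\<psi> x - P x) \<le> C * (norm x / r) ^ Suc m" if "norm x \<le> r" for x
  proof -
    have "(\<Sum>j\<le>m. hpart a j x) = (\<Sum>j\<in>{m}. hpart a j x)"
      by (rule sum.mono_neutral_right) (use low in auto)
    thus ?thesis using rem0[OF that, of m] by (simp add: P_def)
  qed
  define E where "E = exp L"
  have E: "E \<ge> 1" using L_nonneg by (simp add: E_def)
  \<comment> \<open>Keeps the starting point \<open>t\<^sup>2 *\<^sub>R x\<close> and its trajectory
    up to time \<open>t\<close> inside the cube and inside the ball of the remainder estimate;
    \<open>E\<close> bounds the growth of trajectories up to time 1.\<close>
  define \<epsilon> where "\<epsilon> = min 1 (min r (S / 2) / (E * (norm x + 1)))"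
  have \<epsilon>: "\<epsilon> > 0" "\<epsilon> \<le> 1" using r S_pos E by (auto simp: \<epsilon>_def add_nonneg_pos intro!: divide_pos_pos mult_pos_pos)
  have small: "t\<^sup>2 *\<^sub>R x \<in> X" "norm (flow s (t\<^sup>2 *\<^sub>R x)) \<le> E * (t\<^sup>2 * norm x)" "E * (t\<^sup>2 * norm x) \<le> r"
      "flow s (t\<^sup>2 *\<^sub>R x) \<in> cube S"
    if t: "0 < t" "t < \<epsilon>" and s: "0 \<le> s" "s \<le> t" for t s
  proof -
    have "t * t \<le> 1 * t" using t \<epsilon> by (intro mult_right_mono) auto
    hence "t\<^sup>2 \<le> \<epsilon>" unfolding power2_eq_square using t by linarith
    hence "E * (t\<^sup>2 * norm x) \<le> E * (\<epsilon> * (norm x + 1))" using E \<epsilon> by (intro mult_left_mono mult_mono) auto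
    also have "\<dots> = \<epsilon> * (E * (norm x + 1))" by simp
    also have "\<dots> \<le> (min r (S / 2) / (E * (norm x + 1))) * (E * (norm x + 1))"
      using E by (intro mult_right_mono) (auto simp: \<epsilon>_def)
    also have "\<dots> = min r (S / 2)"
    proof -
      have "E * (norm x + 1) \<noteq> 0"
        using E add_nonneg_pos[OF norm_ge_zero zero_less_one, of x] by simp
      thus ?thesis by (metis nonzero_eq_divide_eq)
    qed
    finally have *: "E * (t\<^sup>2 * norm x) \<le> min r (S / 2)" .
    have "1 * (t\<^sup>2 * norm x) \<le> E * (t\<^sup>2 * norm x)" using E by (intro mult_right_mono) auto
    hence "norm (t\<^sup>2 *\<^sub>R x) < S" using * S_pos by simp
    thus X: "t\<^sup>2 *\<^sub>R x \<in> X" using small_in_cube cube_sub by blast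
    have "norm (flow s (t\<^sup>2 *\<^sub>R x)) \<le> exp (L * s) * norm (t\<^sup>2 *\<^sub>R x)" using norm_flow_le[OF X s(1)] .
    also have "\<dots> \<le> E * norm (t\<^sup>2 *\<^sub>R x)"
    proof (rule mult_right_mono)
      have "L * s \<le> L * 1" using s t \<epsilon> L_nonneg by (intro mult_left_mono) auto
      thus "exp (L * s) \<le> E" by (simp add: E_def)
    qed auto
    finally show n: "norm (flow s (t\<^sup>2 *\<^sub>R x)) \<le> E * (t\<^sup>2 * norm x)" by simp
    show "E * (t\<^sup>2 * norm x) \<le> r" using * by simp
    show "flow s (t\<^sup>2 *\<^sub>R x) \<in> cube S" using n * S_pos by (intro small_in_cube) simp
  qed
  \<comment> \<open>The scale is \<open>t\<^sup>2\<close> rather than \<open>t\<close> so that the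
    terms of degree above \<open>m\<close> have relative size \<open>t\<^sup>2\<close> and do not
    affect the derivative at \<open>t = 0\<close>; at scale \<open>t\<close> they would enter at
    first order.\<close>
  define w where "w = (\<lambda>t. if t = 0 then x else (1 / t\<^sup>2) *\<^sub>R flow t (t\<^sup>2 *\<^sub>R x))"
  \<comment> \<open>The speed near the origin is of order \<open>t\<^sup>2\<close>, so the Euler
    error is still of order \<open>t\<^sup>2\<close> after the division by \<open>t\<^sup>2\<close>,
    and the rescaled field at the starting point tends to \<open>A *v x\<close>.\<close>
  have w1: "(w has_vector_derivative A *v x) (at 0 within {0..})"
  proof (rule has_vector_derivative_right_sandwich[OF \<epsilon>(1)])
    fix t assume t: "0 < t" "t < \<epsilon>"
    define y where "y = t\<^sup>2 *\<^sub>R x"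
    have y: "y \<in> X" using small(1)[OF t, of 0] t by (simp add: y_def)
    have "norm (flow t y - y - t *\<^sub>R F y) \<le> L * (L * (E * (t\<^sup>2 * norm x))) * t\<^sup>2"
    proof (rule flow_euler_step_le[OF y])
      fix s assume s: "0 \<le> s" "s \<le> t"
      have "norm (F (flow s y)) \<le> L * norm (flow s y)" by (rule norm_F_le[OF flow_in[OF y s(1)]])
      also have "\<dots> \<le> L * (E * (t\<^sup>2 * norm x))"
        using small(2)[OF t s] L_nonneg by (intro mult_left_mono) (auto simp: y_def)
      finally show "norm (F (flow s y)) \<le> L * (E * (t\<^sup>2 * norm x))" .
    qed (use t in auto)
    hence "(1 / t\<^sup>2) * norm (flow t y - y - t *\<^sub>R F y) \<le> (1 / t\<^sup>2) * (L * (L * (E * (t\<^sup>2 * norm x))) * t\<^sup>2)"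
      by (intro mult_left_mono) auto
    also have "\<dots> = t * (L * L * E * norm x * t)" using t by (simp add: power2_eq_square)
    also have "(1 / t\<^sup>2) * norm (flow t y - y - t *\<^sub>R F y) = norm ((1 / t\<^sup>2) *\<^sub>R (flow t y - y - t *\<^sub>R F y))"
      by simp
    also have "(1 / t\<^sup>2) *\<^sub>R (flow t y - y - t *\<^sub>R F y) = w t - w 0 - t *\<^sub>R ((1 / t\<^sup>2) *\<^sub>R F y)"
      using t by (simp add: w_def y_def scaleR_diff_right)
    finally have 1: "norm (w t - w 0 - t *\<^sub>R ((1 / t\<^sup>2) *\<^sub>R F y)) \<le> t * (L * L * E * norm x * t)" .
    have "w t - w 0 - t *\<^sub>R (A *v x) = (w t - w 0 - t *\<^sub>R ((1 / t\<^sup>2) *\<^sub>R F y)) + t *\<^sub>R ((1 / t\<^sup>2) *\<^sub>R F y - A *v x)"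
      by (simp add: scaleR_diff_right)
    also have "norm \<dots> \<le> t * (L * L * E * norm x * t) + t * norm ((1 / t\<^sup>2) *\<^sub>R F y - A *v x)"
      using 1 t by (intro order_trans[OF norm_triangle_ineq] add_mono) auto
    finally show "norm (w t - w 0 - t *\<^sub>R (A *v x)) \<le>
        t * (L * L * E * norm x * t + norm ((1 / t\<^sup>2) *\<^sub>R F (t\<^sup>2 *\<^sub>R x) - A *v x))"
      by (simp add: y_def distrib_left)
  next
    have "((\<lambda>s::real. s *\<^sub>R x) has_derivative (\<lambda>s. s *\<^sub>R x)) (at 0)"
      by (auto intro!: derivative_eq_intros)
    from diff_chain_at[OF this, of F "(*v) A"] F_has_derivative
    have "((\<lambda>s. F (s *\<^sub>R x)) has_vector_derivative A *v x) (at 0)"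
      by (simp add: o_def has_vector_derivative_def matrix_vector_mult_scaleR)
    hence t1: "((\<lambda>s. norm (F (s *\<^sub>R x) - s *\<^sub>R (A *v x)) / \<bar>s\<bar>) \<longlongrightarrow> 0) (at 0)"
      by (simp add: has_vector_derivative_def has_derivative_at F_0)
    have "((\<lambda>s. (1 / s) *\<^sub>R F (s *\<^sub>R x) - A *v x) \<longlongrightarrow> 0) (at 0)"
    proof (rule tendsto_norm_zero_cancel, rule Lim_transform_eventually[OF t1])
      have "norm (F (s *\<^sub>R x) - s *\<^sub>R (A *v x)) / \<bar>s\<bar> = norm ((1 / s) *\<^sub>R F (s *\<^sub>R x) - A *v x)" if "s \<noteq> 0" for s
      proof -
        have "(1 / s) *\<^sub>R F (s *\<^sub>R x) - A *v x = (1 / s) *\<^sub>R (F (s *\<^sub>R x) - s *\<^sub>R (A *v x))"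
          using that by (simp add: scaleR_diff_right)
        thus ?thesis by simp
      qed
      thus "\<forall>\<^sub>F s in at 0. norm (F (s *\<^sub>R x) - s *\<^sub>R (A *v x)) / \<bar>s\<bar> = norm ((1 / s) *\<^sub>R F (s *\<^sub>R x) - A *v x)"
        by (simp add: eventually_at_filter)
    qed
    hence "((\<lambda>s. (1 / s) *\<^sub>R F (s *\<^sub>R x)) \<longlongrightarrow> A *v x) (at 0)"
      by (simp add: LIM_zero_iff)
    hence "((\<lambda>t. (1 / t\<^sup>2) *\<^sub>R F (t\<^sup>2 *\<^sub>R x)) \<longlongrightarrow> A *v x) (at_right 0)"
    proof (rule filterlim_compose)
      show "filterlim (\<lambda>t::real. t\<^sup>2) (at 0) (at_right 0)"
        by (rule filterlim_atI) (auto intro!: tendsto_eq_intros exI[of _ "1::real"] simp: eventually_at_right_field)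
    qed
    from tendsto_norm[OF tendsto_diff[OF this tendsto_const[of "A *v x"]]]
    have "((\<lambda>t. norm ((1 / t\<^sup>2) *\<^sub>R F (t\<^sup>2 *\<^sub>R x) - A *v x)) \<longlongrightarrow> 0) (at_right 0)" by simp
    moreover have "((\<lambda>t. L * L * E * norm x * t) \<longlongrightarrow> 0) (at_right 0)"
      by (auto intro!: tendsto_eq_intros)
    ultimately show "((\<lambda>t. L * L * E * norm x * t + norm ((1 / t\<^sup>2) *\<^sub>R F (t\<^sup>2 *\<^sub>R x) - A *v x)) \<longlongrightarrow> 0) (at_right 0)"
      using tendsto_add by fastforce
  qed
  have "(P has_derivative hder a m x) (at (w 0))"
    using has_derivative_hpart by (simp add: P_def w_def)
  from vector_derivative_diff_chain_within[OF w1 has_derivative_at_withinI[OF this]]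
  have d1: "((P \<circ> w) has_vector_derivative hder a m x (A *v x)) (at 0 within {0..})" .
  have d2: "((P \<circ> w) has_vector_derivative \<mu> * P x) (at 0 within {0..})"
  proof (rule has_vector_derivative_right_sandwich[OF \<epsilon>(1)])
    fix t assume t: "0 < t" "t < \<epsilon>"
    define y where "y = t\<^sup>2 *\<^sub>R x"
    define z where "z = flow t y"
    define K where "K = C * (E * (t\<^sup>2 * norm x) / r) ^ Suc m"
    have t0: "0 \<le> t" using t by simp
    have y: "y \<in> X" using small(1)[OF t order_refl t0] by (simp add: y_def)
    have zr: "norm z \<le> E * (t\<^sup>2 * norm x)" using small(2)[OF t t0 order_refl] by (simp add: z_def y_def)
    have yr: "norm y \<le> E * (t\<^sup>2 * norm x)"
      using small(2)[OF t order_refl t0] y by (simp add: y_def)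
    have Er: "E * (t\<^sup>2 * norm x) \<le> r" using small(3)[OF t order_refl t0] .
    have KC: "norm (\<psi> u - P u) \<le> K" if "norm u \<le> E * (t\<^sup>2 * norm x)" for u
    proof -
      have "norm (\<psi> u - P u) \<le> C * (norm u / r) ^ Suc m" using that Er by (intro rem) auto
      also have "\<dots> \<le> K" unfolding K_def using that r
        by (intro mult_left_mono power_mono divide_right_mono) auto
      finally show ?thesis .
    qed
    have "\<psi> z = exp (\<mu> * of_real (t - 0)) * \<psi> (flow 0 y)"
      unfolding z_def
      by (rule eigenfunction_flow[OF eig y]) (use small(4)[OF t] t in \<open>auto simp: y_def\<close>)
    hence fl: "\<psi> z = exp (\<mu> * of_real t) * \<psi> y" using y by simp
    have "P z - exp (\<mu> * of_real t) * P y = - (\<psi> z - P z) + exp (\<mu> * of_real t) * (\<psi> y - P y)"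
      by (simp add: fl algebra_simps)
    also have "norm \<dots> \<le> K + exp (norm \<mu>) * K"
    proof (intro order_trans[OF norm_triangle_ineq] add_mono)
      show "norm (- (\<psi> z - P z)) \<le> K" using KC[OF zr] by (simp only: norm_minus_cancel)
      have "norm (exp (\<mu> * of_real t)) \<le> exp (norm (\<mu> * of_real t))" by (rule norm_exp)
      also have "norm (\<mu> * of_real t) \<le> norm \<mu>" using t \<epsilon> by (simp add: norm_mult mult_left_le)
      finally show "norm (exp (\<mu> * of_real t) * (\<psi> y - P y)) \<le> exp (norm \<mu>) * K"
        using KC[OF yr] by (simp only: norm_mult) (intro mult_mono, auto)
    qed
    also have "P z = of_real t ^ (2 * m) * P (w t)"
    proof -
      have "z = (t\<^sup>2) *\<^sub>R w t" using t by (simp add: w_def z_def y_def)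
      thus ?thesis by (simp add: P_def hpart_scaleR power_mult)
    qed
    also have "P y = of_real t ^ (2 * m) * P x"
      by (simp add: y_def P_def hpart_scaleR power_mult)
    also have "of_real t ^ (2 * m) * P (w t) - exp (\<mu> * of_real t) * (of_real t ^ (2 * m) * P x) =
        of_real (t ^ (2 * m)) * (P (w t) - exp (\<mu> * of_real t) * P x)"
      by (simp add: algebra_simps)
    also have "norm \<dots> = t ^ (2 * m) * norm (P (w t) - exp (\<mu> * of_real t) * P x)"
      using t by (simp only: norm_mult norm_of_real) simp
    \<comment> \<open>\<open>(t\<^sup>2) ^ Suc m\<close> splits into \<open>t ^ (2 * m)\<close>,
      which cancels against the homogeneity of \<open>P\<close>, and \<open>t * t\<close>, which is
      the error that remains.\<close>
    also have "K + exp (norm \<mu>) * K = t ^ (2 * m) * (t * (t * ((1 + exp (norm \<mu>)) * C * (E * norm x / r) ^ Suc m)))"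
      by (simp add: K_def power_mult_distrib power_divide algebra_simps power2_eq_square power_mult add_divide_distrib)
    finally have 1: "norm (P (w t) - exp (\<mu> * of_real t) * P x) \<le> t * (t * ((1 + exp (norm \<mu>)) * C * (E * norm x / r) ^ Suc m))"
      by (rule mult_left_le_imp_le) (use t in simp)
    have 2: "exp (\<mu> * of_real t) * P x - P x - t *\<^sub>R (\<mu> * P x) = of_real t * (((exp (\<mu> * of_real t) - 1) / of_real t - \<mu>) * P x)"
      using t by (simp add: field_simps scaleR_conv_of_real)
    have "(P \<circ> w) t - (P \<circ> w) 0 - t *\<^sub>R (\<mu> * P x) =
       (P (w t) - exp (\<mu> * of_real t) * P x) + (exp (\<mu> * of_real t) * P x - P x - t *\<^sub>R (\<mu> * P x))"
      by (simp add: w_def)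
    also have "norm \<dots> \<le> t * (t * ((1 + exp (norm \<mu>)) * C * (E * norm x / r) ^ Suc m)) +
        t * norm (((exp (\<mu> * of_real t) - 1) / of_real t - \<mu>) * P x)"
      unfolding 2 using t by (intro order_trans[OF norm_triangle_ineq] add_mono 1) (auto simp: norm_mult)
    finally show "norm ((P \<circ> w) t - (P \<circ> w) 0 - t *\<^sub>R (\<mu> * P x)) \<le>
        t * (t * ((1 + exp (norm \<mu>)) * C * (E * norm x / r) ^ Suc m) + norm (((exp (\<mu> * of_real t) - 1) / of_real t - \<mu>) * P x))"
      by (simp add: distrib_left)
  next
    have "((\<lambda>z. exp (\<mu> * z)) has_field_derivative \<mu>) (at 0)"
      by (auto intro!: derivative_eq_intros)
    hence "((\<lambda>h. (exp (\<mu> * h) - 1) / h) \<longlongrightarrow> \<mu>) (at 0)"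
      by (simp add: DERIV_def)
    hence "((\<lambda>t. (exp (\<mu> * of_real t) - 1) / of_real t) \<longlongrightarrow> \<mu>) (at_right 0)"
    proof (rule filterlim_compose)
      have "((\<lambda>t. complex_of_real t) \<longlongrightarrow> 0) (at_right 0)" by (auto intro!: tendsto_eq_intros)
      thus "filterlim (\<lambda>t::real. complex_of_real t) (at 0) (at_right 0)"
        by (rule filterlim_atI) (auto simp: eventually_at_right_field intro!: exI[of _ 1])
    qed
    hence "((\<lambda>t. norm (((exp (\<mu> * of_real t) - 1) / of_real t - \<mu>) * P x)) \<longlongrightarrow> norm ((\<mu> - \<mu>) * P x)) (at_right 0)"
      by (intro tendsto_intros)
    moreover have "((\<lambda>t. t * ((1 + exp (norm \<mu>)) * C * (E * norm x / r) ^ Suc m)) \<longlongrightarrow> 0) (at_right 0)"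
      by (intro tendsto_mult_left_zero tendsto_ident_at)
    ultimately show "((\<lambda>t. t * ((1 + exp (norm \<mu>)) * C * (E * norm x / r) ^ Suc m) +
        norm (((exp (\<mu> * of_real t) - 1) / of_real t - \<mu>) * P x)) \<longlongrightarrow> 0) (at_right 0)"
      using tendsto_add by fastforce
  qed
  have "at (0::real) within {0..} \<noteq> bot" by (simp add: at_within_Ici_at_right)
  from vector_derivative_unique_within[OF this d1 d2] show ?thesis by (simp add: P_def)
qed

end

section \<open>Attraction of the whole cube\<close>

lemma has_derivative_vec_lambda:
  fixes f :: "'n::finite \<Rightarrow> 'a::real_normed_vector \<Rightarrow> complex"
  assumes "\<And>i. (f i has_derivative f' i) Fi"
  shows "((\<lambda>x. \<chi> i. f i x) has_derivative (\<lambda>h. \<chi> i. f' i h)) Fi"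
proof -
  have eq: "(\<chi> i. g i) = (\<Sum>i\<in>UNIV. axis i (g i))" for g :: "'n \<Rightarrow> complex"
    by (simp add: vec_eq_iff axis_def)
  have bl: "bounded_linear (\<lambda>c. axis i c :: complex^'n)" for i
  proof -
    have "linear (\<lambda>c. axis i c :: complex^'n)"
      by (rule linearI) (auto simp: vec_eq_iff axis_def)
    thus ?thesis by (simp add: linear_conv_bounded_linear)
  qed
  show ?thesis unfolding eq
    by (intro has_derivative_sum bounded_linear.has_derivative[OF bl] assms)
qed

text \<open>At the first time when \<open>g\<close> reaches \<rho>, the hypothesis
  \<open>step\<close> applies to the whole past and gives \<open>g < \<rho>\<close>, a
  contradiction. This turns an estimate that presupposes a bound into the bound itself.\<close>

lemma barrier:
  fixes g :: "real \<Rightarrow> real"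
  assumes cont: "continuous_on {a..b} g" and a: "g a < \<rho>"
    and step: "\<And>T. a \<le> T \<Longrightarrow> T \<le> b \<Longrightarrow> (\<And>t. a \<le> t \<Longrightarrow> t \<le> T \<Longrightarrow> g t \<le> \<rho>) \<Longrightarrow> g T < \<rho>"
    and t: "a \<le> t" "t \<le> b"
  shows "g t < \<rho>"
proof (rule ccontr)
  assume "\<not> g t < \<rho>"
  define B where "B = {a..b} \<inter> g -` {\<rho>..}"
  have "B \<noteq> {}" using t \<open>\<not> g t < \<rho>\<close> by (auto simp: B_def)
  moreover have "compact B"
  proof -
    have "closed B" unfolding B_def by (rule continuous_on_closed_vimage[THEN iffD1, rule_format, OF _ cont, unfolded Int_commute[of _ "{a..b}"]]) auto
    thus ?thesis using bounded_subset[OF bounded_closed_interval[of a b]] by (auto simp: compact_eq_bounded_closed B_def)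
  qed
  ultimately obtain s where s: "s \<in> B" "\<And>t. t \<in> B \<Longrightarrow> s \<le> t"
    using compact_attains_inf by metis
  have "\<exists>u\<ge>a. u \<le> s \<and> g u = \<rho>"
    by (rule IVT') (use s(1) a cont in \<open>auto simp: B_def intro: continuous_on_subset\<close>)
  then obtain u where u: "a \<le> u" "u \<le> s" "g u = \<rho>" by blast
  have "u \<in> B" using u s(1) by (auto simp: B_def)
  with s(2) u have us: "u = s" by force
  have "g s < \<rho>"
  proof (rule step)
    fix t assume t: "a \<le> t" "t \<le> s"
    show "g t \<le> \<rho>"
    proof (rule ccontr)
      assume "\<not> g t \<le> \<rho>"
      hence "t \<in> B" using t s(1) by (auto simp: B_def)
      with s(2) t have "t = s" by force
      with us u \<open>\<not> g t \<le> \<rho>\<close> show False by simp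
    qed
  qed (use s(1) in \<open>auto simp: B_def\<close>)
  with us u show False by simp
qed

lemma interval_in_cube:
  fixes x :: "real^'n::finite"
  shows "connected {s. s *\<^sub>R x \<in> cube S}"
proof -
  have "is_interval {s. s *\<^sub>R x \<in> cube S}"
    unfolding is_interval_1
  proof (intro ballI allI impI)
    fix a b s assume ab: "a \<in> {s. s *\<^sub>R x \<in> cube S}" "b \<in> {s. s *\<^sub>R x \<in> cube S}" and s: "a \<le> s \<and> s \<le> b"
    have "\<bar>s * x $ i\<bar> < S" for i
    proof -
      have "\<bar>s\<bar> \<le> \<bar>a\<bar> \<or> \<bar>s\<bar> \<le> \<bar>b\<bar>" using s by auto
      hence "\<bar>s\<bar> * \<bar>x $ i\<bar> \<le> \<bar>a\<bar> * \<bar>x $ i\<bar> \<or> \<bar>s\<bar> * \<bar>x $ i\<bar> \<le> \<bar>b\<bar> * \<bar>x $ i\<bar>"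
        by (auto intro: mult_right_mono)
      moreover have "\<bar>a\<bar> * \<bar>x $ i\<bar> < S" "\<bar>b\<bar> * \<bar>x $ i\<bar> < S"
        using ab by (auto simp: cube_def abs_mult)
      ultimately show ?thesis by (auto simp: abs_mult)
    qed
    thus "s \<in> {s. s *\<^sub>R x \<in> cube S}" by (simp add: cube_def)
  qed
  thus ?thesis by (simp add: is_interval_connected_1)
qed

context koopman
begin

lemma open_line_in_cube: "open {s. s *\<^sub>R (x :: real^'n) \<in> cube S}"
proof -
  have "open ((\<lambda>s. s *\<^sub>R x) -` cube S)"
    by (intro open_vimage open_cube continuous_intros)
  thus ?thesis by (simp add: vimage_def)
qed

lemma \<phi>_eigen: "x \<in> cube S \<Longrightarrow> \<phi> i differentiable (at x) \<and> generator F (\<phi> i) x = lam i * \<phi> i x"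
  using principal by (auto simp: principal_eigenfunctions_def eigenfunction_def)

lemma \<phi>_has_derivative: "x \<in> cube S \<Longrightarrow> (\<phi> i has_derivative frechet_derivative (\<phi> i) (at x)) (at x)"
  using \<phi>_eigen frechet_derivative_works by blast

text \<open>The cube is star-shaped about the origin, so the identity theorem on the line through
  \<open>x\<close> is enough.\<close>

lemma analytic_zero_on_cube:
  fixes \<psi> :: "real^'n \<Rightarrow> complex"
  assumes an: "real_analytic_on \<psi> (cube S)" and r: "r > 0" "\<And>x. norm x < r \<Longrightarrow> \<psi> x = 0"
    and x: "x \<in> cube S"
  shows "\<psi> x = 0"
proof -
  define J where "J = {s. s *\<^sub>R x \<in> cube S}"
  have "\<psi> (1 *\<^sub>R x) = 0"
  proof (rule analytic_real_identity[of J "\<lambda>s. \<psi> (s *\<^sub>R x)" 0])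
    show "connected J" "open J" unfolding J_def by (rule interval_in_cube open_line_in_cube)+
    show "analytic_real (\<lambda>s. \<psi> (s *\<^sub>R x)) s" if "s \<in> J" for s
    proof -
      obtain a where "power_series_at \<psi> (s *\<^sub>R x) a"
        using an \<open>s \<in> J\<close> by (auto simp: J_def real_analytic_on_def)
      thus ?thesis by (rule analytic_real_compose[OF _ analytic_curve_line])
    qed
    show "0 \<in> J" "1 \<in> J" using x zero_in_cube by (auto simp: J_def)
    show "r / (norm x + 1) > 0" using r(1) by (simp add: add_nonneg_pos)
    fix s assume "\<bar>s - 0\<bar> < r / (norm x + 1)"
    hence "\<bar>s\<bar> * (norm x + 1) < r"
      using add_nonneg_pos[OF norm_ge_zero zero_less_one, of x] by (simp add: pos_less_divide_eq)
    moreover have "\<bar>s\<bar> * norm x \<le> \<bar>s\<bar> * (norm x + 1)" by (intro mult_left_mono) auto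
    ultimately show "\<psi> (s *\<^sub>R x) = 0" by (intro r(2)) simp
  qed
  thus ?thesis by simp
qed

text \<open>If some homogeneous part of \<psi> is nonzero, the lowest one has a degree
  \<open>m\<close> for which \<open>lam j\<close> is a sum of \<open>m\<close> eigenvalues. Degree 0
  would make \<open>lam j\<close> vanish, degree 1 is excluded by \<open>d0\<close>, and larger
  degrees are excluded by nonresonance.\<close>

lemma eigenfunction_first_order:
  fixes \<psi> :: "real^'n \<Rightarrow> complex"
  assumes an: "real_analytic_on \<psi> (cube S)"
    and eig: "\<And>x. x \<in> cube S \<Longrightarrow> \<psi> differentiable (at x) \<and> generator F \<psi> x = lam j * \<psi> x"
    and d0: "(\<psi> has_derivative (\<lambda>_. 0)) (at 0)"
    and x: "x \<in> cube S"
  shows "\<psi> x = 0"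
proof -
  obtain a where a: "power_series_at \<psi> 0 a"
    using an zero_in_cube by (auto simp: real_analytic_on_def)
  have "\<forall>m x. hpart a m x = 0"
  proof (rule ccontr)
    assume "\<not> ?thesis"
    hence ex: "\<exists>m x. hpart a m x \<noteq> 0" by blast
    define m where "m = (LEAST m. \<exists>x. hpart a m x \<noteq> 0)"
    obtain x0 where x0: "hpart a m x0 \<noteq> 0"
      using LeastI_ex[OF ex] by (auto simp: m_def)
    have low: "hpart a j x = 0" if "j < m" for j x
      using not_less_Least[of j "\<lambda>m. \<exists>x. hpart a m x \<noteq> 0"] that by (auto simp: m_def)
    have "hder a m x (A *v x) = lam j * hpart a m x" for x
      by (rule leading_part_eigen[OF a eig low])
    from polynomial_eigenvalue[OF eigenvalues x0 this]
    obtain k where k: "deg k = m" "lam j = (\<Sum>j\<in>UNIV. of_nat (k j) * lam j)" by blast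
    consider "m = 0" | "m = 1" | "m \<ge> 2" by linarith
    thus False
    proof cases
      case 1
      hence "lam j = 0" using k by (simp add: deg_def)
      thus False using stable[of j] by simp
    next
      case 2
      have "hder a 1 0 = (\<lambda>_. 0)"
        using has_derivative_unique[OF power_series_at_has_derivative_0[OF a] d0] .
      thus False using x0 hpart_1_eq_hder[of a 0 x0] 2 by simp
    next
      case 3
      thus False using nonres k by (auto simp: nonresonant_def deg_def)
    qed
  qed
  then obtain r where "r > 0" "\<And>x. norm x < r \<Longrightarrow> \<psi> x = 0"
    using hpart_zero_imp_zero[OF a] by blast
  from analytic_zero_on_cube[OF an this x] show ?thesis .
qed

section \<open>Differentials of the principal eigenfunctions at the origin\<close>

lemma \<phi>_0: "\<phi> i 0 = 0"
proof -
  \<comment> \<open>As \<open>F 0 = 0\<close>, the generator at the origin differentiates in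
    direction 0.\<close>
  have "lam i * \<phi> i 0 = frechet_derivative (\<phi> i) (at 0) 0"
    using \<phi>_eigen[OF zero_in_cube, of i] by (simp add: generator_def F_0)
  also have "\<dots> = 0"
    using has_derivative_linear[OF \<phi>_has_derivative[OF zero_in_cube]] by (rule linear_0)
  finally show ?thesis using stable[of i] by auto
qed

definition D :: "'n \<Rightarrow> real^'n \<Rightarrow> complex" where
  "D i = frechet_derivative (\<phi> i) (at 0)"

lemma D_has_derivative: "(\<phi> i has_derivative D i) (at 0)"
  using \<phi>_has_derivative[OF zero_in_cube] by (simp add: D_def)

lemma D_linear: "linear (D i)"
  using has_derivative_linear[OF D_has_derivative] .

text \<open>The case \<open>m = 1\<close> of the leading-part relation, applicable because
  \<open>\<phi> i\<close> vanishes at the origin. It makes \<open>D i\<close> a left eigenvector of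
  \<open>A\<close>.\<close>

lemma D_eigen: "D i (A *v h) = lam i * D i h"
proof -
  obtain a where a: "power_series_at (\<phi> i) 0 a"
    using \<phi>_analytic zero_in_cube by (auto simp: real_analytic_on_def)
  have "D i = hder a 1 0"
    using has_derivative_unique[OF D_has_derivative power_series_at_has_derivative_0[OF a]] .
  moreover have "hder a 1 h (A *v h) = lam i * hpart a 1 h"
    by (rule leading_part_eigen[OF a \<phi>_eigen]) (auto simp: power_series_at_0[OF a] \<phi>_0)
  ultimately show ?thesis by (simp only: hpart_1_eq_hder)
qed

text \<open>A relation of minimal support involves a single eigenvalue, since applying it to \<open>A h\<close>
  and subtracting a multiple shortens it. It then expresses that an eigenfunction has vanishing
  first-order part.\<close>

lemma D_independent: "(\<And>h. (\<Sum>i\<in>UNIV. c i * D i h) = 0) \<Longrightarrow> c i = 0"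
proof (induction "card {i. c i \<noteq> 0}" arbitrary: c i rule: less_induct)
  case less
  show ?case
  proof (rule ccontr)
    assume "c i \<noteq> 0"
    define c' where "c' = (\<lambda>k. c k * (lam k - lam i))"
    have "(\<Sum>k\<in>UNIV. c' k * D k h) = 0" for h
    proof -
      have "(\<Sum>k\<in>UNIV. c' k * D k h) = (\<Sum>k\<in>UNIV. c k * D k (A *v h)) - lam i * (\<Sum>k\<in>UNIV. c k * D k h)"
        by (simp add: c'_def D_eigen sum_distrib_left sum_subtractf algebra_simps)
      thus ?thesis using less.prems by simp
    qed
    moreover have "card {k. c' k \<noteq> 0} < card {k. c k \<noteq> 0}"
      using \<open>c i \<noteq> 0\<close> by (intro psubset_card_mono) (auto simp: c'_def)
    ultimately have "c' k = 0" for k using less.hyps by blast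
    \<comment> \<open>Every index in the support of \<open>c\<close> carries the eigenvalue
      \<open>lam i\<close>, so \<psi> satisfies the eigenfunction equation even when that eigenvalue
      is repeated.\<close>
    hence eqlam: "c k * lam k = c k * lam i" for k by (simp add: c'_def)
    define \<psi> where "\<psi> = (\<lambda>x. \<Sum>k\<in>UNIV. c k * \<phi> k x)"
    have \<psi>d: "(\<psi> has_derivative (\<lambda>h. \<Sum>k\<in>UNIV. c k * frechet_derivative (\<phi> k) (at x) h)) (at x)"
      if "x \<in> cube S" for x
      unfolding \<psi>_def by (intro has_derivative_sum has_derivative_mult_right \<phi>_has_derivative that)
    have "\<psi> x = 0" if x: "x \<in> cube S" for x
    proof (rule eigenfunction_first_order[OF _ _ _ x])
      show "real_analytic_on \<psi> (cube S)"
        unfolding \<psi>_def by (rule real_analytic_on_combination) (use \<phi>_analytic in auto)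
      show "(\<psi> has_derivative (\<lambda>_. 0)) (at 0)"
        using \<psi>d[OF zero_in_cube] less.prems by (simp add: D_def)
      fix y :: "real^'n" assume y: "y \<in> cube S"
      have "generator F \<psi> y = (\<Sum>k\<in>UNIV. c k * generator F (\<phi> k) y)"
        using frechet_derivative_at[OF \<psi>d[OF y]] by (simp add: generator_def fun_eq_iff)
      also have "\<dots> = (\<Sum>k\<in>UNIV. (c k * lam k) * \<phi> k y)" using \<phi>_eigen[OF y] by (simp add: mult.assoc)
      also have "\<dots> = lam i * \<psi> y" by (simp add: eqlam \<psi>_def sum_distrib_left mult_ac)
      finally show "\<psi> differentiable (at y) \<and> generator F \<psi> y = lam i * \<psi> y"
        using \<psi>d[OF y] by (auto simp: differentiable_def)
    qed
    hence "c i = 0" using principal unfolding principal_eigenfunctions_def \<psi>_def by blast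
    thus False using \<open>c i \<noteq> 0\<close> by simp
  qed
qed

text \<open>Its norm is the square root of the function \<open>V\<close> of the theorem.\<close>

definition \<Phi> :: "real^'n \<Rightarrow> complex^'n" where
  "\<Phi> x = (\<chi> i. \<phi> i x)"

text \<open>Complex independence of the differentials makes the rows of the square matrix
  \<open>M\<close> independent, so \<open>M\<close> has a left inverse; real directions are
  separated as special complex vectors.\<close>

lemma D_injective: "inj (\<lambda>h. (\<chi> i. D i h) :: complex^'n)"
proof -
  define M :: "complex^'n^'n" where "M = (\<chi> i j. D i (axis j 1))"
  have D_sum: "D i h = (\<Sum>j\<in>UNIV. of_real (h $ j) * D i (axis j 1))" for i h
  proof -
    have "D i h = D i (\<Sum>j\<in>UNIV. h $ j *\<^sub>R axis j 1)"
      using basis_expansion[of h] by (simp add: scalar_mult_eq_scaleR)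
    also have "\<dots> = (\<Sum>j\<in>UNIV. h $ j *\<^sub>R D i (axis j 1))"
      by (simp add: linear_sum[OF D_linear] linear_scale[OF D_linear])
    finally show ?thesis by (simp add: scaleR_conv_of_real)
  qed
  have "\<exists>B. M ** B = mat 1"
    unfolding matrix_right_invertible_independent_rows
  proof (intro allI impI)
    fix c i assume c: "(\<Sum>i\<in>UNIV. c i *s row i M) = 0"
    have "(\<Sum>k\<in>UNIV. c k * D k h) = 0" for h
    proof -
      have "(\<Sum>k\<in>UNIV. c k * D k h) = (\<Sum>j\<in>UNIV. of_real (h $ j) * (\<Sum>k\<in>UNIV. c k *s row k M) $ j)"
        unfolding D_sum[of _ h] sum_distrib_left sum_component
        by (subst sum.swap) (simp add: M_def row_def mult_ac)
      thus ?thesis by (simp add: c)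
    qed
    thus "c i = 0" by (rule D_independent)
  qed
  then obtain B where B: "B ** M = mat 1" using matrix_left_right_inverse by blast
  show ?thesis
  proof (rule injI)
    fix h k assume "(\<chi> i. D i h) = ((\<chi> i. D i k) :: complex^'n)"
    hence "M *v cvec h = M *v cvec k"
      by (simp add: vec_eq_iff matrix_vector_mult_def M_def D_sum[of _ h] D_sum[of _ k] mult.commute)
    hence "B *v (M *v cvec h) = B *v (M *v cvec k)" by simp
    hence "cvec h = cvec k" by (simp add: matrix_vector_mul_assoc B)
    thus "h = k" by (simp add: vec_eq_iff)
  qed
qed

text \<open>Near the origin \<Phi> differs from its injective differential by at most half of the
  lower bound \<open>B\<close>, which leaves \<open>B / 2\<close> below and adds
  \<open>B / 2\<close> above.\<close>

lemma \<Phi>_bounds: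
  obtains \<alpha> C \<rho> where "\<alpha> > 0" "C > 0" "\<rho> > 0" "\<rho> < S"
    "\<And>x. norm x \<le> \<rho> \<Longrightarrow> \<alpha> * norm x \<le> norm (\<Phi> x)" "\<And>x. norm x \<le> \<rho> \<Longrightarrow> norm (\<Phi> x) \<le> C * norm x"
proof -
  define DD where "DD = (\<lambda>h. (\<chi> i. D i h) :: complex^'n)"
  have d: "(\<Phi> has_derivative DD) (at 0)"
    unfolding \<Phi>_def[abs_def] DD_def by (intro has_derivative_vec_lambda D_has_derivative)
  have lin: "linear DD" using has_derivative_linear[OF d] .
  obtain B where B: "B > 0" "\<And>x. B * norm x \<le> norm (DD x)"
    using linear_inj_bounded_below_pos[OF lin] D_injective unfolding DD_def by blast
  obtain C where C: "C > 0" "\<And>x. norm (DD x) \<le> C * norm x"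
    using bounded_linear.pos_bounded[OF has_derivative_bounded_linear[OF d]] by (auto simp: mult.commute)
  have \<Phi>0: "\<Phi> 0 = 0" by (simp add: \<Phi>_def \<phi>_0 vec_eq_iff)
  obtain \<delta> where \<delta>: "\<delta> > 0" "\<And>x. norm x < \<delta> \<Longrightarrow> norm (\<Phi> x - DD x) \<le> (B / 2) * norm x"
    using d B(1) \<Phi>0 unfolding has_derivative_within_alt by (metis UNIV_I diff_zero half_gt_zero)
  define \<rho> where "\<rho> = min (\<delta> / 2) (S / 2)"
  show ?thesis
  proof (rule that[of "B / 2" "C + B / 2" \<rho>])
    fix x :: "real^'n" assume "norm x \<le> \<rho>"
    hence 1: "norm (\<Phi> x - DD x) \<le> (B / 2) * norm x" using \<delta> by (simp add: \<rho>_def)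
    show "B / 2 * norm x \<le> norm (\<Phi> x)"
      using 1 B(2)[of x] norm_triangle_ineq2[of "DD x" "DD x - \<Phi> x"] by (simp add: norm_minus_commute)
    show "norm (\<Phi> x) \<le> (C + B / 2) * norm x"
      using 1 C(2)[of x] norm_triangle_ineq[of "DD x" "\<Phi> x - DD x"] by (simp add: distrib_right)
  qed (use B C \<delta> S_pos in \<open>auto simp: \<rho>_def\<close>)
qed

section \<open>Decay of the eigenfunctions along trajectories and local stability\<close>

definition lm :: real where "lm = Max (range (\<lambda>i. Re (lam i)))"

lemma lm: "Re (lam i) \<le> lm" "lm < 0"
  using stable by (auto simp: lm_def)

text \<open>The relation mentions the two endpoints only: in between, the trajectory may be outside
  the cube.\<close>

definition transported :: "real \<Rightarrow> real^'n \<Rightarrow> bool" where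
  "transported T y \<longleftrightarrow> (\<forall>i. \<phi> i (flow T y) = exp (lam i * of_real T) * \<phi> i y)"

lemma transported_norm_le:
  assumes "transported T y" "T \<ge> 0"
  shows "norm (\<Phi> (flow T y)) \<le> exp (lm * T) * norm (\<Phi> y)"
proof -
  have "norm (\<Phi> (flow T y)) \<le> L2_set (\<lambda>i. exp (lm * T) * norm (\<phi> i y)) UNIV"
    unfolding norm_vec_def
  proof (rule L2_set_mono)
    fix i
    have "norm (exp (lam i * of_real T)) \<le> exp (lm * T)"
      using lm(1)[of i] assms(2) by (simp add: norm_exp_eq_Re mult_right_mono)
    thus "norm (\<Phi> (flow T y) $ i) \<le> exp (lm * T) * norm (\<phi> i y)"
      using assms(1) by (simp add: \<Phi>_def transported_def norm_mult mult_right_mono)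
  qed auto
  also have "\<dots> = exp (lm * T) * norm (\<Phi> y)"
    by (simp add: norm_vec_def \<Phi>_def L2_set_right_distrib)
  finally show ?thesis .
qed

lemma eigenfunctions_flow:
  assumes "y \<in> X" "0 \<le> a" "a \<le> b" "\<And>t. a \<le> t \<Longrightarrow> t \<le> b \<Longrightarrow> flow t y \<in> cube S"
  shows "\<phi> i (flow b y) = exp (lam i * of_real (b - a)) * \<phi> i (flow a y)"
  by (rule eigenfunction_flow[OF \<phi>_eigen]) (use assms in auto)

lemma transported_forward:
  assumes "y \<in> X" "transported T1 y" "0 \<le> T1" "T1 \<le> T" "\<And>t. T1 \<le> t \<Longrightarrow> t \<le> T \<Longrightarrow> flow t y \<in> cube S"
  shows "transported T y"
  unfolding transported_def
proof
  fix i
  have "\<phi> i (flow T y) = exp (lam i * of_real (T - T1)) * \<phi> i (flow T1 y)"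
    by (rule eigenfunctions_flow) (use assms in auto)
  also have "\<phi> i (flow T1 y) = exp (lam i * of_real T1) * \<phi> i y"
    using assms(2) by (simp add: transported_def)
  finally show "\<phi> i (flow T y) = exp (lam i * of_real T) * \<phi> i y"
    by (simp add: mult.assoc[symmetric] algebra_simps flip: exp_add)
qed

text \<open>The exponential factor is nonzero and can be cancelled, so the relation also travels
  backward along a piece inside the cube.\<close>

lemma transported_backward:
  assumes "y \<in> X" "transported T1 y" "0 \<le> T" "T \<le> T1" "\<And>t. T \<le> t \<Longrightarrow> t \<le> T1 \<Longrightarrow> flow t y \<in> cube S"
  shows "transported T y"
  unfolding transported_def
proof
  fix i
  have "exp (lam i * of_real (T1 - T)) * \<phi> i (flow T y) = \<phi> i (flow T1 y)"
    by (rule eigenfunctions_flow[symmetric]) (use assms in auto)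
  also have "\<phi> i (flow T1 y) = exp (lam i * of_real T1) * \<phi> i y"
    using assms(2) by (simp add: transported_def)
  also have "exp (lam i * of_real T1) = exp (lam i * of_real (T1 - T)) * exp (lam i * of_real T)"
    by (simp add: algebra_simps flip: exp_add)
  finally show "\<phi> i (flow T y) = exp (lam i * of_real T) * \<phi> i y" by simp
qed

lemma transported_0: "y \<in> X \<Longrightarrow> transported 0 y"
  by (simp add: transported_def)

text \<open>While a trajectory stays within \<rho>, the norm of \<Phi> decays along it;
  comparability of that norm with the distance gives a strict bound below \<rho>, and
  \<open>barrier\<close> removes the presupposition.\<close>

lemma local_stability:
  obtains \<alpha> \<rho> \<rho>' where "\<alpha> > 0" "0 < \<rho>'" "\<rho>' \<le> \<rho>" "\<rho> < S"
    "\<And>x. norm x \<le> \<rho> \<Longrightarrow> \<alpha> * norm x \<le> norm (\<Phi> x)"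
    "\<And>y t. norm y < \<rho>' \<Longrightarrow> t \<ge> 0 \<Longrightarrow> norm (flow t y) < \<rho>"
    "\<And>y. norm y < \<rho>' \<Longrightarrow> ((\<lambda>t. flow t y) \<longlongrightarrow> 0) at_top"
proof -
  obtain \<alpha> C \<rho> where *: "\<alpha> > 0" "C > 0" "\<rho> > 0" "\<rho> < S"
    "\<And>x. norm x \<le> \<rho> \<Longrightarrow> \<alpha> * norm x \<le> norm (\<Phi> x)" "\<And>x. norm x \<le> \<rho> \<Longrightarrow> norm (\<Phi> x) \<le> C * norm x"
    using \<Phi>_bounds by blast
  \<comment> \<open>The second term ensures \<open>C * \<rho>' \<le> \<alpha> * \<rho>\<close>:
    initially \<Phi> is too small for the distance \<rho> to be reached.\<close>
  define \<rho>' where "\<rho>' = min \<rho> (\<alpha> * \<rho> / C)"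
  have \<rho>': "\<rho>' > 0" "\<rho>' \<le> \<rho>" "C * \<rho>' \<le> \<alpha> * \<rho>"
    using * by (auto simp: \<rho>'_def min_def field_simps)
  have X: "y \<in> X" if "norm y < \<rho>'" for y
    using that small_in_cube[of y] cube_sub \<rho>' * by auto
  have bound: "\<alpha> * norm (flow T y) \<le> exp (lm * T) * norm (\<Phi> y)"
    if y: "norm y < \<rho>'" and T: "T \<ge> 0" and le: "\<And>t. 0 \<le> t \<Longrightarrow> t \<le> T \<Longrightarrow> norm (flow t y) \<le> \<rho>" for y T
  proof -
    have "transported T y"
      by (rule transported_forward[OF X[OF y] transported_0[OF X[OF y]]])
         (use T *(4) in \<open>auto intro!: small_in_cube le_less_trans[OF le]\<close>)
    from transported_norm_le[OF this T] *(5)[OF le[OF T order_refl]] show ?thesis by linarith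
  qed
  have stay: "norm (flow t y) < \<rho>" if y: "norm y < \<rho>'" and t: "t \<ge> 0" for y t
  proof (rule barrier[of 0 t "\<lambda>t. norm (flow t y)"])
    show "continuous_on {0..t} (\<lambda>t. norm (flow t y))"
      by (intro continuous_on_norm continuous_on_subset[OF flow_continuous_on[OF X[OF y]]]) auto
    show "norm (flow 0 y) < \<rho>" using X[OF y] y \<rho>' by simp
    fix T assume T: "0 \<le> T" "T \<le> t" and le: "\<And>s. 0 \<le> s \<Longrightarrow> s \<le> T \<Longrightarrow> norm (flow s y) \<le> \<rho>"
    have "\<alpha> * norm (flow T y) \<le> exp (lm * T) * norm (\<Phi> y)" by (rule bound[OF y T(1) le])
    also have "\<dots> \<le> 1 * norm (\<Phi> y)"
      using lm(2) T(1) by (intro mult_right_mono) (auto simp: mult_nonpos_nonneg)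
    also have "\<dots> \<le> C * norm y" using *(6)[of y] y \<rho>' by simp
    also have "\<dots> < C * \<rho>'" using y * by simp
    also have "\<dots> \<le> \<alpha> * \<rho>" by (rule \<rho>')
    finally show "norm (flow T y) < \<rho>" using *(1) by simp
  qed (use t in auto)
  have conv: "((\<lambda>t. flow t y) \<longlongrightarrow> 0) at_top" if y: "norm y < \<rho>'" for y
  proof (rule Lim_null_comparison)
    have n: "norm (flow t y) \<le> exp (lm * t) * (norm (\<Phi> y) / \<alpha>)" if t: "t \<ge> 0" for t
      using bound[OF y t less_imp_le[OF stay[OF y]]] *(1) by (simp add: field_simps)
    show "\<forall>\<^sub>F t in at_top. norm (flow t y) \<le> exp (lm * t) * (norm (\<Phi> y) / \<alpha>)"
      by (rule eventually_mono[OF eventually_ge_at_top[of 0] n])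
    have "filterlim (\<lambda>t. lm * t) at_bot at_top"
      using lm(2) by (intro filterlim_tendsto_neg_mult_at_bot[OF tendsto_const]) (auto simp: filterlim_ident)
    from filterlim_compose[OF exp_at_bot this]
    show "((\<lambda>t. exp (lm * t) * (norm (\<Phi> y) / \<alpha>)) \<longlongrightarrow> 0) at_top"
      by (intro tendsto_mult_left_zero)
  qed
  show ?thesis using that[OF *(1) \<rho>'(1,2) *(4,5) stay conv] by blast
qed

lemma attracted_if_reaches:
  assumes x: "x \<in> X" and T: "T \<ge> 0" and lim: "((\<lambda>t. flow t (flow T x)) \<longlongrightarrow> 0) at_top"
  shows "x \<in> region_of_attraction X flow"
proof -
  have "filterlim (\<lambda>t::real. - T + t) at_top at_top"
    by (rule filterlim_tendsto_add_at_top[OF tendsto_const filterlim_ident])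
  from filterlim_compose[OF lim this]
  have "((\<lambda>t. flow (- T + t) (flow T x)) \<longlongrightarrow> 0) at_top" .
  moreover have "\<forall>\<^sub>F t in at_top. flow (- T + t) (flow T x) = flow t x"
    using eventually_ge_at_top[of T]
  proof eventually_elim
    case (elim t)
    thus ?case using flow_add[OF x T, of "- T + t"] by simp
  qed
  ultimately have "((\<lambda>t. flow t x) \<longlongrightarrow> 0) at_top" by (rule Lim_transform_eventually)
  thus ?thesis using x by (simp add: region_of_attraction_def)
qed

section \<open>Continuation of attraction along segments from the origin\<close>

lemma cube_attracted:
  assumes x: "x \<in> cube S"
  shows "x \<in> region_of_attraction X flow"
proof -
  obtain \<alpha> \<rho> \<rho>' where \<alpha>: "\<alpha> > 0" and \<rho>: "0 < \<rho>'" "\<rho>' \<le> \<rho>" "\<rho> < S"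
    and lower: "\<And>x. norm x \<le> \<rho> \<Longrightarrow> \<alpha> * norm x \<le> norm (\<Phi> x)"
    and stay: "\<And>y t. norm y < \<rho>' \<Longrightarrow> t \<ge> 0 \<Longrightarrow> norm (flow t y) < \<rho>"
    and conv: "\<And>y. norm y < \<rho>' \<Longrightarrow> ((\<lambda>t. flow t y) \<longlongrightarrow> 0) at_top"
  proof (rule local_stability, goal_cases)
    case 1
    show ?case by (rule 1(1)) (fact 1)+
  qed
  have \<rho>_cube: "y \<in> cube S" if "norm y \<le> \<rho>" for y
    by (rule small_in_cube) (use that \<rho> in linarith)
  \<comment> \<open>An entry time \<open>T1\<close> that is known to exist may be arbitrarily large;
    it is replaced by a time \<open>T\<close> chosen from the bound \<open>M\<close> alone.\<close>
  have uniform: "transported T y \<and> norm (flow T y) \<le> \<rho>' / 2"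
    if y: "y \<in> cube S" and M: "norm (\<Phi> y) \<le> M" and T: "T \<ge> 0" "exp (lm * T) * M \<le> \<alpha> * (\<rho>' / 2)"
      and T1: "T1 \<ge> 0" "transported T1 y" "norm (flow T1 y) < \<rho>'" for y M T T1
  proof -
    have yX: "y \<in> X" using y cube_sub by blast
    have M0: "M \<ge> 0" using order_trans[OF norm_ge_zero M] .
    have est: "norm (flow t y) \<le> \<rho>' / 2" if t: "T \<le> t" "transported t y" "norm (flow t y) \<le> \<rho>" for t
    proof -
      have "\<alpha> * norm (flow t y) \<le> norm (\<Phi> (flow t y))" by (rule lower[OF t(3)])
      also have "\<dots> \<le> exp (lm * t) * norm (\<Phi> y)" using t T by (intro transported_norm_le) auto
      also have "\<dots> \<le> exp (lm * T) * M"
        using t(1) lm(2) M M0 by (intro mult_mono) (auto simp: mult_left_mono_neg)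
      also have "\<dots> \<le> \<alpha> * (\<rho>' / 2)" by (rule T(2))
      finally show ?thesis using \<alpha> by simp
    qed
    show ?thesis
    proof (cases "T1 \<le> T")
      case True
      have fl: "norm (flow t y) < \<rho>" if "T1 \<le> t" for t
        using stay[OF T1(3), of "t - T1"] flow_add[OF yX T1(1), of "t - T1"] that by simp
      have "transported T y"
        by (rule transported_forward[OF yX T1(2,1) True]) (use fl \<rho>_cube in \<open>auto intro: less_imp_le\<close>)
      with est[of T] fl[OF True] show ?thesis by simp
    next
      \<comment> \<open>Late entry: go back from \<open>T1\<close> to \<open>T\<close>. As long as
        the reversed trajectory is within \<rho>', the relation survives and \<open>est\<close>
        gives \<open>\<rho>' / 2\<close>, so the barrier \<rho>' is never reached.\<close>
      case False
      have bwd: "transported (T1 - u) y"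
        if u: "0 \<le> u" "u \<le> T1 - T" and le: "\<And>v. 0 \<le> v \<Longrightarrow> v \<le> u \<Longrightarrow> norm (flow (T1 - v) y) \<le> \<rho>'" for u
      proof (rule transported_backward[OF yX T1(2)])
        fix t assume "T1 - u \<le> t" "t \<le> T1"
        hence "norm (flow t y) \<le> \<rho>'" using le[of "T1 - t"] by simp
        thus "flow t y \<in> cube S" by (intro \<rho>_cube order_trans[OF _ \<rho>(2)])
      qed (use u T in auto)
      have inside: "norm (flow (T1 - u) y) < \<rho>'" if u: "0 \<le> u" "u \<le> T1 - T" for u
      proof (rule barrier[of 0 "T1 - T" "\<lambda>u. norm (flow (T1 - u) y)"])
        show "continuous_on {0..T1 - T} (\<lambda>u. norm (flow (T1 - u) y))"
          by (intro continuous_on_norm continuous_on_compose2[OF flow_continuous_on[OF yX]] continuous_intros)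
             (use T in auto)
        show "norm (flow (T1 - 0) y) < \<rho>'" using T1 by simp
        fix u assume u: "0 \<le> u" "u \<le> T1 - T" and le: "\<And>v. 0 \<le> v \<Longrightarrow> v \<le> u \<Longrightarrow> norm (flow (T1 - v) y) \<le> \<rho>'"
        have "norm (flow (T1 - u) y) \<le> \<rho>' / 2"
          using est[of "T1 - u"] bwd[OF u le] le[OF u(1) order_refl] u \<rho> by simp
        thus "norm (flow (T1 - u) y) < \<rho>'" using \<rho> by simp
      qed (use u in auto)
      have "transported T y"
        using bwd[of "T1 - T"] inside False by (auto intro: less_imp_le)
      moreover have "norm (flow T y) < \<rho>'" using inside[of "T1 - T"] False by simp
      ultimately show ?thesis using est[of T] \<rho> by simp
    qed
  qed
  define J where "J = {s. s *\<^sub>R x \<in> cube S}"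
  have J: "connected J" "open J" unfolding J_def by (rule interval_in_cube open_line_in_cube)+
  have JX: "s \<in> J \<Longrightarrow> s *\<^sub>R x \<in> X" for s using cube_sub by (auto simp: J_def)
  define good where "good = (\<lambda>s T. s \<in> J \<and> T \<ge> 0 \<and> transported T (s *\<^sub>R x) \<and> norm (flow T (s *\<^sub>R x)) < \<rho>')"
  \<comment> \<open>A single \<open>T\<close> serves a whole neighbourhood: this makes
    \<open>G\<close> open and hands the continuation step an interval on which the relation is
    known.\<close>
  define G where "G = {s. \<exists>\<delta>>0. \<exists>T. \<forall>\<sigma>. \<bar>\<sigma> - s\<bar> < \<delta> \<longrightarrow> good \<sigma> T}"
  have G_open: "open G"
    unfolding open_dist
  proof
    fix s assume "s \<in> G"
    then obtain \<delta> T where \<delta>: "\<delta> > 0" "\<And>\<sigma>. \<bar>\<sigma> - s\<bar> < \<delta> \<Longrightarrow> good \<sigma> T" by (auto simp: G_def)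
    have "u \<in> G" if "dist u s < \<delta>" for u
    proof -
      have "good \<sigma> T" if "\<bar>\<sigma> - u\<bar> < \<delta> - dist u s" for \<sigma>
        using that by (intro \<delta>(2)) (auto simp: dist_real_def)
      with \<open>dist u s < \<delta>\<close> show ?thesis unfolding G_def
        by (intro CollectI exI[of _ "\<delta> - dist u s"] exI[of _ T]) auto
    qed
    thus "\<exists>\<delta>>0. \<forall>u. dist u s < \<delta> \<longrightarrow> u \<in> G" using \<delta>(1) by blast
  qed
  have G_good: "\<exists>T. good s T" if "s \<in> G" for s
    using that by (force simp: G_def)
  have nx: "norm x + 1 > 0" using norm_ge_zero[of x] by linarith
  have "0 \<in> G"
  proof -
    have "good \<sigma> 0" if "\<bar>\<sigma> - 0\<bar> < \<rho>' / (norm x + 1)" for \<sigma>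
    proof -
      have "\<bar>\<sigma>\<bar> * (norm x + 1) < \<rho>'" using that nx by (simp add: pos_less_divide_eq)
      moreover have "\<bar>\<sigma>\<bar> * norm x \<le> \<bar>\<sigma>\<bar> * (norm x + 1)" by (intro mult_left_mono) auto
      ultimately have n: "norm (\<sigma> *\<^sub>R x) < \<rho>'" by simp
      hence "\<sigma> \<in> J" using \<rho>_cube[of "\<sigma> *\<^sub>R x"] \<rho> by (simp add: J_def)
      thus ?thesis using n JX transported_0 by (simp add: good_def)
    qed
    thus ?thesis unfolding G_def using \<rho> nx
      by (intro CollectI exI[of _ "\<rho>' / (norm x + 1)"] exI[of _ 0]) auto
  qed
  have G_closed: "s \<in> G" if s: "s \<in> J" and lim: "\<And>\<epsilon>. \<epsilon> > 0 \<Longrightarrow> \<exists>\<sigma>\<in>G. \<bar>\<sigma> - s\<bar> < \<epsilon>" for s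
  proof -
    \<comment> \<open>The \<open>+ 1\<close> leaves room for the same bound on a neighbourhood of
      \<open>s\<close>, by continuity.\<close>
    define M where "M = norm (\<Phi> (s *\<^sub>R x)) + 1"
    have M: "M > 0" by (simp add: M_def add_nonneg_pos)
    have "continuous_on J (\<lambda>s. norm (\<Phi> (s *\<^sub>R x)))"
    proof -
      have "continuous_on (cube S) (\<phi> i)" for i
        by (intro continuous_at_imp_continuous_on ballI has_derivative_continuous[OF \<phi>_has_derivative])
      hence c: "continuous_on (cube S) \<Phi>" unfolding \<Phi>_def[abs_def] by (rule continuous_on_vec_lambda)
      have "continuous_on J (\<lambda>s. s *\<^sub>R x)" by (intro continuous_intros)
      from continuous_on_compose2[OF c this] show ?thesis
        by (intro continuous_on_norm) (auto simp: J_def)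
    qed
    hence "open (J \<inter> (\<lambda>s. norm (\<Phi> (s *\<^sub>R x))) -` {..<M})"
      by (intro continuous_open_preimage J) auto
    moreover have "s \<in> J \<inter> (\<lambda>s. norm (\<Phi> (s *\<^sub>R x))) -` {..<M}" using s by (simp add: M_def)
    ultimately obtain \<delta>1 where \<delta>1: "\<delta>1 > 0"
      and sub: "ball s \<delta>1 \<subseteq> J \<inter> (\<lambda>s. norm (\<Phi> (s *\<^sub>R x))) -` {..<M}"
      by (rule openE)
    have near: "\<sigma> \<in> J" "norm (\<Phi> (\<sigma> *\<^sub>R x)) \<le> M" if "\<bar>\<sigma> - s\<bar> < \<delta>1" for \<sigma>
    proof -
      have "\<sigma> \<in> ball s \<delta>1" using that by (simp add: dist_real_def)
      with sub have "\<sigma> \<in> J \<inter> (\<lambda>s. norm (\<Phi> (s *\<^sub>R x))) -` {..<M}" by blast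
      thus "\<sigma> \<in> J" "norm (\<Phi> (\<sigma> *\<^sub>R x)) \<le> M" by auto
    qed
    obtain T where T: "T \<ge> 0" "exp (lm * T) * M \<le> \<alpha> * (\<rho>' / 2)"
    proof -
      define q where "q = \<alpha> * (\<rho>' / 2) / M"
      have q: "q > 0" using \<alpha> \<rho> M by (simp add: q_def)
      \<comment> \<open>Since \<open>lm < 0\<close>, waiting until \<open>ln q / lm\<close> brings
        \<open>exp (lm * T)\<close> down to \<open>q\<close>.\<close>
      define T where "T = max 0 (ln q / lm)"
      have "lm * T \<le> ln q"
      proof -
        have "lm * T \<le> lm * (ln q / lm)" using lm(2) by (intro mult_left_mono_neg) (auto simp: T_def)
        thus ?thesis using lm(2) by simp
      qed
      hence "exp (lm * T) \<le> q" using q by (metis exp_le_cancel_iff exp_ln)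
      hence "exp (lm * T) * M \<le> \<alpha> * (\<rho>' / 2)" using M by (simp add: q_def field_simps)
      thus ?thesis using that[of T] by (simp add: T_def)
    qed
    define E where "E = exp (L * T) * (norm x + 1)"
    have E: "E > 0" using nx by (simp add: E_def)
    \<comment> \<open>A shift of the parameter by less than \<delta>2 moves the endpoint at time
      \<open>T\<close> by at most \<open>\<rho>' / 8\<close>.\<close>
    define \<delta>2 where "\<delta>2 = \<rho>' / (8 * E)"
    have \<delta>2: "\<delta>2 > 0" using \<rho> E by (simp add: \<delta>2_def)
    have lipx: "norm (flow T (\<sigma> *\<^sub>R x) - flow T (s *\<^sub>R x)) \<le> \<rho>' / 8"
      if "\<sigma> \<in> J" "\<bar>\<sigma> - s\<bar> < \<delta>2" for \<sigma>
    proof -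
      have "norm (flow T (\<sigma> *\<^sub>R x) - flow T (s *\<^sub>R x)) \<le> exp (L * T) * norm (\<sigma> *\<^sub>R x - s *\<^sub>R x)"
        using flow_diff_le[OF JX[OF that(1)] JX[OF s] T(1)] .
      also have "norm (\<sigma> *\<^sub>R x - s *\<^sub>R x) = \<bar>\<sigma> - s\<bar> * norm x" by (simp flip: scaleR_diff_left)
      also have "exp (L * T) * (\<bar>\<sigma> - s\<bar> * norm x) \<le> exp (L * T) * (\<delta>2 * (norm x + 1))"
        using that \<delta>2 by (intro mult_left_mono mult_mono) auto
      also have "\<dots> = E * \<delta>2" by (simp add: E_def)
      also have "\<dots> = \<rho>' / 8" using E by (simp add: \<delta>2_def)
      finally show ?thesis .
    qed
    define \<delta> where "\<delta> = min \<delta>1 \<delta>2"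
    have \<delta>: "\<delta> > 0" using \<delta>1 \<delta>2 by (simp add: \<delta>_def)
    obtain s0 where s0: "s0 \<in> G" "\<bar>s0 - s\<bar> < \<delta>" using lim[OF \<delta>] by blast
    have T_good: "transported T (\<sigma> *\<^sub>R x) \<and> norm (flow T (\<sigma> *\<^sub>R x)) \<le> \<rho>' / 2"
      if \<sigma>: "\<bar>\<sigma> - s\<bar> < \<delta>" and ex: "\<exists>T1. good \<sigma> T1" for \<sigma>
    proof -
      obtain T1 where T1: "good \<sigma> T1" using ex by blast
      show ?thesis
        by (rule uniform[of _ M T T1]) (use T1 near[of \<sigma>] \<sigma> T in \<open>auto simp: good_def \<delta>_def J_def\<close>)
    qed
    \<comment> \<open>Two such shifts, from \<open>s0\<close> to \<open>s\<close> and on to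
      \<sigma>, add at most \<open>\<rho>' / 4\<close> to the bound \<open>\<rho>' / 2\<close> at
      \<open>s0\<close>, so the endpoints are near the origin although good times are so far
      guaranteed only at points of \<open>G\<close>.\<close>
    have small: "norm (flow T (\<sigma> *\<^sub>R x)) < \<rho>'" if \<sigma>: "\<bar>\<sigma> - s\<bar> < \<delta>" for \<sigma>
    proof -
      have "norm (flow T (s0 *\<^sub>R x)) \<le> \<rho>' / 2" using T_good[OF s0(2) G_good[OF s0(1)]] by blast
      moreover have "norm (flow T (s0 *\<^sub>R x) - flow T (s *\<^sub>R x)) \<le> \<rho>' / 8"
        using lipx[of s0] s0(2) near[of s0] by (simp add: \<delta>_def)
      moreover have "norm (flow T (\<sigma> *\<^sub>R x) - flow T (s *\<^sub>R x)) \<le> \<rho>' / 8"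
        using lipx[of \<sigma>] \<sigma> near[of \<sigma>] by (simp add: \<delta>_def)
      ultimately show ?thesis
        using \<rho>(1) norm_triangle_ineq3[of "flow T (s0 *\<^sub>R x)" "flow T (s *\<^sub>R x)"]
          norm_triangle_ineq2[of "flow T (\<sigma> *\<^sub>R x)" "flow T (s *\<^sub>R x)"] by linarith
    qed
    have J\<delta>: "\<sigma> \<in> J" if "\<bar>\<sigma> - s\<bar> < \<delta>" for \<sigma> using near that by (simp add: \<delta>_def)
    \<comment> \<open>Near \<open>s0\<close> the relation holds by \<open>T_good\<close>. Since
      \<open>flow T\<close> is analytic in the parameter and ends in the cube on the whole interval,
      the difference is analytic there and must vanish.\<close>
    have trans: "\<phi> i (flow T (\<sigma> *\<^sub>R x)) - exp (lam i * of_real T) * \<phi> i (\<sigma> *\<^sub>R x) = 0"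
      if \<sigma>: "\<bar>\<sigma> - s\<bar> < \<delta>" for \<sigma> i
    proof -
      obtain \<delta>3 T3 where \<delta>3: "\<delta>3 > 0" "\<And>\<sigma>. \<bar>\<sigma> - s0\<bar> < \<delta>3 \<Longrightarrow> good \<sigma> T3"
        using s0(1) by (auto simp: G_def)
      show ?thesis
      proof (rule analytic_real_identity[where J = "{s - \<delta><..<s + \<delta>}" and e = "min \<delta>3 (\<delta> - \<bar>s0 - s\<bar>)" and ?s0.0 = s0])
        fix u assume "u \<in> {s - \<delta><..<s + \<delta>}"
        hence u: "\<bar>u - s\<bar> < \<delta>" by auto
        have "analytic_curve (\<lambda>s. flow T (s *\<^sub>R x)) u"
          by (rule flow_analytic[OF analytic_curve_line, of "\<delta> - \<bar>u - s\<bar>"]) (use u T(1) JX J\<delta> in auto)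
        moreover obtain a where "power_series_at (\<phi> i) (flow T (u *\<^sub>R x)) a"
          using \<phi>_analytic[of i] \<rho>_cube[of "flow T (u *\<^sub>R x)"] small[OF u] \<rho> by (auto simp: real_analytic_on_def)
        ultimately have 1: "analytic_real (\<lambda>s. \<phi> i (flow T (s *\<^sub>R x))) u"
          by (rule analytic_real_compose[rotated])
        obtain b where "power_series_at (\<phi> i) (u *\<^sub>R x) b"
          using \<phi>_analytic[of i] J\<delta>[OF u] by (auto simp: real_analytic_on_def J_def)
        hence 2: "analytic_real (\<lambda>s. \<phi> i (s *\<^sub>R x)) u"
          by (rule analytic_real_compose[OF _ analytic_curve_line])
        show "analytic_real (\<lambda>\<sigma>. \<phi> i (flow T (\<sigma> *\<^sub>R x)) - exp (lam i * of_real T) * \<phi> i (\<sigma> *\<^sub>R x)) u"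
          by (intro analytic_real_diff analytic_real_cmult 1 2)
      next
        fix u assume u: "\<bar>u - s0\<bar> < min \<delta>3 (\<delta> - \<bar>s0 - s\<bar>)"
        hence "\<bar>u - s\<bar> < \<delta>" by linarith
        from T_good[OF this] \<delta>3(2)[of u] u
        show "\<phi> i (flow T (u *\<^sub>R x)) - exp (lam i * of_real T) * \<phi> i (u *\<^sub>R x) = 0"
          by (auto simp: transported_def)
      qed (use s0 \<delta>3 \<sigma> in auto)
    qed
    have "good \<sigma> T" if "\<bar>\<sigma> - s\<bar> < \<delta>" for \<sigma>
      using J\<delta>[OF that] T(1) small[OF that] trans[OF that] by (simp add: good_def transported_def)
    thus ?thesis unfolding G_def using \<delta> by blast
  qed
  have "open (J - G)"
    unfolding open_dist
  proof
    fix s assume s: "s \<in> J - G"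
    then obtain \<epsilon> where \<epsilon>: "\<epsilon> > 0" "\<And>t. t \<in> G \<Longrightarrow> \<not> \<bar>t - s\<bar> < \<epsilon>" using G_closed[of s] by blast
    obtain d where d: "d > 0" "\<And>t. dist t s < d \<Longrightarrow> t \<in> J"
      using J(2) s by (auto simp: open_dist)
    show "\<exists>d>0. \<forall>t. dist t s < d \<longrightarrow> t \<in> J - G"
      using d \<epsilon> by (intro exI[of _ "min d \<epsilon>"]) (auto simp: dist_real_def)
  qed
  moreover have "0 \<in> J" "1 \<in> J" using zero_in_cube x by (auto simp: J_def)
  ultimately have "1 \<in> G"
    using J(1) G_open \<open>0 \<in> G\<close> unfolding connected_def by blast
  then obtain T where "good 1 T" using G_good by blast
  hence "T \<ge> 0" "norm (flow T x) < \<rho>'" by (auto simp: good_def)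
  thus ?thesis using attracted_if_reaches[of x T] conv x cube_sub by blast
qed

end

theorem proposition5:
  fixes F :: "real^'n::finite \<Rightarrow> real^'n"
    and X D \<Omega> :: "(real^'n) set"
    and flow :: "real \<Rightarrow> real^'n \<Rightarrow> real^'n"
    and lam :: "'n \<Rightarrow> complex"
    and \<phi> :: "'n \<Rightarrow> real^'n \<Rightarrow> complex"
    and V Vt :: "real^'n \<Rightarrow> real"
    and S \<epsilon>1 \<epsilon>2 lam_m \<gamma>1 \<gamma>2 :: real
    and N :: nat
  assumes "compact X"
    and "real_analytic_on F X"
    and "\<exists>L. L-lipschitz_on X F"
    and "is_flow F X flow"
    and "0 \<in> X" and "F 0 = 0"
    and "eigenvalue_family (jacobian F (at 0)) lam"
    and "\<And>i. Re (lam i) < 0"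
    and "nonresonant lam"
    and "S > 0" and "cube S \<subseteq> X"
    and "principal_eigenfunctions F (cube S) lam \<phi>"
    and "\<And>i. real_analytic_on (\<phi> i) (cube S)"
    and V_def: "V = (\<lambda>x. \<Sum>i\<in>UNIV. (cmod (\<phi> i x))\<^sup>2)"
    and Vt_def: "Vt = (\<lambda>x. \<Sum>i\<in>UNIV. (cmod (truncation N (\<phi> i) x))\<^sup>2)"
    and "D \<subseteq> X" and "D \<subseteq> cube S"
    and "\<And>x. x \<in> D \<Longrightarrow> \<bar>V x - Vt x\<bar> < \<epsilon>1"
    and "\<And>x. x \<in> D \<Longrightarrow> \<bar>generator F V x - generator F Vt x\<bar> < \<epsilon>2"
    and lam_m_def: "lam_m = Max (range (\<lambda>i. Re (lam i)))"
    and \<gamma>1_def: "\<gamma>1 = (- \<epsilon>2 - 2 * \<bar>lam_m\<bar> * \<epsilon>1) / (2 * lam_m)"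
    and "levels_in Vt (cube S) D \<noteq> {}"
    and \<gamma>2_def: "\<gamma>2 = Sup (levels_in Vt (cube S) D)"
    and \<Omega>_def: "\<Omega> = {x \<in> D. \<gamma>1 < Vt x \<and> Vt x < \<gamma>2}"
    and "\<Omega> \<noteq> {}"
  shows "\<Omega> \<subseteq> region_of_attraction X flow"
proof -
  obtain L where L: "L-lipschitz_on X F" using assms(3) by blast
  interpret koopman F X flow L S lam \<phi>
    by unfold_locales (use L assms in auto)
  show ?thesis
    using cube_attracted \<open>D \<subseteq> cube S\<close> by (auto simp: \<Omega>_def)
qed

end
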